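(* Let $M\in\mathbb N$, $\mathcal A\subset\mathbb Z_M=\{0,1,\dots,M-1\}$ with $\delta:=\frac{\log|\mathcal A|}{\log M}\in(0,1)$, and $\chi\in C_c^\infty((0,1);[0,1])$, and for $N=M^k$, $k\in\mathbb N$, let $B_N$ be the quantum open baker's map determined by $(M,\mathcal A,\chi)$. Let $\beta_E:=\tfrac34\left(\tfrac12-\delta\right)+\tfrac{\gamma_{\mathcal A}}{8}$, with $\gamma_{\mathcal A}>0$ the additive energy exponent. Then there exists $\beta>\tfrac12-\delta$ such that for each $\nu>0$ and $\varepsilon>0$ there is $C>0$ with $$\mathcal N_k(\nu)\le C\,N^{m(\nu,\delta)+\varepsilon}\qquad\text{as }k\to\infty$$ (i.e. for all sufficiently large $k$, where $N=M^k$), where $$m(\nu,\delta):=\min\left(4(\nu-\beta),\,4(\nu-\beta_E),\,2\left(\nu-\left(\tfrac12-\delta\right)\right),\,\delta\right)$$ and $\mathcal N_k(\nu)$ is the number of eigenvalues $\lambda$ of $B_N$, counted with multiplicity, satisfying $|\lambda|\ge M^{-\nu}$.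
   Context: For $N\in\mathbb N$ let $\mathbb Z_N=\mathbb Z/N\mathbb Z\simeq\{0,\dots,N-1\}$ and let $\ell^2_N$ be the space of functions $u:\mathbb Z_N\to\mathbb C$ with $\|u\|^2_{\ell^2_N}=\sum_{j=0}^{N-1}|u(j)|^2$. The unitary discrete Fourier transform is $(\mathcal F_Nu)(j)=\frac1{\sqrt N}\sum_{l=0}^{N-1}\exp\left(-\frac{2\pi i jl}{N}\right)u(l)$. For $N=M^k$, the quantum open baker's map $B_N:\ell^2_N\to\ell^2_N$ is $$B_N:=\mathcal F_N^*\,\operatorname{diag}\bigl(\chi_{N/M}\mathcal F_{N/M}\chi_{N/M},\dots,\chi_{N/M}\mathcal F_{N/M}\chi_{N/M}\bigr)\,I_{\mathcal A,M},$$ where the middle factor is block diagonal with $M$ identical blocks of size $N/M$; $\chi_{N/M}$ acts as multiplication by the function $\chi_{N/M}(j)=\chi(Mj/N)$, $j\in\{0,\dots,N/M-1\}$; and $I_{\mathcal A,M}$ is the diagonal $N\times N$ matrix whose $j$-th entry is $1$ if $\lfloor Mj/N\rfloor\in\mathcal A$ and $0$ otherwise. Put $C_k:=\left\{\sum_{j=0}^{k-1}a_jM^j:\ a_0,\dots,a_{k-1}\in\mathcal A\right\}\subset\mathbb Z_N$ ($N=M^k$). For $X\subset\mathbb Z_N$ its additive energy is $E_{\mathcal A}(X):=|\{(a,b,c,d)\in X^4:\ a+b\equiv c+d \pmod N\}|$. The constant $\gamma_{\mathcal A}>0$ (its existence is a theorem of Dyatlov--Jin) is such that for any $\varepsilon>0$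 there is $C_\varepsilon>0$ with $E_{\mathcal A}(C_k)\le C_\varepsilon N^{3\delta-\gamma_{\mathcal A}+\varepsilon}$ for all $k$. *)

theory Defs
  imports
    Complex_Main
    "HOL-Number_Theory.Cong"
    "HOL-Analysis.Derivative"
    "Jordan_Normal_Form.Char_Poly"
    "Jordan_Normal_Form.Schur_Decomposition"
begin

definition smooth_cutoff :: "(real \<Rightarrow> real) \<Rightarrow> bool" where
  "smooth_cutoff chi \<longleftrightarrow>
     (\<forall>n x. (deriv ^^ n) chi field_differentiable (at x)) \<and>
     compact (closure {x. chi x \<noteq> 0}) \<and>
     closure {x. chi x \<noteq> 0} \<subseteq> {0<..<1} \<and>
     range chi \<subseteq> {0..1}"

text \<open>Elements of Z/NZ are represented by the naturals below N, and operators on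
  functions on Z/NZ by their N x N matrices in the standard basis.\<close>

definition dft_mat :: "nat \<Rightarrow> complex mat" where
  "dft_mat N = Matrix.mat N N (\<lambda>(j, l).
     complex_of_real (1 / sqrt (real N)) *
     exp (- (2 * complex_of_real pi * \<i> * of_nat j * of_nat l) / of_nat N))"

text \<open>The multiplication operator on functions on Z/LZ by the values of the cutoff at
  j / L; for L = N / M this is the value at M j / N.\<close>

definition cutoff_mat :: "(real \<Rightarrow> real) \<Rightarrow> nat \<Rightarrow> complex mat" where
  "cutoff_mat chi L = mat_diag L (\<lambda>j. complex_of_real (chi (real j / real L)))"

definition alphabet_mat :: "nat \<Rightarrow> nat set \<Rightarrow> nat \<Rightarrow> complex mat" where
  "alphabet_mat M A N = mat_diag N (\<lambda>j. if (M * j) div N \<in> A then 1 else 0)"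

text \<open>The open baker's map with N = M ^ k.  It is meaningful for k > 0 only, since the
  block size is N / M.\<close>

definition open_baker_map :: "nat \<Rightarrow> nat set \<Rightarrow> (real \<Rightarrow> real) \<Rightarrow> nat \<Rightarrow> complex mat" where
  "open_baker_map M A chi k =
     (let N = M ^ k; L = N div M in
        mat_adjoint (dft_mat N)
        * diag_block_mat (replicate M (cutoff_mat chi L * dft_mat L * cutoff_mat chi L))
        * alphabet_mat M A N)"

text \<open>Eigenvalues of modulus at least M powr (- \<nu>), counted with algebraic multiplicity.\<close>

definition eigenvalue_count ::
  "nat \<Rightarrow> nat set \<Rightarrow> (real \<Rightarrow> real) \<Rightarrow> nat \<Rightarrow> real \<Rightarrow> nat" where
  "eigenvalue_count M A chi k \<nu> =
     (\<Sum>z | eigenvalue (open_baker_map M A chi k) z \<and> cmod z \<ge> real M powr (- \<nu>).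
        order z (char_poly (open_baker_map M A chi k)))"

definition cantor_set :: "nat \<Rightarrow> nat set \<Rightarrow> nat \<Rightarrow> nat set" where
  "cantor_set M A k = {\<Sum>j<k. a j * M ^ j | a. \<forall>j<k. a j \<in> A}"

definition additive_energy :: "nat \<Rightarrow> nat set \<Rightarrow> nat" where
  "additive_energy N X =
     card {(a, b, c, d). a \<in> X \<and> b \<in> X \<and> c \<in> X \<and> d \<in> X \<and> [a + b = c + d] (mod N)}"

definition cantor_dim :: "nat \<Rightarrow> nat set \<Rightarrow> real" where
  "cantor_dim M A = ln (real (card A)) / ln (real M)"

definition additive_energy_exponent :: "nat \<Rightarrow> nat set \<Rightarrow> real \<Rightarrow> bool" where
  "additive_energy_exponent M A \<gamma> \<longleftrightarrow>
     \<gamma> > 0 \<and>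
     (\<forall>\<epsilon>>0. \<exists>C>0. \<forall>k.
        real (additive_energy (M ^ k) (cantor_set M A k))
          \<le> C * real (M ^ k) powr (3 * cantor_dim M A - \<gamma> + \<epsilon>))"

definition beta_E :: "real \<Rightarrow> real \<Rightarrow> real" where
  "beta_E \<delta> \<gamma> = 3 / 4 * (1 / 2 - \<delta>) + \<gamma> / 8"

definition weyl_exponent :: "real \<Rightarrow> real \<Rightarrow> real \<Rightarrow> real \<Rightarrow> real" where
  "weyl_exponent \<beta> \<beta>\<^sub>E \<nu> \<delta> =
     Min {4 * (\<nu> - \<beta>), 4 * (\<nu> - \<beta>\<^sub>E), 2 * (\<nu> - (1 / 2 - \<delta>)), \<delta>}"

end

theory Submission
  imports Defs "HOL-Complex_Analysis.Conformal_Mappings"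
begin

text \<open>Let \<open>K = B\<^sup>k\<close>, \<open>N = M\<^sup>k\<close>, let \<open>F\<close> be the Fourier transform and \<open>Q\<close> the indicator of the
  \<open>N\<^sup>\<kappa>\<close>-neighbourhood \<open>X\<close> of the Cantor set.  Non-stationary phase gives \<open>K = K Q\<close> up to an
  error smaller than any power of \<open>N\<close>; since \<open>F B F\<^sup>* = B\<^sup>T\<close>, this also localizes \<open>K\<close> in
  frequency.  Conjugation by a diagonal matrix then shows that \<open>K\<close> is similar to \<open>Q H G\<close> up to a
  tiny error, where \<open>H\<close> is a contraction and \<open>G = Q F\<^sup>* Q\<close>.  By Schur's inequality the
  eigenvalues \<open>\<lambda>\<close> of \<open>B\<close> satisfy \<open>\<Sum> \<bar>\<lambda>\<bar>\<^bsup>2k\<^esup> \<lesssim> \<parallel>G\<parallel>\<^sub>H\<^sub>S\<^sup>2\<close> and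
  \<open>\<Sum> \<bar>\<lambda>\<bar>\<^bsup>4k\<^esup> \<lesssim> \<parallel>G\<^sup>* G\<parallel>\<^sub>H\<^sub>S\<^sup>2\<close>.  The first norm is \<open>card X / N\<^bsup>1/2\<^esup>\<close>.  The second reduces to an
  exponential sum over the Cantor set, which is at most \<open>N\<^bsup>1/2\<^esup>\<close> times the additive energy and
  which, as a Riesz product, beats the trivial bound by a power of \<open>N\<close>: this gives \<open>\<beta>\<close>.  The
  bound \<open>\<delta>\<close> holds because all but \<open>card X\<close> rows of \<open>K\<^sup>T\<close> are tiny, which by
  the maximum principle for the characteristic polynomial leaves \<open>O(card X)\<close> eigenvalues that
  are not.\<close>

section \<open>The Hilbert--Schmidt norm\<close>

text \<open>After \<open>k\<close> steps the expansion by \<open>M\<close> has resolved position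
  down to single sites: the condition \<open>\<bar>\<lambda>\<bar> \<ge> M powr (- \<nu>)\<close>
  turns into \<open>\<bar>\<lambda> ^ k\<bar> \<ge> N powr (- \<nu>)\<close>, and the Cantor set
  needs thickening only by about \<open>N powr \<kappa>\<close>. The obstacle is that
  \<open>K\<close> need not be normal, so a tiny error in it is not known to move its eigenvalues
  little. Hence eigenvalues are never perturbed: Schur's inequality is applied to a matrix with
  exactly the spectrum of \<open>K\<close>, and to its square, and only Hilbert--Schmidt norms are
  compared with those of \<open>Q H G\<close>. The conjugation is not unitary and costs powers of
  \<open>N\<close>; this is harmless because the localization error is \<open>N powr (- P)\<close>
  with \<open>P\<close> free. The thickening costs powers of \<open>N powr \<kappa>\<close>, which
  make up the \<epsilon> of the statement. The gain \<beta> rests on uniformity: a saving on a fixed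
  number of digits, whatever the earlier digits are, iterates to a power of
  \<open>N\<close>.\<close>

definition hs :: "complex mat \<Rightarrow> real" where
  "hs A = L2_set (\<lambda>p. cmod (A $$ p)) ({..<dim_row A} \<times> {..<dim_col A})"

definition tr :: "complex mat \<Rightarrow> complex" where
  "tr A = (\<Sum>i<dim_row A. A $$ (i, i))"

lemma hs_nonneg [simp]: "0 \<le> hs A"
  by (simp add: hs_def)

lemma hs_eq:
  "A \<in> carrier_mat n m \<Longrightarrow>
    hs A = L2_set (\<lambda>p. cmod (A $$ p)) ({..<n} \<times> {..<m})"
  by (auto simp: hs_def)

lemma hs_sq:
  "A \<in> carrier_mat n m \<Longrightarrow> (hs A)\<^sup>2 = (\<Sum>i<n. \<Sum>j<m. (cmod (A $$ (i, j)))\<^sup>2)"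
  by (simp add: hs_eq L2_set_def sum_nonneg case_prod_unfold sum.cartesian_product)

lemma hs_triangle:
  assumes "A \<in> carrier_mat n m" "B \<in> carrier_mat n m"
  shows "hs (A + B) \<le> hs A + hs B"
proof -
  have "hs (A + B) \<le> L2_set (\<lambda>p. cmod (A $$ p) + cmod (B $$ p)) ({..<n} \<times> {..<m})"
    using assms by (subst hs_eq[of _ n m]) (auto intro!: L2_set_mono norm_triangle_ineq)
  also have "\<dots> \<le> hs A + hs B"
    using assms by (simp add: hs_eq[of _ n m] L2_set_triangle_ineq)
  finally show ?thesis .
qed

lemma hs_mono:
  assumes "A \<in> carrier_mat n m" "B \<in> carrier_mat n m"
    and "\<And>i j. i < n \<Longrightarrow> j < m \<Longrightarrow> cmod (A $$ (i, j)) \<le> cmod (B $$ (i, j))"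
  shows "hs A \<le> hs B"
  using assms by (auto simp: hs_eq[of _ n m] intro!: L2_set_mono)

lemma hs_le_entry:
  assumes "A \<in> carrier_mat n n" "0 \<le> c"
    and "\<And>i j. i < n \<Longrightarrow> j < n \<Longrightarrow> cmod (A $$ (i, j)) \<le> c"
  shows "hs A \<le> real n * c"
proof -
  have "(hs A)\<^sup>2 \<le> (\<Sum>i<n. \<Sum>j<n. c\<^sup>2)"
    unfolding hs_sq[OF assms(1)] using assms by (intro sum_mono power_mono) auto
  also have "\<dots> = (real n * c)\<^sup>2" by (simp add: power2_eq_square)
  finally show ?thesis using assms(2) by (simp add: power2_le_iff_abs_le)
qed

lemma entry_le_hs:
  assumes "A \<in> carrier_mat n m" "i < n" "j < m"
  shows "cmod (A $$ (i, j)) \<le> hs A"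
  using member_le_L2_set[of "{..<n} \<times> {..<m}" "(i, j)" "\<lambda>p. cmod (A $$ p)"] assms
  by (simp add: hs_eq[of _ n m])

section \<open>Adjoints, the trace pairing and unitary invariance\<close>

lemma mat_adjoint_carrier [simp]:
  "mat_adjoint (A :: complex mat) \<in> carrier_mat n m \<longleftrightarrow> A \<in> carrier_mat m n"
  unfolding mat_adjoint_def carrier_mat_def mem_Collect_eq mat_of_rows_carrier(2,3) length_map cols_length by blast

lemma mat_adjoint_index:
  "A \<in> carrier_mat n m \<Longrightarrow> i < m \<Longrightarrow> j < n \<Longrightarrow>
    mat_adjoint (A :: complex mat) $$ (i, j) = cnj (A $$ (j, i))"
  by (auto simp: mat_adjoint_def mat_of_rows_def conjugate_complex_def)

lemma mat_adjoint_adjoint [simp]: "mat_adjoint (mat_adjoint (A :: complex mat)) = A"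
proof (rule eq_matI)
  have A: "A \<in> carrier_mat (dim_row A) (dim_col A)" by auto
  have A': "mat_adjoint A \<in> carrier_mat (dim_col A) (dim_row A)" by simp
  fix i j assume "i < dim_row A" "j < dim_col A"
  then show "mat_adjoint (mat_adjoint A) $$ (i, j) = A $$ (i, j)"
    by (simp add: mat_adjoint_index[OF A'] mat_adjoint_index[OF A])
qed (auto simp: mat_adjoint_def)

lemma mult_mat_index:
  assumes "A \<in> carrier_mat n k" "B \<in> carrier_mat k m" "i < n" "j < m"
  shows "(A * B) $$ (i, j) = (\<Sum>l<k. A $$ (i, l) * B $$ (l, j))"
  using assms by (auto simp: scalar_prod_def atLeast0LessThan)

lemma mat_adjoint_mult:
  assumes A: "A \<in> carrier_mat n k" and B: "B \<in> carrier_mat k m"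
  shows "mat_adjoint (A * B :: complex mat) = mat_adjoint B * mat_adjoint A"
proof (rule eq_matI)
  have AB: "A * B \<in> carrier_mat n m" using A B by auto
  have A': "mat_adjoint A \<in> carrier_mat k n" and B': "mat_adjoint B \<in> carrier_mat m k"
    using A B by auto
  fix i j assume "i < dim_row (mat_adjoint B * mat_adjoint A)"
    "j < dim_col (mat_adjoint B * mat_adjoint A)"
  then have ij: "i < m" "j < n" using A' B' by (auto simp del: mat_adjoint_carrier)
  show "mat_adjoint (A * B) $$ (i, j) = (mat_adjoint B * mat_adjoint A) $$ (i, j)"
    using ij A B
    by (simp add: mat_adjoint_index[OF AB] mult_mat_index[OF A B] mult_mat_index[OF B' A']
        mat_adjoint_index[OF A] mat_adjoint_index[OF B] mult.commute del: index_mult_mat(1))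
qed (use A B in \<open>auto simp: mat_adjoint_def\<close>)

lemma tr_comm:
  assumes A: "A \<in> carrier_mat n m" and B: "B \<in> carrier_mat m n"
  shows "tr (A * B) = tr (B * A)"
proof -
  have "tr (A * B) = (\<Sum>i<n. \<Sum>l<m. A $$ (i, l) * B $$ (l, i))"
    using A by (simp add: tr_def mult_mat_index[OF A B] del: index_mult_mat(1))
  also have "\<dots> = (\<Sum>l<m. \<Sum>i<n. B $$ (l, i) * A $$ (i, l))"
    by (subst sum.swap) (simp add: mult.commute)
  also have "\<dots> = tr (B * A)"
    using B by (simp add: tr_def mult_mat_index[OF B A] del: index_mult_mat(1))
  finally show ?thesis .
qed

lemma hs_adjoint [simp]: "hs (mat_adjoint A) = hs A"
proof -
  define n m where "n = dim_row A" and "m = dim_col A"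
  have A: "A \<in> carrier_mat n m" and A': "mat_adjoint A \<in> carrier_mat m n"
    by (auto simp: n_def m_def)
  have "(hs (mat_adjoint A))\<^sup>2 = (hs A)\<^sup>2"
    unfolding hs_sq[OF A] hs_sq[OF A']
    by (subst sum.swap) (simp add: mat_adjoint_index[OF A])
  then show ?thesis by simp
qed

lemma hs_transpose [simp]: "hs (transpose_mat A) = hs A"
proof -
  define n m where "n = dim_row A" and "m = dim_col A"
  have A: "A \<in> carrier_mat n m" and A': "transpose_mat A \<in> carrier_mat m n"
    by (auto simp: n_def m_def)
  have "(hs (transpose_mat A))\<^sup>2 = (hs A)\<^sup>2"
    unfolding hs_sq[OF A] hs_sq[OF A']
    by (subst sum.swap) (use A in simp)
  then show ?thesis by simp
qed

lemma cmod_tr_mult_le: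
  assumes A: "A \<in> carrier_mat n m" and B: "B \<in> carrier_mat m n"
  shows "cmod (tr (A * B)) \<le> hs A * hs B"
proof -
  have "tr (A * B) = (\<Sum>i<n. \<Sum>l<m. A $$ (i, l) * B $$ (l, i))"
    using A by (simp add: tr_def mult_mat_index[OF A B] del: index_mult_mat(1))
  also have "\<dots> = (\<Sum>(i, l)\<in>{..<n} \<times> {..<m}. A $$ (i, l) * B $$ (l, i))"
    by (simp add: sum.cartesian_product)
  finally have "cmod (tr (A * B)) \<le>
      (\<Sum>(i, l)\<in>{..<n} \<times> {..<m}. cmod (A $$ (i, l)) * cmod (B $$ (l, i)))"
    by (auto simp: case_prod_unfold norm_mult intro: order_trans[OF norm_sum])
  also have "\<dots> \<le> L2_set (\<lambda>p. cmod (A $$ p)) ({..<n} \<times> {..<m}) *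
      L2_set (\<lambda>p. cmod (transpose_mat B $$ p)) ({..<n} \<times> {..<m})"
    using B by (intro order_trans[OF _ L2_set_mult_ineq] sum_mono) auto
  also have "\<dots> = hs A * hs B"
  proof -
    have "transpose_mat B \<in> carrier_mat n m" using B by simp
    then show ?thesis using hs_eq[OF A] hs_eq[of "transpose_mat B" n m] by simp
  qed
  finally show ?thesis .
qed

lemma hs_sq_tr:
  assumes A: "A \<in> carrier_mat n m"
  shows "complex_of_real ((hs A)\<^sup>2) = tr (mat_adjoint A * A)"
proof -
  have A': "mat_adjoint A \<in> carrier_mat m n" using A by simp
  have "tr (mat_adjoint A * A) = (\<Sum>j<m. \<Sum>i<n. cnj (A $$ (i, j)) * A $$ (i, j))"
    using A A' by (simp add: tr_def mult_mat_index[OF A' A] mat_adjoint_index[OF A]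
        carrier_matD(1)[OF A'] del: index_mult_mat(1) mat_adjoint_carrier)
  also have "\<dots> = (\<Sum>i<n. \<Sum>j<m. complex_of_real ((cmod (A $$ (i, j)))\<^sup>2))"
    by (subst sum.swap) (simp only: complex_norm_square mult.commute)
  finally show ?thesis by (simp add: hs_sq[OF A])
qed

lemma hs_unitary_mult:
  assumes U: "U \<in> carrier_mat n n" "mat_adjoint U * U = 1\<^sub>m n" and X: "X \<in> carrier_mat n m"
  shows "hs (U * X) = hs X"
proof -
  have c: "mat_adjoint U \<in> carrier_mat n n" "mat_adjoint X \<in> carrier_mat m n" "U * X \<in> carrier_mat n m"
    using U X by auto
  have "mat_adjoint U * (U * X) = X"
    using assoc_mult_mat[OF c(1) U(1) X] U X by simp
  then have "mat_adjoint X * mat_adjoint U * (U * X) = mat_adjoint X * X"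
    using assoc_mult_mat[OF c(2,1,3)] by simp
  then have "mat_adjoint (U * X) * (U * X) = mat_adjoint X * X"
    using mat_adjoint_mult[OF U(1) X] by simp
  then have "complex_of_real ((hs (U * X))\<^sup>2) = complex_of_real ((hs X)\<^sup>2)"
    using hs_sq_tr[OF X] hs_sq_tr[OF c(3)] by simp
  then show ?thesis by (simp del: of_real_power)
qed

subsection \<open>Contractions\<close>

text \<open>Operator norm at most 1, phrased without vectors: the squared Hilbert--Schmidt norm is a
  sum over the columns of \<open>Y\<close>, and a \<open>Y\<close> with one nonzero column is a
  single vector. In this form contractions can be peeled off inside \<open>hs\<close>.\<close>

definition contraction :: "nat \<Rightarrow> complex mat \<Rightarrow> bool" where
  "contraction n A \<longleftrightarrow>
    A \<in> carrier_mat n n \<and> (\<forall>Y \<in> carrier_mat n n. hs (A * Y) \<le> hs Y)"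

lemma contractionD:
  "contraction n A \<Longrightarrow> A \<in> carrier_mat n n"
  "contraction n A \<Longrightarrow> Y \<in> carrier_mat n n \<Longrightarrow> hs (A * Y) \<le> hs Y"
  by (auto simp: contraction_def)

lemma contraction_unitary:
  "U \<in> carrier_mat n n \<Longrightarrow> mat_adjoint U * U = 1\<^sub>m n \<Longrightarrow> contraction n U"
  by (simp add: contraction_def hs_unitary_mult)

lemma contraction_diag:
  assumes "\<And>i. i < n \<Longrightarrow> cmod (d i) \<le> 1"
  shows "contraction n (mat_diag n d)"
  unfolding contraction_def
proof (intro conjI ballI)
  fix Y :: "complex mat" assume Y: "Y \<in> carrier_mat n n"
  show "hs (mat_diag n d * Y) \<le> hs Y"
    using assms Y by (intro hs_mono[of _ n n])
      (auto simp: mat_diag_mult_left[OF Y] norm_mult intro: mult_left_le_one_le)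
qed simp

lemma contraction_mult:
  assumes "contraction n A" "contraction n B"
  shows "contraction n (A * B)"
proof -
  have c: "A \<in> carrier_mat n n" "B \<in> carrier_mat n n" using assms contractionD by auto
  have "hs (A * B * Y) \<le> hs Y" if Y: "Y \<in> carrier_mat n n" for Y
  proof -
    have "hs (A * B * Y) = hs (A * (B * Y))" using c Y by (simp add: assoc_mult_mat[of _ n n _ n _ n])
    also have "\<dots> \<le> hs (B * Y)" using assms c Y by (intro contractionD(2)) auto
    also have "\<dots> \<le> hs Y" using assms Y by (intro contractionD(2))
    finally show ?thesis .
  qed
  then show ?thesis using c by (auto simp: contraction_def)
qed

lemma contraction_one: "contraction n (1\<^sub>m n)"
  by (simp add: contraction_def)

lemma contraction_pow:
  assumes "contraction n A" shows "contraction n (A ^\<^sub>m k)"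
proof (induction k)
  case 0 then show ?case using assms contractionD(1)[OF assms] by (auto simp: contraction_one)
next
  case (Suc k) then show ?case using assms by (simp add: contraction_mult)
qed

text \<open>Duality: with \<open>Z = mat_adjoint A * Y\<close>, the square of \<open>hs Z\<close> is
  the trace of \<open>mat_adjoint Y * (A * Z)\<close>, hence at most \<open>hs Y * hs Z\<close>.
  This is what allows contractions to be removed on the right as well.\<close>

lemma contraction_adjoint:
  assumes "contraction n A" shows "contraction n (mat_adjoint A)"
proof -
  have A: "A \<in> carrier_mat n n" and A': "mat_adjoint A \<in> carrier_mat n n"
    using contractionD[OF assms] by auto
  have "hs (mat_adjoint A * Y) \<le> hs Y" if Y: "Y \<in> carrier_mat n n" for Y
  proof -
    define Z where "Z = mat_adjoint A * Y"
    have Z: "Z \<in> carrier_mat n n" using A' Y by (auto simp: Z_def)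
    have Y': "mat_adjoint Y \<in> carrier_mat n n" using Y by simp
    have "mat_adjoint Z * Z = mat_adjoint Y * (A * Z)"
      using A A' Y Y' Z
      by (simp add: Z_def mat_adjoint_mult[of _ n n _ n] assoc_mult_mat[of _ n n _ n _ n]
          del: mat_adjoint_carrier)
    then have "complex_of_real ((hs Z)\<^sup>2) = tr (mat_adjoint Y * (A * Z))"
      using hs_sq_tr[OF Z] by simp
    then have "(hs Z)\<^sup>2 = cmod (tr (mat_adjoint Y * (A * Z)))"
      by (metis abs_power2 norm_of_real)
    also have "\<dots> \<le> hs (mat_adjoint Y) * hs (A * Z)"
      using A Z Y' by (intro cmod_tr_mult_le) auto
    also have "\<dots> \<le> hs Y * hs Z"
      using contractionD(2)[OF assms Z] by (simp add: mult_left_mono)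
    finally have "hs Z * hs Z \<le> hs Y * hs Z" by (simp add: power2_eq_square)
    then show ?thesis
      unfolding Z_def[symmetric] using hs_nonneg[of Z] hs_nonneg[of Y]
      by (cases "hs Z = 0") (auto simp: mult_le_cancel_right)
  qed
  then show ?thesis using A' by (auto simp: contraction_def)
qed

lemma contraction_right:
  assumes "contraction n A" and Y: "Y \<in> carrier_mat n n"
  shows "hs (Y * A) \<le> hs Y"
proof -
  have A: "A \<in> carrier_mat n n" using contractionD assms by auto
  have "hs (Y * A) = hs (mat_adjoint (Y * A))" by simp
  also have "\<dots> = hs (mat_adjoint A * mat_adjoint Y)" using A Y by (simp add: mat_adjoint_mult[of _ n n _ n])
  also have "\<dots> \<le> hs (mat_adjoint Y)"
    using Y contraction_adjoint[OF assms(1)] by (intro contractionD(2)) auto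
  finally show ?thesis by simp
qed

lemma hs_one: "hs (1\<^sub>m n) = sqrt (real n)"
proof -
  have "(hs (1\<^sub>m n))\<^sup>2 = (\<Sum>i<n. \<Sum>j<n. if i = j then 1 else 0)"
    by (subst hs_sq[of _ n n]) (auto intro!: sum.cong simp del: sum.delta sum.delta')
  also have "\<dots> = real n" by simp
  finally show ?thesis by (metis hs_nonneg real_sqrt_abs abs_of_nonneg)
qed

lemma contraction_hs:
  assumes "contraction n A" shows "hs A \<le> sqrt (real n)"
  using contractionD(2)[OF assms, of "1\<^sub>m n"] contractionD(1)[OF assms] by (simp add: hs_one)

lemma hs_mult_le:
  assumes A: "A \<in> carrier_mat n k" and B: "B \<in> carrier_mat k m"
  shows "hs (A * B) \<le> hs A * hs B"
proof -
  have AB: "A * B \<in> carrier_mat n m" using A B by auto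
  have "(hs (A * B))\<^sup>2 \<le> (\<Sum>i<n. \<Sum>j<m. (\<Sum>l<k. (cmod (A $$ (i, l)))\<^sup>2) * (\<Sum>l<k. (cmod (B $$ (l, j)))\<^sup>2))"
    unfolding hs_sq[OF AB]
  proof (intro sum_mono)
    fix i j assume ij: "i \<in> {..<n}" "j \<in> {..<m}"
    have "cmod ((A * B) $$ (i, j)) \<le> (\<Sum>l<k. cmod (A $$ (i, l)) * cmod (B $$ (l, j)))"
      using ij by (simp add: mult_mat_index[OF A B] del: index_mult_mat(1))
        (auto simp: norm_mult intro: order_trans[OF norm_sum])
    then have "(cmod ((A * B) $$ (i, j)))\<^sup>2 \<le> (\<Sum>l<k. cmod (A $$ (i, l)) * cmod (B $$ (l, j)))\<^sup>2"
      by (intro power_mono) auto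
    also have "\<dots> \<le> (\<Sum>l<k. (cmod (A $$ (i, l)))\<^sup>2) * (\<Sum>l<k. (cmod (B $$ (l, j)))\<^sup>2)"
      by (rule Cauchy_Schwarz_ineq_sum)
    finally show "(cmod ((A * B) $$ (i, j)))\<^sup>2 \<le> \<dots>" .
  qed
  also have "\<dots> = (hs A * hs B)\<^sup>2"
    unfolding power_mult_distrib hs_sq[OF A] hs_sq[OF B]
    by (simp add: sum_product sum.swap[of _ "{..<m}" "{..<k}"])
  finally show ?thesis by (simp add: power2_le_iff_abs_le)
qed

section \<open>Eigenvalues and the Hilbert--Schmidt norm\<close>

text \<open>One deflation step for Schur's inequality. Mere invertibility of the change of basis
  would not do, since the Hilbert--Schmidt norm must survive it.\<close>

lemma unitary_with_first_column:
  fixes v :: "complex vec"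
  assumes v: "v \<in> carrier_vec n" "v \<noteq> 0\<^sub>v n" and n: "0 < n"
  obtains U c where "U \<in> carrier_mat n n" "mat_adjoint U * U = 1\<^sub>m n" "col U 0 = c \<cdot>\<^sub>v v"
proof -
  interpret cof_vec_space n "TYPE(complex)" .
  define b where "b = basis_completion v"
  define ws where "ws = gram_schmidt n b"
  define W where "W = mat_of_cols n ws"
  from basis_completion[OF v, folded b_def]
  have dist_b: "distinct b" and indep: "\<not> lin_dep (set b)" and b: "set b \<subseteq> carrier_vec n"
    and hdb: "hd b = v" and len_b: "length b = n" by auto
  from hdb len_b n obtain vs where bv: "b = v # vs" by (cases b) auto
  from gram_schmidt_result[OF b dist_b indep refl, folded ws_def]
  have ws: "set ws \<subseteq> carrier_vec n" "corthogonal ws" "length ws = n"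
    by (auto simp: len_b)
  have hdws: "hd ws = v" using gram_schmidt_hd[OF v(1), of vs] by (simp add: ws_def bv)
  have W: "W \<in> carrier_mat n n"
    using ws unfolding W_def using mat_of_cols_carrier(1)[of n ws] by auto
  have colW: "col W j = ws ! j" if "j < n" for j
    using that ws unfolding W_def by (simp add: subset_eq)
  have ort: "(\<Sum>l<n. cnj (W $$ (l, i)) * W $$ (l, j)) = 0 \<longleftrightarrow> i \<noteq> j" if "i < n" "j < n" for i j
  proof -
    have "ws ! j \<bullet>c ws ! i = 0 \<longleftrightarrow> j \<noteq> i"
      using corthogonalD[OF ws(2)] that ws(3) by simp
    moreover have "ws ! j \<bullet>c ws ! i = (\<Sum>l<n. cnj (W $$ (l, i)) * W $$ (l, j))"
      using that W unfolding colW[OF that(1), symmetric] colW[OF that(2), symmetric]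
      by (simp add: scalar_prod_def atLeast0LessThan conjugate_complex_def mult.commute)
    ultimately show ?thesis by auto
  qed
  \<comment> \<open>The Gram--Schmidt columns are orthogonal but not normalized; dividing column
    \<open>j\<close> by the root of \<open>s j\<close> only rescales \<open>v\<close> in the first
    column.\<close>
  define s where "s j = (\<Sum>l<n. (cmod (W $$ (l, j)))\<^sup>2)" for j
  have s: "(\<Sum>l<n. cnj (W $$ (l, j)) * W $$ (l, j)) = complex_of_real (s j)" for j
    unfolding s_def of_real_sum by (simp only: complex_norm_square mult.commute)
  have s_pos: "s j > 0" if "j < n" for j
  proof -
    have "complex_of_real (s j) \<noteq> 0" using ort[OF that that] s[of j] by simp
    moreover have "s j \<ge> 0" unfolding s_def by (intro sum_nonneg) auto
    ultimately show ?thesis by simp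
  qed
  define d where "d j = complex_of_real (1 / sqrt (s j))" for j
  define U where "U = W * mat_diag n d"
  have U: "U \<in> carrier_mat n n" using W by (simp add: U_def)
  have Uij: "U $$ (i, j) = W $$ (i, j) * d j" if "i < n" "j < n" for i j
    using that by (simp add: U_def mat_diag_mult_right[OF W])
  have U': "mat_adjoint U \<in> carrier_mat n n" using U by simp
  have "(mat_adjoint U * U) $$ (i, j) = (if i = j then 1 else 0)" if ij: "i < n" "j < n" for i j
  proof -
    have "(mat_adjoint U * U) $$ (i, j) =
        cnj (d i) * d j * (\<Sum>l<n. cnj (W $$ (l, i)) * W $$ (l, j))"
      using ij by (simp add: mult_mat_index[OF U' U] mat_adjoint_index[OF U] Uij sum_distrib_left
          mult_ac del: index_mult_mat(1))
    also have "\<dots> = (if i = j then 1 else 0)"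
    proof (cases "i = j")
      case True
      have "cnj (d j) * d j * complex_of_real (s j) = complex_of_real (1 / sqrt (s j) * (1 / sqrt (s j)) * s j)"
        by (simp only: d_def complex_cnj_complex_of_real of_real_mult)
      also have "1 / sqrt (s j) * (1 / sqrt (s j)) * s j = 1"
        using s_pos[OF ij(2)] by (simp add: field_simps)
      finally show ?thesis using True by (simp add: s)
    next
      case False then show ?thesis using ort[OF ij] by simp
    qed
    finally show ?thesis .
  qed
  then have UU: "mat_adjoint U * U = 1\<^sub>m n"
    using U U' by (intro eq_matI) (auto simp del: mat_adjoint_carrier)
  have "col U 0 = d 0 \<cdot>\<^sub>v v"
  proof (rule eq_vecI)
    have "col W 0 = v" using colW[OF n] hdws ws(3) n by (cases ws) auto
    then have "v $ i = W $$ (i, 0)" if "i < n" for i using that W n by (auto simp: col_def)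
    then show "col U 0 $ i = (d 0 \<cdot>\<^sub>v v) $ i" if "i < dim_vec (d 0 \<cdot>\<^sub>v v)" for i
      using that v U n by (simp add: Uij)
  qed (use U v in auto)
  then show thesis using that[OF U UU] by blast
qed

text \<open>In a unitary basis beginning with an eigenvector, the first column is \<open>e\<close>
  followed by zeros, and the lower right block carries the remaining roots. The inequality comes
  from the rest of the first row, which is thrown away.\<close>

theorem schur_inequality:
  assumes "A \<in> carrier_mat n n" "char_poly A = (\<Prod>e\<leftarrow>es. [:- e, 1:])"
  shows "(\<Sum>e\<leftarrow>es. (cmod e)\<^sup>2) \<le> (hs A)\<^sup>2"
  using assms
proof (induct es arbitrary: n A)
  case Nil then show ?case by simp
next
  case (Cons e es)
  let ?n1 = "n - 1"
  note A = Cons(2)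
  have cp: "char_poly A = [:- e, 1:] * (\<Prod>e\<leftarrow>es. [:- e, 1:])" using Cons(3) by simp
  have "monic (\<Prod>e\<leftarrow>es. [:- e, 1:])" by (rule monic_prod_list) auto
  then have "degree (char_poly A) = Suc (degree (\<Prod>e\<leftarrow>es. [:- e, 1:]))"
    unfolding cp by (subst degree_mult_eq) auto
  then have n: "0 < n" using degree_monic_char_poly[OF A] by auto
  have "eigenvalue A e" unfolding eigenvalue_root_char_poly[OF A] cp by simp
  then obtain v where ev: "v \<in> carrier_vec n" "v \<noteq> 0\<^sub>v n" "A *\<^sub>v v = e \<cdot>\<^sub>v v"
    using A unfolding eigenvalue_def eigenvector_def by auto
  obtain U c where U: "U \<in> carrier_mat n n" "mat_adjoint U * U = 1\<^sub>m n" "col U 0 = c \<cdot>\<^sub>v v"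
    using unitary_with_first_column[OF ev(1,2) n] by metis
  define V where "V = mat_adjoint U"
  have V: "V \<in> carrier_mat n n" using U by (simp add: V_def)
  have VU: "V * U = 1\<^sub>m n" using U(2) by (simp add: V_def)
  have UV: "U * V = 1\<^sub>m n" using mat_mult_left_right_inverse[OF V U(1) VU] .
  define A' where "A' = V * (A * U)"
  have AU: "A * U \<in> carrier_mat n n" and A': "A' \<in> carrier_mat n n"
    using A U V by (auto simp: A'_def)
  have sim: "similar_mat A' A"
    using A A' U V VU UV assoc_mult_mat[OF V A U(1)]
    by (intro similar_matI[of _ _ V U n]) (auto simp: A'_def)
  have "hs A' = hs (A * U)"
    unfolding A'_def using UV AU V by (intro hs_unitary_mult[of _ n]) (auto simp: V_def)
  also have "\<dots> \<le> hs A"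
    using A U by (intro contraction_right[of n] contraction_unitary) auto
  finally have hsA': "hs A' \<le> hs A" .
  have "col (A * U) 0 = e \<cdot>\<^sub>v col U 0"
  proof -
    have "col (A * U) 0 = A *\<^sub>v (c \<cdot>\<^sub>v v)" using col_mult2[OF A U(1) n] U(3) by simp
    also have "\<dots> = c \<cdot>\<^sub>v (e \<cdot>\<^sub>v v)" using mult_mat_vec[OF A ev(1)] ev(3) by simp
    finally show ?thesis by (simp add: U(3) smult_smult_assoc mult.commute)
  qed
  then have "col A' 0 = e \<cdot>\<^sub>v col (V * U) 0"
    unfolding A'_def col_mult2[OF V AU n] col_mult2[OF V U(1) n]
    using U(1) by (simp only: mult_mat_vec[OF V, of "col U 0"] col_carrier_vec[OF n, of U n])
  then have col0: "A' $$ (i, 0) = (if i = 0 then e else 0)" if "i < n" for i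
    using arg_cong[of _ _ "\<lambda>v. v $ i"] that n A' unfolding VU by (fastforce simp: col_def)
  obtain A1 A2 A0 A3 where split: "split_block A' 1 1 = (A1, A2, A0, A3)"
    by (cases "split_block A' 1 1") auto
  have "dim_row A' = 1 + ?n1" "dim_col A' = 1 + ?n1" using A' n by auto
  note sb = split_block[OF split this]
  have A0: "A0 = 0\<^sub>m ?n1 1"
    using split[unfolded split_block_def Let_def] A' n col0 by auto
  have A1: "A1 = mat 1 1 (\<lambda>_. e)"
    using split[unfolded split_block_def Let_def] A' n col0 by auto
  have A3: "A3 $$ (i, j) = A' $$ (Suc i, Suc j)" if "i < ?n1" "j < ?n1" for i j
    using split[unfolded split_block_def Let_def] A' n that by auto
  have "char_poly A' = char_poly A1 * char_poly A3"
    unfolding sb(5) A0 by (rule char_poly_four_block_zeros_col) (use sb in auto)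
  moreover have "char_poly A1 = [:- e, 1:]"
    by (subst char_poly_upper_triangular[of _ 1]) (auto simp: A1 diag_mat_def)
  ultimately have "char_poly A3 = (\<Prod>e\<leftarrow>es. [:- e, 1:])"
    using char_poly_similar[OF sim] cp
    by (metis mult_cancel_left pCons_eq_0_iff zero_neq_one)
  then have IH: "(\<Sum>e\<leftarrow>es. (cmod e)\<^sup>2) \<le> (hs A3)\<^sup>2" using Cons(1) sb(4) by blast
  have n': "n = Suc ?n1" using n by simp
  have "(cmod e)\<^sup>2 + (hs A3)\<^sup>2 \<le> (cmod e)\<^sup>2 + (\<Sum>i<?n1. \<Sum>j<n. (cmod (A' $$ (Suc i, j)))\<^sup>2)"
    unfolding hs_sq[OF sb(4)]
  proof (intro add_left_mono sum_mono)
    fix i assume i: "i \<in> {..<?n1}"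
    have "(\<Sum>j<?n1. (cmod (A3 $$ (i, j)))\<^sup>2) = (\<Sum>j<?n1. (cmod (A' $$ (Suc i, Suc j)))\<^sup>2)"
      using i A3 by simp
    also have "\<dots> \<le> (\<Sum>j<Suc ?n1. (cmod (A' $$ (Suc i, j)))\<^sup>2)"
      by (subst sum.lessThan_Suc_shift) simp
    finally show "(\<Sum>j<?n1. (cmod (A3 $$ (i, j)))\<^sup>2) \<le> (\<Sum>j<n. (cmod (A' $$ (Suc i, j)))\<^sup>2)"
      using n' by simp
  qed
  also have "(cmod e)\<^sup>2 \<le> (\<Sum>j<n. (cmod (A' $$ (0, j)))\<^sup>2)"
    using col0[OF n] n member_le_sum[of 0 "{..<n}" "\<lambda>j. (cmod (A' $$ (0, j)))\<^sup>2"] by simp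
  also have "(\<Sum>j<n. (cmod (A' $$ (0, j)))\<^sup>2) + (\<Sum>i<?n1. \<Sum>j<n. (cmod (A' $$ (Suc i, j)))\<^sup>2)
      = (hs A')\<^sup>2"
    unfolding hs_sq[OF A'] using n'
    sum.lessThan_Suc_shift[of "\<lambda>i. \<Sum>j<n. (cmod (A' $$ (i, j)))\<^sup>2" ?n1] by simp
  also have "\<dots> \<le> (hs A)\<^sup>2" using hsA' by (intro power_mono) auto
  finally show ?case using IH by simp
qed

section \<open>Roots of powers, and algebraic multiplicity as multiplicity in a list\<close>

lemma upper_triangular_mult:
  assumes "A \<in> carrier_mat n n" "B \<in> carrier_mat n n" "upper_triangular A" "upper_triangular B"
  shows "upper_triangular (A * B)"
    and "i < n \<Longrightarrow> (A * B) $$ (i, i) = A $$ (i, i) * (B $$ (i, i) :: 'a :: comm_ring_1)"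
proof -
  note AB = assms(1,2)
  have z: "A $$ (i, l) * B $$ (l, j) = 0" if "i < n" "l < n" "j \<le> i" "l \<noteq> i \<or> j < i" for i j l
    using that upper_triangularD[OF assms(3), of l i] upper_triangularD[OF assms(4), of j l] AB
    by (cases "l < i") auto
  show "upper_triangular (A * B)"
  proof (rule upper_triangularI)
    fix i j assume "j < i" "i < dim_row (A * B)"
    then show "(A * B) $$ (i, j) = 0"
      using AB z by (simp add: scalar_prod_def)
  qed
  show "(A * B) $$ (i, i) = A $$ (i, i) * B $$ (i, i)" if "i < n"
  proof -
    have "(\<Sum>l\<in>{0..<n}. A $$ (i, l) * B $$ (l, i)) = (\<Sum>l\<in>{i}. A $$ (i, l) * B $$ (l, i))"
      using that z by (intro sum.mono_neutral_right) auto
    then show ?thesis using that AB by (simp add: scalar_prod_def)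
  qed
qed

text \<open>Spectral mapping with multiplicities, read off the diagonal of a triangular form. Any
  similarity will do here, since no norm is involved.\<close>

lemma char_poly_pow:
  fixes A :: "complex mat"
  assumes A: "A \<in> carrier_mat n n" and cp: "char_poly A = (\<Prod>e\<leftarrow>es. [:- e, 1:])"
  shows "char_poly (A ^\<^sub>m m) = (\<Prod>e\<leftarrow>map (\<lambda>e. e ^ m) es. [:- e, 1:])"
proof -
  obtain B P Q where dec: "schur_decomposition A es = (B, P, Q)" by (cases "schur_decomposition A es") auto
  have wit: "similar_mat_wit A B P Q" and ut: "upper_triangular B" and dg: "diag_mat B = es"
    using schur_decomposition[OF A cp dec] by auto
  have B: "B \<in> carrier_mat n n" using wit A by (auto simp: similar_mat_wit_def Let_def)
  have Bm: "B ^\<^sub>m m \<in> carrier_mat n n" using B by simp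
  have "upper_triangular (B ^\<^sub>m m) \<and> (\<forall>i<n. (B ^\<^sub>m m) $$ (i, i) = (B $$ (i, i)) ^ m)"
  proof (induction m)
    case 0 then show ?case using B by auto
  next
    case (Suc m)
    then show ?case using upper_triangular_mult[of "B ^\<^sub>m m" n B] B ut by (simp add: mult.commute del: index_mult_mat)
  qed
  then have "upper_triangular (B ^\<^sub>m m)" "diag_mat (B ^\<^sub>m m) = map (\<lambda>e. e ^ m) (diag_mat B)"
    using B Bm by (auto simp: diag_mat_def)
  moreover have "similar_mat (A ^\<^sub>m m) (B ^\<^sub>m m)"
    using similar_mat_wit_pow[OF wit] by (auto simp: similar_mat_def)
  ultimately show ?thesis
    using char_poly_similar char_poly_upper_triangular[OF Bm] dg by metis
qed

lemma order_prod_linear: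
  "order z (\<Prod>e\<leftarrow>es. [:- e, 1:]) = count_list es (z :: complex)"
proof (induction es)
  case Nil then show ?case by simp
next
  case (Cons e es)
  have "monic (\<Prod>e\<leftarrow>e # es. [:- e, 1:])" by (rule monic_prod_list) auto
  then have nz: "[:- e, 1:] * (\<Prod>e\<leftarrow>es. [:- e, 1:]) \<noteq> 0" by force
  have "order z [:- e, 1:] = (if e = z then 1 else 0)"
    using order_linear_power[of z "- e" 1] by (simp only: power_one_right) simp
  then show ?case using Cons order_mult[OF nz, of z] by (simp only: list.map prod_list.Cons) simp
qed

text \<open>Lets a count with algebraic multiplicity be handled as the length of a filtered list of
  roots, the form in which the estimates below are made.\<close>

lemma sum_order_char_poly:
  fixes A :: "complex mat"
  assumes A: "A \<in> carrier_mat n n" and cp: "char_poly A = (\<Prod>e\<leftarrow>es. [:- e, 1:])"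
  shows "(\<Sum>z | eigenvalue A z \<and> P z. order z (char_poly A)) = length (filter P es)"
proof -
  have "{z. eigenvalue A z \<and> P z} = set (filter P es)"
    unfolding eigenvalue_root_char_poly[OF A] cp by (auto simp: poly_prod_list prod_list_zero_iff)
  moreover have "order z (char_poly A) = count_list (filter P es) z" if "z \<in> set (filter P es)" for z
  proof -
    have "P z" using that by simp
    then have "count_list (filter P es) z = count_list es z" by (induction es) auto
    then show ?thesis by (simp add: cp order_prod_linear)
  qed
  ultimately show ?thesis by (simp add: sum_count_set)
qed

section \<open>Counting eigenvalues of matrices with few large rows\<close>

text \<open>The product of the row sums expands into a sum over all maps from rows to columns; the
  Leibniz formula uses only the permutations among them.\<close>

lemma cmod_det_le_row_sums:
  fixes A :: "complex mat"
  assumes A: "A \<in> carrier_mat n n"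
  shows "cmod (Determinant.det A) \<le> (\<Prod>i<n. \<Sum>j<n. cmod (A $$ (i, j)))"
proof -
  let ?I = "{0..<n}"
  define g where "g f = (\<Prod>i\<in>?I. cmod (A $$ (i, f i)))" for f
  have "cmod (Determinant.det A) \<le> (\<Sum>p | p permutes ?I. cmod (signof p * (\<Prod>i\<in>?I. A $$ (i, p i))))"
    unfolding det_def'[OF A] by (rule norm_sum)
  also have "\<dots> = (\<Sum>p | p permutes ?I. g p)"
  proof (rule sum.cong[OF refl])
    fix p :: "nat \<Rightarrow> nat"
    show "cmod (signof p * (\<Prod>i\<in>?I. A $$ (i, p i))) = g p"
      by (cases p rule: sign_cases) (simp_all add: g_def norm_mult prod_norm)
  qed
  \<comment> \<open>A permutation is the identity outside \<open>?I\<close>, a member of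
    \<open>PiE\<close> is \<open>undefined\<close> there, so permutations are restricted before the
    two index sets are compared.\<close>
  also have "\<dots> = (\<Sum>f\<in>(\<lambda>p. restrict p ?I) ` {p. p permutes ?I}. g f)"
  proof (rule sum.reindex_cong[symmetric, OF _ refl])
    show "inj_on (\<lambda>p. restrict p ?I) {p. p permutes ?I}"
    proof (rule inj_onI)
      fix p q assume "p \<in> {p. p permutes ?I}" "q \<in> {p. p permutes ?I}"
        and eq: "restrict p ?I = restrict q ?I"
      then have pq: "p permutes ?I" "q permutes ?I" by auto
      show "p = q"
      proof
        fix x show "p x = q x"
          using fun_cong[OF eq, of x] permutes_not_in[OF pq(1), of x] permutes_not_in[OF pq(2), of x]
          by (cases "x \<in> ?I") auto
      qed
    qed
  qed (simp add: g_def)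
  also have "\<dots> \<le> (\<Sum>f\<in>PiE ?I (\<lambda>_. ?I). g f)"
  proof (rule sum_mono2)
    show "(\<lambda>p. restrict p ?I) ` {p. p permutes ?I} \<subseteq> PiE ?I (\<lambda>_. ?I)"
      using permutes_in_image by fastforce
  qed (auto simp: g_def intro!: prod_nonneg finite_PiE)
  also have "\<dots> = (\<Prod>i\<in>?I. \<Sum>j\<in>?I. cmod (A $$ (i, j)))"
    unfolding g_def by (rule prod_sum_PiE[symmetric]) auto
  finally show ?thesis by (simp add: atLeast0LessThan)
qed

lemma holomorphic_on_prod_list:
  assumes "\<And>x. x \<in> set xs \<Longrightarrow> f x holomorphic_on S"
  shows "(\<lambda>z. \<Prod>x\<leftarrow>xs. f x z) holomorphic_on S"
  using assms by (induction xs) (auto intro!: holomorphic_intros)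

lemma norm_prod_list_map:
  "norm (\<Prod>x\<leftarrow>xs. (f x :: complex)) = (\<Prod>x\<leftarrow>xs. norm (f x))"
  by (induction xs) (auto simp: norm_mult)

text \<open>Reflecting the roots inside the circle of radius \<open>b\<close> does not change the modulus
  on the circle, while the value at the origin becomes the product on the left.\<close>

lemma prod_max_roots_le:
  fixes es :: "complex list"
  assumes b: "0 < b" and S: "\<And>z. cmod z = b \<Longrightarrow> cmod (\<Prod>e\<leftarrow>es. z - e) \<le> S"
  shows "(\<Prod>e\<leftarrow>es. max b (cmod e)) \<le> S"
proof -
  define f where "f e z = (if cmod e \<le> b then (of_real (b\<^sup>2) - cnj e * z) / of_real b else z - e)"
    for e z :: complex
  define q where "q z = (\<Prod>e\<leftarrow>es. f e z)" for z
  have hol: "q holomorphic_on A" for A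
    unfolding q_def
  proof (rule holomorphic_on_prod_list)
    fix e show "f e holomorphic_on A"
      using b by (cases "cmod e \<le> b") (auto simp: f_def[abs_def] intro!: holomorphic_intros)
  qed
  have circ: "cmod (f e z) = cmod (z - e)" if "cmod z = b" for e z
  proof (cases "cmod e \<le> b")
    case True
    have "complex_of_real (b\<^sup>2) = z * cnj z" using that by (simp add: complex_norm_square[symmetric])
    then have "complex_of_real (b\<^sup>2) - cnj e * z = z * cnj (z - e)" by (simp add: algebra_simps)
    then show ?thesis using True that b by (simp add: f_def norm_mult norm_divide del: of_real_power complex_cnj_diff)
  qed (simp add: f_def)
  have "cmod (q 0) \<le> S"
  proof (rule maximum_modulus_frontier[of q "ball 0 b"])
    show "continuous_on (closure (ball 0 b)) q" using hol holomorphic_on_imp_continuous_on by blast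
    show "cmod (q z) \<le> S" if "z \<in> frontier (ball 0 b)" for z
      using S[of z] that b circ[of z] by (simp add: q_def norm_prod_list_map)
  qed (use b hol in auto)
  moreover have "cmod (q 0) = (\<Prod>e\<leftarrow>es. max b (cmod e))"
    unfolding q_def norm_prod_list_map
    by (intro arg_cong[of _ _ prod_list] map_cong refl)
      (use b in \<open>auto simp: f_def norm_divide power2_eq_square norm_mult\<close>)
  ultimately show ?thesis by simp
qed

lemma power_length_filter_le:
  fixes es :: "complex list"
  assumes "0 < b" "b \<le> a"
  shows "(a / b) ^ length (filter (\<lambda>e. a \<le> cmod e) es) * b ^ length es \<le> (\<Prod>e\<leftarrow>es. max b (cmod e))"
proof (induction es)
  case Nil then show ?case by simp
next
  case (Cons e es)
  let ?P = "(a / b) ^ length (filter (\<lambda>e. a \<le> cmod e) es) * b ^ length es"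
  have "(a / b) ^ length (filter (\<lambda>e. a \<le> cmod e) (e # es)) * b ^ length (e # es) =
      (if a \<le> cmod e then a else b) * ?P"
    using assms by (simp add: field_simps)
  also have "\<dots> \<le> max b (cmod e) * (\<Prod>e\<leftarrow>es. max b (cmod e))"
    using assms Cons by (intro mult_mono) auto
  finally show ?case by simp
qed

lemma length_es_dim:
  assumes "A \<in> carrier_mat n n" "char_poly A = (\<Prod>e\<leftarrow>es. [:- e :: complex, 1:])"
  shows "length es = n"
  using degree_monic_char_poly[OF assms(1)] degree_linear_factors[of uminus es] assms(2) by simp

text \<open>A Jensen-type count. On the circle of radius \<open>b\<close>, a row of
  \<open>z - A\<close> outside \<open>X\<close> has absolute sum at most
  \<open>b * (1 + 1 / n)\<close>, a row in \<open>X\<close> at most \<open>2 * n\<close>. Every root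
  of modulus at least \<open>a\<close> lifts the left side of \<open>prod_max_roots_le\<close> above
  \<open>b ^ n\<close> by a factor \<open>a / b\<close>, and only the rows in \<open>X\<close> can
  pay for it.\<close>

lemma eigenvalue_count_few_rows:
  fixes A :: "complex mat"
  assumes A: "A \<in> carrier_mat n n" and cp: "char_poly A = (\<Prod>e\<leftarrow>es. [:- e, 1:])"
    and X: "X \<subseteq> {..<n}" and n: "0 < n"
    and b: "0 < b" "b \<le> a" "b \<le> 1"
    and le1: "\<And>i j. i < n \<Longrightarrow> j < n \<Longrightarrow> cmod (A $$ (i, j)) \<le> 1"
    and small: "\<And>i j. i < n \<Longrightarrow> j < n \<Longrightarrow> i \<notin> X \<Longrightarrow> cmod (A $$ (i, j)) \<le> b / (real n)\<^sup>2"
  shows "(a / b) ^ length (filter (\<lambda>e. a \<le> cmod e) es) \<le> 3 * (2 * real n / b) ^ card X"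
proof -
  have len: "length es = n" using length_es_dim[OF A cp] .
  define r where "r = card X"
  have r: "r \<le> n" using card_mono[OF _ X] by (simp add: r_def)
  define S where "S = (2 * real n) ^ r * (b * (1 + 1 / real n)) ^ (n - r)"
  have bound: "cmod (\<Prod>e\<leftarrow>es. z - e) \<le> S" if z: "cmod z = b" for z
  proof -
    have "(\<Prod>e\<leftarrow>es. z - e) = poly (char_poly A) z"
      unfolding cp poly_prod_list by (simp add: o_def)
    also have "\<dots> = Determinant.det (- char_matrix A z)" by (rule char_poly_matrix[OF A])
    finally have "cmod (\<Prod>e\<leftarrow>es. z - e) \<le> (\<Prod>i<n. \<Sum>j<n. cmod ((- char_matrix A z) $$ (i, j)))"
      using cmod_det_le_row_sums[of "- char_matrix A z" n] A by simp
    also have "\<dots> \<le> (\<Prod>i<n. if i \<in> X then 2 * real n else b * (1 + 1 / real n))"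
    proof (intro prod_mono conjI sum_nonneg)
      fix i assume i: "i \<in> {..<n}"
      have "(\<Sum>j<n. cmod ((- char_matrix A z) $$ (i, j))) \<le> (\<Sum>j<n. (if i = j then b else 0) + cmod (A $$ (i, j)))"
      proof (rule sum_mono)
        fix j assume "j \<in> {..<n}"
        then have "(- char_matrix A z) $$ (i, j) = (if i = j then z else 0) - A $$ (i, j)"
          using i A by (simp add: char_matrix_def)
        then show "cmod ((- char_matrix A z) $$ (i, j)) \<le> (if i = j then b else 0) + cmod (A $$ (i, j))"
          using norm_triangle_ineq4[of "if i = j then z else 0" "A $$ (i, j)"] z
          by (simp split: if_splits)
      qed
      also have "\<dots> = b + (\<Sum>j<n. cmod (A $$ (i, j)))"
        using i by (simp add: sum.distrib)
      also have "\<dots> \<le> (if i \<in> X then 2 * real n else b * (1 + 1 / real n))"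
      proof (cases "i \<in> X")
        case True
        have "(\<Sum>j<n. cmod (A $$ (i, j))) \<le> (\<Sum>j<n. 1)" using i le1 by (intro sum_mono) auto
        then show ?thesis using True b n by simp
      next
        case False
        have "(\<Sum>j<n. cmod (A $$ (i, j))) \<le> (\<Sum>j<n. b / (real n)\<^sup>2)"
          using i small False by (intro sum_mono) auto
        also have "\<dots> = b / real n" using n by (simp add: power2_eq_square)
        finally show ?thesis using False by (simp add: algebra_simps)
      qed
      finally show "(\<Sum>j<n. cmod ((- char_matrix A z) $$ (i, j))) \<le>
          (if i \<in> X then 2 * real n else b * (1 + 1 / real n))" .
    qed auto
    also have "\<dots> = S"
    proof -
      have "{..<n} \<inter> X = X" "card ({..<n} - X) = n - r"
        using X finite_subset[OF X] by (auto simp: card_Diff_subset r_def)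
      moreover have "{..<n} \<inter> - X = {..<n} - X" by auto
      ultimately show ?thesis by (simp add: prod.If_cases S_def r_def)
    qed
    finally show ?thesis .
  qed
  have "(a / b) ^ length (filter (\<lambda>e. a \<le> cmod e) es) * b ^ n \<le> S"
    using power_length_filter_le[OF b(1,2), of es] prod_max_roots_le[OF b(1) bound] len by simp
  also have "S \<le> (2 * real n) ^ r * (b ^ (n - r) * 3)"
  proof -
    \<comment> \<open>The allowance \<open>b / n^2\<close> per entry leaves an excess
      \<open>b / n\<close> per row; over all rows this costs only the factor
      \<open>exp 1\<close>.\<close>
    have "(1 + 1 / real n) ^ (n - r) \<le> (1 + 1 / real n) ^ n" by (intro power_increasing) auto
    also have "\<dots> \<le> exp (1 / real n) ^ n" by (intro power_mono exp_ge_add_one_self) auto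
    also have "\<dots> = exp 1" using n by (simp add: exp_of_nat_mult[symmetric])
    also have "\<dots> \<le> 3" by (rule exp_le)
    finally show ?thesis using b unfolding S_def power_mult_distrib
      by (intro mult_left_mono) auto
  qed
  also have "\<dots> = 3 * (2 * real n / b) ^ r * b ^ n"
    using r b by (simp add: power_divide power_diff)
  finally show ?thesis using b by (simp add: r_def)
qed

section \<open>Localized contractions\<close>

lemma hs_le_scaled:
  assumes "A \<in> carrier_mat n n" "B \<in> carrier_mat n n" "0 \<le> c"
    and "\<And>i j. i < n \<Longrightarrow> j < n \<Longrightarrow> cmod (A $$ (i, j)) \<le> c * cmod (B $$ (i, j))"
  shows "hs A \<le> c * hs B"
proof -
  have "hs A \<le> hs (complex_of_real c \<cdot>\<^sub>m B)"
    using assms by (intro hs_mono[of _ n n]) (auto simp: norm_mult)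
  also have "\<dots> = c * hs B"
    using assms by (subst (1 2) hs_eq[of _ n n])
      (auto simp: norm_mult L2_set_right_distrib intro!: L2_set_cong)
  finally show ?thesis .
qed

lemma hs_adjoint_mult_self:
  assumes G: "G \<in> carrier_mat n n"
  shows "hs (G * mat_adjoint G) = hs (mat_adjoint G * G)"
proof -
  have G': "mat_adjoint G \<in> carrier_mat n n" using G by simp
  note c = mult_carrier_mat[of _ n n _ n]
  have "complex_of_real ((hs (mat_adjoint G * G))\<^sup>2) = tr ((mat_adjoint G * G) * (mat_adjoint G * G))"
    using G G' by (simp add: hs_sq_tr[of _ n n] c mat_adjoint_mult[of _ n n _ n] del: of_real_power)
  also have "\<dots> = tr (mat_adjoint G * (G * (mat_adjoint G * G)))"
    using G G' by (simp add: c assoc_mult_mat[of _ n n _ n _ n])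
  also have "\<dots> = tr ((G * (mat_adjoint G * G)) * mat_adjoint G)"
    using G G' by (intro tr_comm[of _ n n]) (auto simp: c)
  also have "\<dots> = tr ((G * mat_adjoint G) * (G * mat_adjoint G))"
    using G G' by (simp add: c assoc_mult_mat[of _ n n _ n _ n])
  also have "\<dots> = complex_of_real ((hs (G * mat_adjoint G))\<^sup>2)"
    using G G' by (simp add: hs_sq_tr[of _ n n] c mat_adjoint_mult[of _ n n _ n] del: of_real_power)
  finally have "(hs (mat_adjoint G * G))\<^sup>2 = (hs (G * mat_adjoint G))\<^sup>2"
    unfolding of_real_eq_iff .
  then show ?thesis by simp
qed

text \<open>Hoelder's inequality for Schatten norms: \<open>hs (mat_adjoint G * G)\<close> is the
  square of the Schatten 4-norm of \<open>G\<close>. By cyclicity of the trace the squared left side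
  pairs \<open>mat_adjoint H * (Y * H)\<close> with \<open>G * mat_adjoint G\<close>, both of norm
  at most \<open>hs Y\<close>.\<close>

lemma hs_sandwich_le:
  assumes G: "G \<in> carrier_mat n n" and H: "contraction n H"
  shows "hs (G * H * G) \<le> hs (mat_adjoint G * G)"
proof -
  have H': "contraction n (mat_adjoint H)" using contraction_adjoint[OF H] .
  have c: "G \<in> carrier_mat n n" "H \<in> carrier_mat n n" "mat_adjoint G \<in> carrier_mat n n"
    "mat_adjoint H \<in> carrier_mat n n"
    using G contractionD(1)[OF H] by auto
  note m = mult_carrier_mat[of _ n n _ n]
  note a = assoc_mult_mat[of _ n n _ n _ n]
  define Y where "Y = mat_adjoint G * G"
  have Y: "Y \<in> carrier_mat n n" using c by (simp add: Y_def m)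
  have "complex_of_real ((hs (G * H * G))\<^sup>2) =
      tr (mat_adjoint G * (mat_adjoint H * (Y * (H * G))))"
    using c by (simp add: hs_sq_tr[of _ n n] m mat_adjoint_mult[of _ n n _ n] a Y_def
        del: of_real_power)
  also have "\<dots> = tr ((mat_adjoint H * (Y * (H * G))) * mat_adjoint G)"
    using c Y by (intro tr_comm[of _ n n]) (auto simp: m)
  also have "\<dots> = tr ((mat_adjoint H * (Y * H)) * (G * mat_adjoint G))"
    using c Y by (simp add: m a)
  finally have "(hs (G * H * G))\<^sup>2 = cmod (tr ((mat_adjoint H * (Y * H)) * (G * mat_adjoint G)))"
    by (metis abs_power2 norm_of_real)
  also have "\<dots> \<le> hs (mat_adjoint H * (Y * H)) * hs (G * mat_adjoint G)"
    using c Y by (intro cmod_tr_mult_le[of _ n n]) (auto simp: m)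
  also have "\<dots> \<le> hs Y * hs Y"
  proof (rule mult_mono)
    have "hs (mat_adjoint H * (Y * H)) \<le> hs (Y * H)"
      using c Y by (intro contractionD(2)[OF H']) (auto simp: m)
    also have "\<dots> \<le> hs Y" using contraction_right[OF H Y] .
    finally show "hs (mat_adjoint H * (Y * H)) \<le> hs Y" .
  qed (simp_all add: hs_adjoint_mult_self[OF G] Y_def)
  finally have "(hs (G * H * G))\<^sup>2 \<le> (hs Y)\<^sup>2" by (simp add: power2_eq_square)
  then show ?thesis using hs_nonneg[of Y] by (auto simp: Y_def dest: power2_le_imp_le)
qed


abbreviation ind :: "nat \<Rightarrow> nat set \<Rightarrow> complex mat" where
  "ind n X \<equiv> mat_diag n (\<lambda>i. if i \<in> X then 1 else 0)"

lemma contraction_ind: "contraction n (ind n X)"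
  by (rule contraction_diag) auto

lemma ind_mult_index:
  assumes "A \<in> carrier_mat n n" "i < n" "j < n"
  shows "(ind n X * A) $$ (i, j) = (if i \<in> X then A $$ (i, j) else 0)"
    and "(A * ind n X) $$ (i, j) = (if j \<in> X then A $$ (i, j) else 0)"
  using assms by (auto simp: mat_diag_mult_left[OF assms(1)] mat_diag_mult_right[OF assms(1)])

lemma ind_idem: "ind n X * ind n X = ind n X"
  by (auto intro!: arg_cong[of _ _ "mat_diag n"])

lemma transpose_ind_index:
  assumes "K \<in> carrier_mat n n" "i < n" "j < n" "i \<notin> X"
  shows "transpose_mat (K * ind n (- X)) $$ (i, j) = K $$ (j, i)"
  using assms by (auto simp: mat_diag_mult_right[OF assms(1)])

text \<open>One smallness hypothesis serves twice. Small columns of \<open>K\<close> outside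
  \<open>X\<close> are small rows of its transpose, and by \<open>transpose\<close> that transpose
  is \<open>K\<close> in another unitary basis; so \<open>K * ind n (- X)\<close> controls position
  and frequency.\<close>

locale localized_contraction =
  fixes n :: nat and F K :: "complex mat" and X :: "nat set" and \<eta> :: real and es :: "complex list"
  assumes n: "0 < n"
    and F: "F \<in> carrier_mat n n" "mat_adjoint F * F = 1\<^sub>m n"
    and K: "contraction n K"
    and transpose: "F * K * mat_adjoint F = transpose_mat K"
    and \<eta>: "0 < \<eta>" "\<eta> \<le> 1" "hs (K * ind n (- X)) \<le> \<eta>"
    and cp: "char_poly K = (\<Prod>e\<leftarrow>es. [:- e, 1:])"
begin

definition T :: "complex mat" where "T = transpose_mat K"
definition G :: "complex mat" where "G = ind n X * mat_adjoint F * ind n X"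
text \<open>\<open>T = F * K * mat_adjoint F\<close> compressed to \<open>X\<close> on both sides,
  with a further \<open>ind n X\<close> inserted after \<open>K\<close>. The insertion costs an
  error of size \<eta> and produces the factor \<open>G\<close>.\<close>

definition Z :: "complex mat" where "Z = ind n X * (F * K) * G"

lemma carriers [simp]:
  "F \<in> carrier_mat n n" "K \<in> carrier_mat n n" "T \<in> carrier_mat n n" "G \<in> carrier_mat n n"
  "Z \<in> carrier_mat n n" "mat_adjoint F \<in> carrier_mat n n"
  using F contractionD(1)[OF K]
  by (auto simp: T_def G_def Z_def mult_carrier_mat[of _ n n _ n] intro!: mult_carrier_mat[of _ n n _ n])

lemma F_adjoint: "F * mat_adjoint F = 1\<^sub>m n"
  by (rule mat_mult_left_right_inverse[of _ n]) (use F in auto)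

lemma char_poly_T: "char_poly T = (\<Prod>e\<leftarrow>es. [:- e, 1:])"
proof -
  have "similar_mat T K"
    using F F_adjoint transpose
    by (intro similar_matI[of _ _ F "mat_adjoint F" n]) (auto simp: T_def[symmetric])
  then show ?thesis using char_poly_similar cp by metis
qed

lemma T_outside: "i < n \<Longrightarrow> j < n \<Longrightarrow> i \<notin> X \<Longrightarrow> cmod (T $$ (i, j)) \<le> \<eta>"
  using entry_le_hs[of "transpose_mat (K * ind n (- X))" n n i j] \<eta>(3)
    transpose_ind_index[OF carriers(2), of i j X] contractionD(1)[OF K]
  by (simp add: T_def mult_carrier_mat[of _ n n _ n] carrier_matD[OF carriers(2)])

lemma contraction_FK: "contraction n (F * K)"
  using contraction_mult[OF contraction_unitary K] F by blast

lemma hs_Z_le: "hs Z \<le> hs G"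
proof -
  have "hs Z = hs (ind n X * (F * K * G))"
    by (simp add: Z_def assoc_mult_mat[of _ n n _ n _ n] mult_carrier_mat[of _ n n _ n])
  also have "\<dots> \<le> hs (F * K * G)"
    by (intro contractionD(2)[OF contraction_ind]) (simp add: mult_carrier_mat[of _ n n _ n])
  also have "\<dots> \<le> hs G" by (intro contractionD(2)[OF contraction_FK]) simp
  finally show ?thesis .
qed

lemma contraction_Z: "contraction n Z"
  unfolding Z_def G_def
  using contraction_unitary[OF F]
  by (intro contraction_mult contraction_ind contraction_FK contraction_adjoint) auto

text \<open>A single \<open>Z\<close> contains \<open>G\<close> once and sees only its
  Hilbert--Schmidt norm. In \<open>Z * Z\<close> two copies of \<open>G\<close> enclose a
  contraction, which brings in the Schatten 4-norm; hence the fourth powers of eigenvalues.\<close>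

lemma hs_Z_sq_le: "hs (Z * Z) \<le> hs (mat_adjoint G * G)"
proof -
  note m = mult_carrier_mat[of _ n n _ n]
  note a = assoc_mult_mat[of _ n n _ n _ n]
  have "G * ind n X = G"
    by (simp add: G_def a m ind_idem del: mat_diag_diag)
  then have GQ: "G * (ind n X * Y) = G * Y" if "Y \<in> carrier_mat n n" for Y
    using that a[of G "ind n X" Y] by simp
  have "Z * Z = ind n X * (F * K * (G * (F * K) * G))"
    by (simp add: Z_def a m GQ)
  also have "hs \<dots> \<le> hs (F * K * (G * (F * K) * G))"
    by (intro contractionD(2)[OF contraction_ind]) (simp add: m)
  also have "\<dots> \<le> hs (G * (F * K) * G)"
    by (intro contractionD(2)[OF contraction_FK]) (simp add: m)
  also have "\<dots> \<le> hs (mat_adjoint G * G)"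
    by (intro hs_sandwich_le[of _ n] contraction_FK) simp
  finally show ?thesis .
qed

text \<open>Only the rows of \<open>T\<close> indexed by \<open>X\<close> are not small.  Conjugating by a diagonal matrix
  damps the columns outside \<open>X\<close> at the cost of amplifying the small rows, so \<open>T\<close> is similar
  to a small perturbation of its \<open>X \<times> X\<close> block, which is \<open>Z\<close> up to a small error.\<close>

lemma similar_near_Z:
  obtains A where "A \<in> carrier_mat n n" "char_poly A = (\<Prod>e\<leftarrow>es. [:- e, 1:])"
    "hs (A - Z) \<le> 4 * sqrt (\<eta> * real n)"
proof -
  note m = mult_carrier_mat[of _ n n _ n]
  note a = assoc_mult_mat[of _ n n _ n _ n]
  \<comment> \<open>The square root balances the two effects of the conjugation: columns outside
    \<open>X\<close> are damped by \<open>s\<close>, and rows of size \<eta> are amplified to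
    \<open>\<eta> / s = s\<close>.\<close>
  define s where "s = sqrt \<eta>"
  have s: "0 < s" "s \<le> 1" "s * s = \<eta>" using \<eta> by (auto simp: s_def)
  define d where "d i = (if i \<in> X then 1 else complex_of_real (1 / s))" for i
  define d' where "d' i = (if i \<in> X then 1 else complex_of_real s)" for i
  define A where "A = mat_diag n d * T * mat_diag n d'"
  have dd: "d i * d' i = 1" for i using s by (simp add: d_def d'_def)
  then have dd': "d' i * d i = 1" for i by (simp add: mult.commute)
  have A: "A \<in> carrier_mat n n" by (simp add: A_def m)
  have Aij: "A $$ (i, j) = d i * T $$ (i, j) * d' j" if "i < n" "j < n" for i j
    using that by (simp add: A_def mat_diag_mult_left[of T n n] mat_diag_mult_right[of _ n n])
  have "similar_mat A T"
    using A dd dd' by (intro similar_matI[of _ _ "mat_diag n d" "mat_diag n d'" n]) (auto simp: A_def)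
  then have cpA: "char_poly A = (\<Prod>e\<leftarrow>es. [:- e, 1:])"
    using char_poly_similar char_poly_T by metis
  define R1 where "R1 = Matrix.mat n n (\<lambda>(i, j). if i \<in> X \<and> j \<notin> X then A $$ (i, j) else 0)"
  define R2 where "R2 = Matrix.mat n n (\<lambda>(i, j). if i \<notin> X then A $$ (i, j) else 0)"
  \<comment> \<open>The error of inserting \<open>ind n X\<close> between \<open>K\<close> and
    \<open>mat_adjoint F\<close>: \<open>K * ind n (- X)\<close> multiplied by contractions.\<close>
  define R3 where "R3 = ind n X * F * (K * ind n (- X)) * mat_adjoint F * ind n X"
  have R: "R1 \<in> carrier_mat n n" "R2 \<in> carrier_mat n n" "R3 \<in> carrier_mat n n"
    by (auto simp: R1_def R2_def R3_def m)
  have "hs R1 \<le> s * hs T"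
    by (rule hs_le_scaled[of _ n]) (use R s in \<open>auto simp: R1_def Aij d_def d'_def norm_mult\<close>)
  moreover have "hs T \<le> sqrt (real n)"
    using contraction_hs[OF K] by (simp add: T_def)
  ultimately have h1: "hs R1 \<le> s * sqrt (real n)"
    using s by (meson mult_left_mono order_trans less_imp_le)
  have "hs R2 \<le> 1 / s * hs (transpose_mat (K * ind n (- X)))"
  proof (rule hs_le_scaled[of _ n])
    fix i j assume ij: "i < n" "j < n"
    have "cmod (T $$ (i, j)) * (1 / s) * s \<le> cmod (T $$ (i, j)) * (1 / s) * 1"
      using s by (intro mult_left_mono) auto
    then show "cmod (R2 $$ (i, j)) \<le> 1 / s * cmod (transpose_mat (K * ind n (- X)) $$ (i, j))"
      using ij s transpose_ind_index[OF carriers(2) ij, of X] carrier_matD[OF carriers(2)]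
      by (cases "i \<in> X") (auto simp: R2_def Aij d_def d'_def norm_mult norm_divide T_def mult.commute)
  qed (use R s in \<open>auto simp: m\<close>)
  also have "\<dots> \<le> 1 / s * \<eta>" using \<eta> s by (intro mult_left_mono) (simp_all add: hs_transpose)
  also have "\<dots> = s" using s by (simp add: field_simps)
  finally have h2: "hs R2 \<le> s" .
  have U: "contraction n F" "contraction n (mat_adjoint F)"
    using contraction_unitary[OF F] contraction_adjoint by auto
  have "hs R3 \<le> hs (ind n X * F * (K * ind n (- X)) * mat_adjoint F)"
    unfolding R3_def by (intro contraction_right[OF contraction_ind]) (simp add: m)
  also have "\<dots> \<le> hs (ind n X * F * (K * ind n (- X)))"
    by (intro contraction_right[OF U(2)]) (simp add: m)
  also have "\<dots> \<le> hs (K * ind n (- X))"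
    by (intro contractionD(2)[of n] contraction_mult contraction_ind U) (simp add: m)
  also have "\<dots> \<le> s" using \<eta>(3) s mult_left_le[of s s] by auto
  finally have h3: "hs R3 \<le> s" .
  have split1: "A = R1 + R2 + ind n X * T * ind n X"
  proof (rule eq_matI)
    fix i j assume "i < dim_row (R1 + R2 + ind n X * T * ind n X)"
      "j < dim_col (R1 + R2 + ind n X * T * ind n X)"
    then have ij: "i < n" "j < n" by (auto simp: carrier_matD[OF mat_diag_dim])
    have "(ind n X * T * ind n X) $$ (i, j) = (if i \<in> X \<and> j \<in> X then T $$ (i, j) else 0)"
      using ij by (simp add: ind_mult_index[of _ n] m del: index_mult_mat(1))
    moreover have "(R1 + R2 + ind n X * T * ind n X) $$ (i, j) =
        R1 $$ (i, j) + R2 $$ (i, j) + (ind n X * T * ind n X) $$ (i, j)"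
      using ij R by (simp add: carrier_matD[OF mat_diag_dim] del: index_mult_mat(1))
    ultimately show "A $$ (i, j) = (R1 + R2 + ind n X * T * ind n X) $$ (i, j)"
      using ij by (auto simp: R1_def R2_def Aij d_def d'_def simp del: index_mult_mat(1) index_add_mat)
  qed (use A in \<open>auto simp: carrier_matD[OF mat_diag_dim]\<close>)
  have split2: "ind n X * T * ind n X = R3 + Z"
  proof -
    have "K * ind n (- X) + K * ind n X = K"
      by (rule eq_matI) (auto simp: mat_diag_mult_right[OF carriers(2)] carrier_matD[OF carriers(2)])
    then have "ind n X * T * ind n X =
        ind n X * F * (K * ind n (- X) + K * ind n X) * mat_adjoint F * ind n X"
      by (simp add: T_def transpose[symmetric] a m)
    also have "\<dots> = R3 + ind n X * F * (K * ind n X) * mat_adjoint F * ind n X"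
      by (simp add: R3_def mult_add_distrib_mat[of _ n n _ n] add_mult_distrib_mat[of _ n n _ _ n] m)
    also have "ind n X * F * (K * ind n X) * mat_adjoint F * ind n X = Z"
      by (simp add: Z_def G_def a m)
    finally show ?thesis .
  qed
  have "A - Z = R1 + R2 + R3"
    using A R by (intro eq_matI) (auto simp: split1 split2 carrier_matD[OF carriers(5)])
  then have "hs (A - Z) \<le> hs R1 + hs R2 + hs R3"
    using hs_triangle[of "R1 + R2" n n R3] hs_triangle[of R1 n n R2] R by simp
  also have "\<dots> \<le> s * sqrt (real n) + s * sqrt (real n) + s * sqrt (real n)"
  proof -
    have "s * 1 \<le> s * sqrt (real n)" using s n by (intro mult_left_mono) auto
    then show ?thesis using h1 h2 h3 by linarith
  qed
  also have "\<dots> \<le> 4 * sqrt (\<eta> * real n)"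
    using \<eta> by (simp add: s_def real_sqrt_mult)
  finally show thesis using that[OF A cpA] by blast
qed

text \<open>Schur's inequality for the similar matrix and for its square. The factor 2 comes from
  squaring a sum of two terms; the other constants are \<open>32 = 2 * 4^2\<close> and
  \<open>288 = 2 * (4 * 3)^2\<close>.\<close>

lemma sum_eigenvalues_bounds:
  assumes small: "4 * sqrt (\<eta> * real n) \<le> 1"
  shows "(\<Sum>e\<leftarrow>es. (cmod e)\<^sup>2) \<le> 2 * (hs G)\<^sup>2 + 32 * \<eta> * real n"
    and "(\<Sum>e\<leftarrow>es. (cmod e) ^ 4) \<le> 2 * (hs (mat_adjoint G * G))\<^sup>2 + 288 * \<eta> * (real n)\<^sup>2"
proof -
  note m = mult_carrier_mat[of _ n n _ n]
  obtain A where A: "A \<in> carrier_mat n n" "char_poly A = (\<Prod>e\<leftarrow>es. [:- e, 1:])"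
    "hs (A - Z) \<le> 4 * sqrt (\<eta> * real n)"
    using similar_near_Z by blast
  define E where "E = A - Z"
  define t where "t = 4 * sqrt (\<eta> * real n)"
  have t: "0 \<le> t" "t \<le> 1" "t\<^sup>2 = 16 * (\<eta> * real n)" using small \<eta> by (auto simp: t_def power_mult_distrib)
  have E: "E \<in> carrier_mat n n" "hs E \<le> t"
    unfolding E_def t_def using A(3) minus_carrier_mat[OF carriers(5)] by blast+
  have AZ: "A = Z + E" using A by (intro eq_matI) (auto simp: E_def carrier_matD[OF carriers(5)])
  have two: "(x + y)\<^sup>2 \<le> 2 * x\<^sup>2 + 2 * y\<^sup>2" for x y :: real
    using sum_squares_bound[of x y] by (simp add: power2_sum)
  have "hs A \<le> hs G + t"
    using hs_triangle[of Z n n E] E hs_Z_le by (simp add: AZ)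
  then have "(hs A)\<^sup>2 \<le> 2 * (hs G)\<^sup>2 + 2 * t\<^sup>2"
    using power_mono[of "hs A" "hs G + t" 2] two[of "hs G" t] by simp
  then show "(\<Sum>e\<leftarrow>es. (cmod e)\<^sup>2) \<le> 2 * (hs G)\<^sup>2 + 32 * \<eta> * real n"
    using schur_inequality[OF A(1,2)] t(3) by simp
  have A2: "A ^\<^sub>m 2 = A * A" using A(1) by (simp add: numeral_2_eq_2)
  have "A * A = Z * Z + (Z * E + E * A)"
  proof -
    have "A * A = Z * A + E * A"
      using add_mult_distrib_mat[OF carriers(5) E(1) A(1)] by (simp add: AZ[symmetric])
    also have "Z * A = Z * Z + Z * E"
      using mult_add_distrib_mat[OF carriers(5) carriers(5) E(1)] by (simp add: AZ[symmetric])
    finally show ?thesis using E(1) A(1) by (simp add: assoc_add_mat[of _ n n] m)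
  qed
  then have "hs (A * A) \<le> hs (Z * Z) + (hs (Z * E) + hs (E * A))"
    using hs_triangle[of "Z * Z" n n "Z * E + E * A"] hs_triangle[of "Z * E" n n "E * A"] E(1) A(1)
    by (simp add: m)
  also have "hs (Z * E) \<le> t" using contractionD(2)[OF contraction_Z E(1)] E(2) by simp
  \<comment> \<open>The conjugation is not unitary, so \<open>A\<close> is not known to be a
    contraction; its Hilbert--Schmidt norm is used instead, at the price of
    \<open>sqrt n\<close>.\<close>
  also have "hs (E * A) \<le> t * (sqrt (real n) + 1)"
  proof -
    have "hs A \<le> sqrt (real n) + 1"
      using hs_triangle[of Z n n E] E t contraction_hs[OF contraction_Z] by (simp add: AZ)
    then show ?thesis using hs_mult_le[OF E(1) A(1)] E(2) t
      by (meson hs_nonneg mult_mono order_trans)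
  qed
  also have "t + t * (sqrt (real n) + 1) \<le> t * (3 * sqrt (real n))"
  proof -
    have "1 \<le> sqrt (real n)" using n by simp
    then have "1 + (sqrt (real n) + 1) \<le> 3 * sqrt (real n)" by linarith
    then have "t * (1 + (sqrt (real n) + 1)) \<le> t * (3 * sqrt (real n))" using t by (intro mult_left_mono)
    then show ?thesis by (simp add: algebra_simps)
  qed
  finally have "hs (A ^\<^sub>m 2) \<le> hs (mat_adjoint G * G) + t * (3 * sqrt (real n))"
    unfolding A2 using hs_Z_sq_le by simp
  then have "(hs (A ^\<^sub>m 2))\<^sup>2 \<le> 2 * (hs (mat_adjoint G * G))\<^sup>2 + 2 * (t * (3 * sqrt (real n)))\<^sup>2"
    using power_mono[of "hs (A ^\<^sub>m 2)" "hs (mat_adjoint G * G) + t * (3 * sqrt (real n))" 2]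
      two[of "hs (mat_adjoint G * G)" "t * (3 * sqrt (real n))"] by simp
  also have "2 * (t * (3 * sqrt (real n)))\<^sup>2 = 288 * \<eta> * (real n)\<^sup>2"
    by (simp add: power_mult_distrib t(3)) (simp add: power2_eq_square)
  finally show "(\<Sum>e\<leftarrow>es. (cmod e) ^ 4) \<le> 2 * (hs (mat_adjoint G * G))\<^sup>2 + 288 * \<eta> * (real n)\<^sup>2"
    using schur_inequality[of "A ^\<^sub>m 2" n "map (\<lambda>e. e ^ 2) es"] A(1) char_poly_pow[OF A(1,2), of 2]
    by (force simp add: o_def norm_power power_mult[symmetric])
qed

end

section \<open>Exponential sums\<close>

definition ee :: "real \<Rightarrow> complex" where "ee x = cis (2 * pi * x)"

lemma ee_add: "ee (x + y) = ee x * ee y"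
  by (simp add: ee_def cis_mult distrib_left)

lemma ee_0 [simp]: "ee 0 = 1"
  by (simp add: ee_def)

lemma cmod_ee [simp]: "cmod (ee x) = 1"
  by (simp add: ee_def)

lemma cnj_ee [simp]: "cnj (ee x) = ee (- x)"
  by (simp add: ee_def cis_cnj)

lemma ee_mult_cnj: "ee x * cnj (ee y) = ee (x - y)"
  by (simp add: ee_add[symmetric])

lemma ee_of_int [simp]: "ee (of_int m) = 1"
  by (simp add: ee_def cis_multiple_2pi)

lemma ee_power: "ee x ^ n = ee (real n * x)"
  by (induction n) (auto simp: ee_add[symmetric] algebra_simps)

lemma ee_eq_1_iff: "ee x = 1 \<longleftrightarrow> x \<in> \<int>"
proof
  assume "ee x = 1"
  then have "cos (2 * pi * x) = 1" by (simp add: ee_def complex_eq_iff)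
  then obtain n :: int where "2 * pi * x = of_int n * 2 * pi" using cos_one_2pi_int by blast
  then have "x = of_int n" by simp
  then show "x \<in> \<int>" by simp
qed (auto simp: ee_def cis_multiple_2pi)

lemma sum_roots_of_unity:
  assumes "0 < N"
  shows "(\<Sum>j<N. ee (real j * (of_int m / real N))) = (if int N dvd m then of_nat N else 0)"
proof (cases "int N dvd m")
  case True
  then obtain l where "m = int N * l" by blast
  then have "ee (real j * (of_int m / real N)) = 1" for j
    using assms ee_of_int[of "int j * l"] by simp
  then show ?thesis using True by simp
next
  case False
  define z where "z = ee (of_int m / real N)"
  have "z \<noteq> 1"
  proof
    assume "z = 1"
    then obtain l :: int where "of_int m / real N = of_int l"
      by (auto simp: z_def ee_eq_1_iff elim: Ints_cases)
    then have "of_int m = real_of_int (int N * l)" using assms by (simp add: field_simps)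
    then have "m = int N * l" by (simp only: of_int_eq_iff)
    then show False using False by simp
  qed
  moreover have "z ^ N = 1" using assms by (simp add: z_def ee_power)
  ultimately have "(\<Sum>j<N. z ^ j) = 0" by (simp add: geometric_sum)
  then show ?thesis using False by (simp add: z_def ee_power)
qed

lemma parseval_count:
  fixes h :: "'a \<Rightarrow> int"
  assumes N: "0 < N" and I: "finite I"
  shows "(\<Sum>j<N. (cmod (\<Sum>i\<in>I. ee (real j * (of_int (h i) / real N))))\<^sup>2)
    = real N * real (card {(i, i'). i \<in> I \<and> i' \<in> I \<and> [h i = h i'] (mod int N)})"
proof -
  have "complex_of_real (\<Sum>j<N. (cmod (\<Sum>i\<in>I. ee (real j * (of_int (h i) / real N))))\<^sup>2) =
      (\<Sum>j<N. \<Sum>i\<in>I. \<Sum>i'\<in>I. ee (real j * (of_int (h i - h i') / real N)))"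
  proof -
    have "real j * (of_int (h i) / real N) - real j * (of_int (h i') / real N) =
        real j * (of_int (h i - h i') / real N)" for i i' j
      by (simp add: right_diff_distrib diff_divide_distrib)
    then show ?thesis
      by (simp only: of_real_sum complex_norm_square cnj_sum sum_product ee_mult_cnj)
  qed
  also have "\<dots> = (\<Sum>i\<in>I. \<Sum>i'\<in>I. \<Sum>j<N. ee (real j * (of_int (h i - h i') / real N)))"
    by (subst sum.swap, intro sum.cong refl, subst sum.swap) simp
  also have "\<dots> = (\<Sum>i\<in>I. \<Sum>i'\<in>I. if [h i = h i'] (mod int N) then of_nat N else 0)"
    by (simp only: sum_roots_of_unity[OF N] cong_iff_dvd_diff)
  also have "\<dots> = (\<Sum>p\<in>I \<times> I. if [h (fst p) = h (snd p)] (mod int N) then of_nat N else 0)"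
    by (simp add: sum.cartesian_product case_prod_unfold)
  also have "\<dots> = of_nat (card {p \<in> I \<times> I. [h (fst p) = h (snd p)] (mod int N)}) * of_nat N"
  proof -
    have "{p \<in> I \<times> I. [h (fst p) = h (snd p)] (mod int N)} =
        (I \<times> I) \<inter> {p. [h (fst p) = h (snd p)] (mod int N)}" by blast
    then show ?thesis using I by (simp add: sum.If_cases)
  qed
  also have "{p \<in> I \<times> I. [h (fst p) = h (snd p)] (mod int N)} =
      {(i, i'). i \<in> I \<and> i' \<in> I \<and> [h i = h i'] (mod int N)}" by auto
  finally have "complex_of_real (\<Sum>j<N. (cmod (\<Sum>i\<in>I. ee (real j * (of_int (h i) / real N))))\<^sup>2)
    = complex_of_real (real N * real (card {(i, i'). i \<in> I \<and> i' \<in> I \<and> [h i = h i'] (mod int N)}))"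
    by (simp add: mult.commute)
  then show ?thesis by (simp only: of_real_eq_iff)
qed

text \<open>If \<open>f\<close> and \<open>g\<close> both embed \<open>X = I = J\<close> in the integers, this is \<open>N\<^sup>2\<close> times the fourth power
  of the Schatten 4-norm of the Fourier transform compressed to \<open>X\<close>.\<close>

definition schatten_sum :: "nat \<Rightarrow> ('a \<Rightarrow> int) \<Rightarrow> 'a set \<Rightarrow> ('b \<Rightarrow> int) \<Rightarrow> 'b set \<Rightarrow> real" where
  "schatten_sum N f I g J =
    (\<Sum>i\<in>I. \<Sum>i'\<in>I. (cmod (\<Sum>j\<in>J. ee (of_int ((f i - f i') * g j) / real N)))\<^sup>2)"

lemma schatten_sum_nonneg [simp]: "0 \<le> schatten_sum N f I g J"
  by (simp add: schatten_sum_def sum_nonneg)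

lemma schatten_sum_expand:
  "complex_of_real (schatten_sum N f I g J) =
    (\<Sum>i\<in>I. \<Sum>i'\<in>I. \<Sum>j\<in>J. \<Sum>j'\<in>J. ee (of_int ((f i - f i') * (g j - g j')) / real N))"
  unfolding schatten_sum_def of_real_sum complex_norm_square cnj_sum sum_product ee_mult_cnj
  by (simp add: right_diff_distrib diff_divide_distrib)

text \<open>After opening the square, the phase is a difference of \<open>f\<close> values times a
  difference of \<open>g\<close> values. The symmetry reflects that a matrix and its adjoint have
  the same singular values.\<close>

lemma schatten_sum_commute: "schatten_sum N f I g J = schatten_sum N g J f I"
proof -
  have "complex_of_real (schatten_sum N f I g J) =
    (\<Sum>i\<in>I. \<Sum>j\<in>J. \<Sum>i'\<in>I. \<Sum>j'\<in>J. ee (of_int ((f i - f i') * (g j - g j')) / real N))"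
    unfolding schatten_sum_expand by (intro sum.cong refl sum.swap)
  also have "\<dots> = (\<Sum>j\<in>J. \<Sum>i\<in>I. \<Sum>j'\<in>J. \<Sum>i'\<in>I. ee (of_int ((f i - f i') * (g j - g j')) / real N))"
    by (subst sum.swap) (intro sum.cong refl sum.swap)
  also have "\<dots> = (\<Sum>j\<in>J. \<Sum>j'\<in>J. \<Sum>i\<in>I. \<Sum>i'\<in>I. ee (of_int ((f i - f i') * (g j - g j')) / real N))"
    by (intro sum.cong refl sum.swap)
  also have "\<dots> = complex_of_real (schatten_sum N g J f I)"
    unfolding schatten_sum_expand by (simp add: mult.commute)
  finally show ?thesis by (simp only: of_real_eq_iff)
qed

text \<open>The outer terms are squares, so the outer index set may be enlarged or counted with
  multiplicity. Termwise this fails for the inner index, which is reached through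
  \<open>schatten_sum_commute\<close>.\<close>

lemma schatten_sum_image_le:
  assumes "finite I" "X \<subseteq> f ` I"
  shows "schatten_sum N id X g J \<le> schatten_sum N f I g J"
proof -
  define \<phi> where "\<phi> p = (cmod (\<Sum>j\<in>J. ee (of_int ((fst p - snd p) * g j) / real N)))\<^sup>2" for p
  have "schatten_sum N id X g J = (\<Sum>p\<in>X \<times> X. \<phi> p)"
    by (simp add: schatten_sum_def sum.cartesian_product \<phi>_def case_prod_unfold)
  also have "\<dots> \<le> (\<Sum>p\<in>map_prod f f ` (I \<times> I). \<phi> p)"
  proof (intro sum_mono2)
    show "X \<times> X \<subseteq> map_prod f f ` (I \<times> I)"
      using assms(2) by (simp add: map_prod_surj_on[OF refl refl] Sigma_mono)
  qed (use assms(1) in \<open>auto simp: \<phi>_def\<close>)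
  also have "\<dots> \<le> (\<Sum>p\<in>I \<times> I. (\<phi> \<circ> map_prod f f) p)"
    using assms by (intro sum_image_le) (auto simp: \<phi>_def)
  also have "\<dots> = schatten_sum N f I g J"
    by (simp add: schatten_sum_def sum.cartesian_product \<phi>_def case_prod_unfold)
  finally show ?thesis .
qed

text \<open>Once the cover sits in the inner sum, the exponential sum over
  \<open>C \<times> H\<close> factors, and the factor over \<open>H\<close> is bounded trivially.
  Thickening thus costs only a power of \<open>card H\<close>, whatever the arithmetic of
  \<open>C\<close>.\<close>

lemma schatten_sum_cover:
  assumes "finite C" "finite H" "X \<subseteq> (\<lambda>(c, h). c + h) ` (C \<times> H)"
  shows "schatten_sum N id X g J \<le> (real (card H))\<^sup>2 * schatten_sum N id C g J"
proof -
  define f where "f = (\<lambda>(c, h). c + h :: int)"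
  have "schatten_sum N id X g J \<le> schatten_sum N f (C \<times> H) g J"
    using assms by (intro schatten_sum_image_le) (auto simp: f_def)
  also have "\<dots> = schatten_sum N g J f (C \<times> H)" by (rule schatten_sum_commute)
  also have "\<dots> \<le> (\<Sum>i\<in>J. \<Sum>i'\<in>J. (real (card H))\<^sup>2 *
      (cmod (\<Sum>c\<in>C. ee (of_int ((g i - g i') * c) / real N)))\<^sup>2)"
    unfolding schatten_sum_def
  proof (intro sum_mono)
    fix i i'
    let ?m = "g i - g i'"
    have "(\<Sum>p\<in>C \<times> H. ee (of_int (?m * f p) / real N)) =
        (\<Sum>c\<in>C. \<Sum>h\<in>H. ee (of_int (?m * c) / real N) * ee (of_int (?m * h) / real N))"
      by (simp add: sum.cartesian_product f_def case_prod_unfold ee_add[symmetric] distrib_left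
          add_divide_distrib)
    also have "\<dots> = (\<Sum>h\<in>H. ee (of_int (?m * h) / real N)) * (\<Sum>c\<in>C. ee (of_int (?m * c) / real N))"
      by (simp add: sum_product sum.swap[of _ C H] mult.commute)
    finally have "cmod (\<Sum>p\<in>C \<times> H. ee (of_int (?m * f p) / real N)) =
        cmod (\<Sum>h\<in>H. ee (of_int (?m * h) / real N)) * cmod (\<Sum>c\<in>C. ee (of_int (?m * c) / real N))"
      by (simp only: norm_mult)
    moreover have "cmod (\<Sum>h\<in>H. ee (of_int (?m * h) / real N)) \<le> real (card H)"
      using norm_sum[of "\<lambda>h. ee (of_int (?m * h) / real N)" H] by simp
    ultimately have "cmod (\<Sum>p\<in>C \<times> H. ee (of_int (?m * f p) / real N)) \<le>
        real (card H) * cmod (\<Sum>c\<in>C. ee (of_int (?m * c) / real N))"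
      by (simp add: mult_right_mono)
    then show "(cmod (\<Sum>p\<in>C \<times> H. ee (of_int (?m * f p) / real N)))\<^sup>2 \<le>
        (real (card H))\<^sup>2 * (cmod (\<Sum>c\<in>C. ee (of_int (?m * c) / real N)))\<^sup>2"
      using power_mono[of _ _ 2] by (fastforce simp: power_mult_distrib)
  qed
  also have "\<dots> = (real (card H))\<^sup>2 * schatten_sum N g J id C"
    by (simp add: schatten_sum_def sum_distrib_left)
  finally show ?thesis by (simp add: schatten_sum_commute[of N g J])
qed

lemma schatten_sum_cover2:
  assumes "finite C" "finite H" "X \<subseteq> (\<lambda>(c, h). c + h) ` (C \<times> H)"
  shows "schatten_sum N id X id X \<le> (real (card H)) ^ 4 * schatten_sum N id C id C"
proof -
  have "schatten_sum N id X id X \<le> (real (card H))\<^sup>2 * schatten_sum N id X id C"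
    using schatten_sum_cover[OF assms, of N id X] schatten_sum_commute[of N id C id X] by simp
  also have "\<dots> \<le> (real (card H))\<^sup>2 * ((real (card H))\<^sup>2 * schatten_sum N id C id C)"
    using schatten_sum_cover[OF assms, of N id C] by (intro mult_left_mono) auto
  finally show ?thesis by (simp add: power4_eq_xxxx power2_eq_square mult.assoc)
qed

subsection \<open>The bound by additive energy\<close>

lemma card_quadruples:
  "card {(a, b, c, d). P a b c d} = card {(p, q). P (fst p) (snd p) (fst q) (snd q)}"
  "card {(a, b, c, d). P a b c d} = card {(p, q). P (fst p) (snd q) (fst q) (snd p)}"
proof -
  define f where "f = (\<lambda>(a :: 'a, b :: 'b, c :: 'c, d :: 'd). ((a, b), (c, d)))"
  define g where "g = (\<lambda>(a :: 'a, b :: 'b, c :: 'c, d :: 'd). ((a, d), (c, b)))"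
  have "inj f" "inj g" by (auto simp: inj_def f_def g_def)
  moreover have "{(p, q). P (fst p) (snd p) (fst q) (snd q)} = f ` {(a, b, c, d). P a b c d}"
    by (auto simp: f_def image_iff)
  moreover have "{(p, q). P (fst p) (snd q) (fst q) (snd p)} = g ` {(a, b, c, d). P a b c d}"
    by (auto simp: g_def image_iff)
  ultimately show "card {(a, b, c, d). P a b c d} = card {(p, q). P (fst p) (snd p) (fst q) (snd q)}"
    "card {(a, b, c, d). P a b c d} = card {(p, q). P (fst p) (snd q) (fst q) (snd p)}"
    using card_image[OF inj_on_subset[OF \<open>inj f\<close> subset_UNIV], of "{(a, b, c, d). P a b c d}"]
      card_image[OF inj_on_subset[OF \<open>inj g\<close> subset_UNIV], of "{(a, b, c, d). P a b c d}"]
    by simp_all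
qed

text \<open>The same quadruples paired in two ways: equal sums give the fourth moment of the
  exponential sum, equal differences the second moment of the number of representations as a
  difference.\<close>

lemma additive_energy_eq:
  shows "additive_energy N X =
      card {(p, q). p \<in> X \<times> X \<and> q \<in> X \<times> X \<and>
        [int (fst p) + int (snd p) = int (fst q) + int (snd q)] (mod int N)}"
    and "additive_energy N X =
      card {(p, q). p \<in> X \<times> X \<and> q \<in> X \<times> X \<and>
        [int (fst p) - int (snd p) = int (fst q) - int (snd q)] (mod int N)}"
proof -
  have 1: "[a + b = c + d] (mod N) \<longleftrightarrow> [int a + int b = int c + int d] (mod int N)" for a b c d
    by (metis cong_int_iff of_nat_add)
  have 2: "[a - d = c - b] (mod int N) \<longleftrightarrow> [a + b = c + d] (mod int N)"
    for a b c d :: int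
  proof -
    have "a - d - (c - b) = a + b - (c + d)" by simp
    then show ?thesis unfolding cong_iff_dvd_diff by (simp only:)
  qed
  show "additive_energy N X =
      card {(p, q). p \<in> X \<times> X \<and> q \<in> X \<times> X \<and>
        [int (fst p) + int (snd p) = int (fst q) + int (snd q)] (mod int N)}"
    unfolding additive_energy_def 1 card_quadruples(1)
    by (rule arg_cong[of _ _ card], rule Collect_cong) (simp only: mem_Times_iff case_prod_unfold, blast)
  show "additive_energy N X =
      card {(p, q). p \<in> X \<times> X \<and> q \<in> X \<times> X \<and>
        [int (fst p) - int (snd p) = int (fst q) - int (snd q)] (mod int N)}"
    unfolding additive_energy_def 1 2 card_quadruples(2)
    by (rule arg_cong[of _ _ card], rule Collect_cong) (simp only: mem_Times_iff case_prod_unfold, blast)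
qed

text \<open>Grouped by the residue \<open>j\<close> of the difference, the terms are
  \<open>r j\<close> times the squared modulus of \<open>f j\<close>. Cauchy--Schwarz separates the
  two: the squares of \<open>r\<close> add up to the energy, and by Parseval the fourth powers of
  \<open>f\<close> to \<open>N\<close> times the energy.\<close>

lemma schatten_sum_le_energy:
  assumes N: "0 < N" and X: "finite X"
  shows "schatten_sum N id (int ` X) id (int ` X) \<le> sqrt (real N) * real (additive_energy N X)"
proof -
  define f where "f j = (\<Sum>x\<in>X. ee (real j * (of_int (int x) / real N)))" for j
  define d where "d = (\<lambda>p. int (fst p) - int (snd p))"
  define r where "r j = card {p \<in> X \<times> X. nat (d p mod int N) = j}" for j
  have lt: "nat (d p mod int N) < N" for p using N by (simp add: nat_less_iff)
  have f_mod: "(\<Sum>x\<in>X. ee (of_int (m * int x) / real N)) = f (nat (m mod int N))" for m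
    unfolding f_def
  proof (rule sum.cong[OF refl])
    fix x
    define r q where "r = m mod int N" and "q = m div int N"
    have "m = r + int N * q" by (simp add: r_def q_def)
    then have "of_int (m * int x) / real N = of_int (r * int x) / real N + of_int (q * int x)"
      using N by (simp add: field_simps)
    then have "ee (of_int (m * int x) / real N) = ee (of_int ((m mod int N) * int x) / real N)"
      by (simp only: ee_add ee_of_int mult_1_right r_def)
    moreover have "real (nat (m mod int N)) = of_int (m mod int N)" using N by simp
    ultimately show "ee (of_int (m * int x) / real N) =
        ee (real (nat (m mod int N)) * (of_int (int x) / real N))" by simp
  qed
  have "schatten_sum N id (int ` X) id (int ` X) = (\<Sum>p\<in>X \<times> X. (cmod (f (nat (d p mod int N))))\<^sup>2)"
  proof -
    have "schatten_sum N id (int ` X) id (int ` X) = schatten_sum N int X int X"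
      by (simp add: schatten_sum_def sum.reindex)
    then show ?thesis
      by (simp add: schatten_sum_def sum.cartesian_product d_def case_prod_unfold flip: f_mod)
  qed
  also have "\<dots> = (\<Sum>j<N. \<Sum>p | p \<in> X \<times> X \<and> nat (d p mod int N) = j. (cmod (f (nat (d p mod int N))))\<^sup>2)"
    by (rule sum.group[symmetric]) (use X lt in auto)
  also have "\<dots> = (\<Sum>j<N. \<bar>real (r j)\<bar> * \<bar>(cmod (f j))\<^sup>2\<bar>)"
    by (intro sum.cong refl) (simp add: r_def)
  also have "\<dots> \<le> L2_set (\<lambda>j. real (r j)) {..<N} * L2_set (\<lambda>j. (cmod (f j))\<^sup>2) {..<N}"
    by (rule L2_set_mult_ineq)
  also have "L2_set (\<lambda>j. real (r j)) {..<N} = sqrt (real (additive_energy N X))"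
  proof -
    have "{(p, q). p \<in> X \<times> X \<and> q \<in> X \<times> X \<and> [d p = d q] (mod int N)} =
        (\<Union>j<N. {p \<in> X \<times> X. nat (d p mod int N) = j} \<times> {p \<in> X \<times> X. nat (d p mod int N) = j})"
      (is "?L = ?R")
    proof -
      have "[d p = d q] (mod int N) \<longleftrightarrow> nat (d p mod int N) = nat (d q mod int N)" for p q
        using N by (simp add: Cong.cong_def eq_nat_nat_iff)
      then show ?thesis using lt by auto
    qed
    moreover have "card ?R = (\<Sum>j<N. (r j)\<^sup>2)"
      using X by (subst card_UN_disjoint) (auto simp: r_def card_cartesian_product power2_eq_square)
    ultimately have "additive_energy N X = (\<Sum>j<N. (r j)\<^sup>2)"
      using additive_energy_eq(2)[of N X] by (simp add: d_def)
    then show ?thesis by (simp add: L2_set_def)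
  qed
  also have "L2_set (\<lambda>j. (cmod (f j))\<^sup>2) {..<N} = sqrt (real N * real (additive_energy N X))"
  proof -
    have "(f j)\<^sup>2 = (\<Sum>p\<in>X \<times> X. ee (real j * (of_int (int (fst p) + int (snd p)) / real N)))" for j
      unfolding f_def power2_eq_square sum_product
      by (simp add: sum.cartesian_product case_prod_unfold ee_add[symmetric] algebra_simps add_divide_distrib)
    then have "((cmod (f j))\<^sup>2)\<^sup>2 =
        (cmod (\<Sum>p\<in>X \<times> X. ee (real j * (of_int (int (fst p) + int (snd p)) / real N))))\<^sup>2" for j
      by (metis norm_power)
    then show ?thesis
      using parseval_count[OF N, of "X \<times> X" "\<lambda>p. int (fst p) + int (snd p)"] X
        additive_energy_eq(1)[of N X]
      by (simp add: L2_set_def)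
  qed
  finally show ?thesis by (simp add: real_sqrt_mult mult_ac id_def)
qed

subsection \<open>Exponential sums over Cantor sets\<close>

definition digit_sum :: "nat set \<Rightarrow> real \<Rightarrow> complex" where
  "digit_sum A x = (\<Sum>a\<in>A. ee (x * real a))"

lemma digit_sum_add_int: "digit_sum A (x + of_int m) = digit_sum A x"
proof -
  have "ee ((x + of_int m) * real a) = ee (x * real a)" for a
    using ee_of_int[of "m * int a"] by (simp add: distrib_right ee_add)
  then show ?thesis by (simp add: digit_sum_def)
qed

lemma cmod_digit_sum_le: "cmod (digit_sum A x) \<le> real (card A)"
  unfolding digit_sum_def using norm_sum[of "\<lambda>a. ee (x * real a)" A] by simp

text \<open>All digits but two are estimated trivially. The bound uses the squared modulus of
  \<open>1 + w\<close>, which for unimodular \<open>w\<close> is affine in \<open>Re w\<close>, so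
  that two such bounds can be added and compared.\<close>

lemma digit_sum_gain:
  assumes A: "finite A" "a \<in> A" "a' \<in> A" "a \<noteq> a'"
  shows "(cmod (digit_sum A x))\<^sup>2 \<le> (real (card A))\<^sup>2 - 4 + (cmod (1 + ee (x * (real a' - real a))))\<^sup>2"
proof -
  define q where "q = cmod (1 + ee (x * (real a' - real a)))"
  define m where "m = real (card A)"
  have cA: "card (A - {a, a'}) = card A - 2" "2 \<le> card A"
    using A card_Diff_subset[of "{a, a'}" A] card_mono[of A "{a, a'}"] by auto
  have "digit_sum A x = (\<Sum>b\<in>A - {a, a'}. ee (x * real b)) + (\<Sum>b\<in>{a, a'}. ee (x * real b))"
    unfolding digit_sum_def using A by (intro sum.subset_diff) auto
  moreover have "cmod (\<Sum>b\<in>A - {a, a'}. ee (x * real b)) \<le> m - 2"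
    using norm_sum[of "\<lambda>b. ee (x * real b)" "A - {a, a'}"] cA by (simp add: m_def of_nat_diff)
  moreover have "(\<Sum>b\<in>{a, a'}. ee (x * real b)) = ee (x * real a) * (1 + ee (x * (real a' - real a)))"
    using A by (simp add: ring_distribs ee_add[symmetric])
  ultimately have "cmod (digit_sum A x) \<le> (m - 2) + q"
    using norm_triangle_ineq[of "\<Sum>b\<in>A - {a, a'}. ee (x * real b)" "\<Sum>b\<in>{a, a'}. ee (x * real b)"]
    by (simp add: q_def norm_mult)
  then have "(cmod (digit_sum A x))\<^sup>2 \<le> ((m - 2) + q)\<^sup>2" by (intro power_mono) auto
  also have "\<dots> \<le> m\<^sup>2 - 4 + q\<^sup>2"
  proof -
    have "q \<le> 2" unfolding q_def using norm_triangle_ineq[of 1 "ee (x * (real a' - real a))"] by simp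
    moreover have "m \<ge> 2" using cA by (simp add: m_def)
    ultimately have "0 \<le> (m - 2) * (2 - q)" by simp
    then show ?thesis by (simp add: power2_eq_square algebra_simps)
  qed
  finally show ?thesis by (simp add: q_def m_def)
qed

lemma cmod_one_plus_sq: "cmod w = 1 \<Longrightarrow> (cmod (1 + w))\<^sup>2 = 2 + 2 * Re w"
proof -
  assume "cmod w = 1"
  then have "(Re w)\<^sup>2 + (Im w)\<^sup>2 = 1" by (simp add: cmod_def)
  then show ?thesis by (simp add: cmod_power2 power2_sum)
qed

text \<open>If all terms had modulus \<open>(card A)\<^sup>4\<close>, then \<open>d * x\<close> would be an integer for all differences
  \<open>d\<close> of digits and all arguments \<open>x\<close>; but two of the arguments differ by \<open>d / M\<^sup>2\<close>, and
  \<open>0 < d\<^sup>2 / M\<^sup>2 < 1\<close> for a nonzero difference.\<close>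

lemma two_digit_gain:
  assumes A: "A \<subseteq> {0..<M}" "2 \<le> card A"
  shows "\<exists>c>0. c < 1 \<and> (\<forall>y. (\<Sum>(\<alpha>, \<beta>)\<in>A \<times> A. \<Sum>(\<alpha>', \<beta>')\<in>A \<times> A.
        (cmod (digit_sum A ((y + (real \<alpha> - real \<beta>)) / real M)))\<^sup>2 *
        (cmod (digit_sum A (((y + (real \<alpha> - real \<beta>)) / real M + (real \<alpha>' - real \<beta>')) / real M)))\<^sup>2)
      \<le> c * real (card A) ^ 8)"
proof -
  have fin: "finite A" using A(1) finite_subset by blast
  obtain a a' where aa: "a \<in> A" "a' \<in> A" "a \<noteq> a'"
    using A(2) card_le_Suc0_iff_eq[OF fin] by force
  have M: "0 < M" "a < M" "a' < M" using aa A(1) by auto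
  define m where "m = real (card A)"
  have m: "2 \<le> m" using A(2) by (simp add: m_def)
  define d where "d = real a' - real a"
  \<comment> \<open>The two arguments compared below differ by \<open>d / M^2\<close>; the relative
    phases of the digits \<open>a\<close> and \<open>a'\<close> at them then differ by the factor
    \<open>u\<close>, which is independent of \<open>y\<close>.\<close>
  define u where "u = ee (d\<^sup>2 / (real M)\<^sup>2)"
  have "d\<^sup>2 / (real M)\<^sup>2 \<notin> \<int>"
  proof
    have "\<bar>d\<bar> < real M" "d \<noteq> 0" using M aa by (auto simp: d_def)
    then have "0 < d\<^sup>2" "d\<^sup>2 < (real M)\<^sup>2" by (auto simp: abs_square_less_1 intro: power2_strict_mono)
    then have "0 < d\<^sup>2 / (real M)\<^sup>2" "d\<^sup>2 / (real M)\<^sup>2 < 1" using M by auto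
    moreover assume "d\<^sup>2 / (real M)\<^sup>2 \<in> \<int>"
    ultimately show False by (auto elim!: Ints_cases)
  qed
  then have "u \<noteq> 1" by (simp add: u_def ee_eq_1_iff)
  have cu: "cmod u = 1" by (simp add: u_def)
  have "Re u < 1"
  proof (rule ccontr)
    assume "\<not> Re u < 1"
    moreover have "Re u \<le> 1" using complex_Re_le_cmod[of u] cu by simp
    ultimately have "Re u = 1" by simp
    moreover then have "Im u = 0" using cu by (simp add: cmod_def)
    ultimately show False using \<open>u \<noteq> 1\<close> by (simp add: complex_eq_iff)
  qed
  \<comment> \<open>For unimodular \<open>w\<close> the squared moduli of \<open>1 + w\<close> and
    \<open>1 + w * u\<close> add up to \<open>4 + 2 * Re (w * (1 + u))\<close>, at most
    \<open>8 - \<kappa>\<close>: as \<open>u\<close> is not 1, both phases cannot be 1.\<close>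
  define \<kappa> where "\<kappa> = 2 * (2 - cmod (1 + u))"
  have "(cmod (1 + u))\<^sup>2 < 2\<^sup>2" using cmod_one_plus_sq[OF cu] \<open>Re u < 1\<close> by simp
  then have "cmod (1 + u) < 2" by (rule power_less_imp_less_base) simp
  then have \<kappa>: "0 < \<kappa>" by (simp add: \<kappa>_def)
  have "\<kappa> \<le> 4" by (simp add: \<kappa>_def)
  \<comment> \<open>Out of \<open>m ^ 8\<close> the amount \<open>m^2 * \<kappa>\<close> is lost:
    \<kappa> from the second digit sum, \<open>m^2\<close> from the trivial bound for the
    first.\<close>
  define c where "c = 1 - \<kappa> / m ^ 6"
  have m6: "2 ^ 6 \<le> m ^ 6" using m by (intro power_mono) auto
  have "\<kappa> < m ^ 6" using \<open>\<kappa> \<le> 4\<close> m6 by simp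
  then have c: "0 < c" "c < 1" using \<kappa> m by (auto simp: c_def)
  have "(\<Sum>(\<alpha>, \<beta>)\<in>A \<times> A. \<Sum>(\<alpha>', \<beta>')\<in>A \<times> A.
        (cmod (digit_sum A ((y + (real \<alpha> - real \<beta>)) / real M)))\<^sup>2 *
        (cmod (digit_sum A (((y + (real \<alpha> - real \<beta>)) / real M + (real \<alpha>' - real \<beta>')) / real M)))\<^sup>2)
      \<le> c * m ^ 8" for y
  proof -
    define D where "D x = (cmod (digit_sum A x))\<^sup>2" for x
    have D: "D x \<le> m\<^sup>2" "0 \<le> D x" for x
      unfolding D_def m_def by (auto intro: power_mono cmod_digit_sum_le)
    define x where "x p = (y + (real (fst p) - real (snd p))) / real M" for p :: "nat \<times> nat"
    define t where "t p = D (x (fst p)) * D ((x (fst p) + (real (fst (snd p)) - real (snd (snd p)))) / real M)"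
      for p :: "(nat \<times> nat) \<times> (nat \<times> nat)"
    have t: "t p \<le> m ^ 4" for p
    proof -
      have "t p \<le> m\<^sup>2 * m\<^sup>2" unfolding t_def using D by (intro mult_mono) auto
      then show ?thesis by (simp add: power2_eq_square power4_eq_xxxx mult.assoc)
    qed
    have t': "t p \<le> m\<^sup>2 * D ((x (fst p) + (real (fst (snd p)) - real (snd (snd p)))) / real M)" for p
      unfolding t_def using D by (intro mult_right_mono) auto
    define B where "B = (A \<times> A) \<times> (A \<times> A)"
    have B: "finite B" "real (card B) = m ^ 4"
      using fin by (auto simp: B_def card_cartesian_product m_def power4_eq_xxxx)
    \<comment> \<open>The two terms differ only in the first digit \<alpha>, and the second pair of
      digits cancels; so the second digit sum is taken at \<open>y / M^2\<close> and at
      \<open>(y + d) / M^2\<close>.\<close>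
    define p1 where "p1 = ((a, a), (a, a))"
    define p2 where "p2 = ((a', a), (a, a))"
    have p: "{p1, p2} \<subseteq> B" "p1 \<noteq> p2" using aa by (auto simp: B_def p1_def p2_def)
    define w where "w = ee (y / (real M)\<^sup>2 * d)"
    have "D (y / (real M)\<^sup>2) \<le> m\<^sup>2 - 4 + (cmod (1 + w))\<^sup>2"
      using digit_sum_gain[OF fin aa, of "y / (real M)\<^sup>2"] by (simp add: D_def m_def w_def d_def)
    moreover have "D ((y + d) / (real M)\<^sup>2) \<le> m\<^sup>2 - 4 + (cmod (1 + w * u))\<^sup>2"
    proof -
      have "ee ((y + d) / (real M)\<^sup>2 * d) = w * u"
        unfolding w_def u_def ee_add[symmetric]
        by (simp add: add_divide_distrib distrib_right power2_eq_square)
      then show ?thesis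
        using digit_sum_gain[OF fin aa, of "(y + d) / (real M)\<^sup>2"] by (simp add: D_def m_def d_def)
    qed
    moreover have "(cmod (1 + w))\<^sup>2 + (cmod (1 + w * u))\<^sup>2 \<le> 8 - \<kappa>"
    proof -
      have w: "cmod w = 1" by (simp add: w_def)
      have "(cmod (1 + w))\<^sup>2 + (cmod (1 + w * u))\<^sup>2 = 4 + 2 * Re (w * (1 + u))"
        using w cu by (simp add: cmod_one_plus_sq norm_mult algebra_simps)
      also have "Re (w * (1 + u)) \<le> cmod (1 + u)"
        using complex_Re_le_cmod[of "w * (1 + u)"] w by (simp only: norm_mult)
      finally show ?thesis by (simp add: \<kappa>_def)
    qed
    ultimately have "D (y / (real M)\<^sup>2) + D ((y + d) / (real M)\<^sup>2) \<le> 2 * m\<^sup>2 - \<kappa>" by linarith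
    then have "m\<^sup>2 * D (y / (real M)\<^sup>2) + m\<^sup>2 * D ((y + d) / (real M)\<^sup>2) \<le> m\<^sup>2 * (2 * m\<^sup>2 - \<kappa>)"
      unfolding distrib_left[symmetric] by (intro mult_left_mono) auto
    moreover have "t p1 \<le> m\<^sup>2 * D (y / (real M)\<^sup>2)" "t p2 \<le> m\<^sup>2 * D ((y + d) / (real M)\<^sup>2)"
      using t'[of p1] t'[of p2] by (simp_all add: p1_def p2_def x_def d_def power2_eq_square)
    ultimately have "t p1 + t p2 \<le> m\<^sup>2 * (2 * m\<^sup>2 - \<kappa>)"
      by linarith
    then have tt: "m\<^sup>2 * \<kappa> \<le> (\<Sum>p\<in>{p1, p2}. m ^ 4 - t p)"
      using p(2) by (simp add: algebra_simps power2_eq_square power4_eq_xxxx)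
    also have "\<dots> \<le> (\<Sum>p\<in>B. m ^ 4 - t p)"
      using B p t by (intro sum_mono2) auto
    also have "\<dots> = m ^ 8 - (\<Sum>p\<in>B. t p)"
      using B by (simp add: sum_subtractf flip: power_add)
    finally have "(\<Sum>p\<in>B. t p) \<le> m ^ 8 - m\<^sup>2 * \<kappa>" by simp
    also have "\<dots> = c * m ^ 8"
    proof -
      have "m ^ 8 = m\<^sup>2 * m ^ 6" by (simp flip: power_add)
      moreover have "\<kappa> / m ^ 6 * (m\<^sup>2 * m ^ 6) = m\<^sup>2 * \<kappa>"
        using m by (simp del: power_add_numeral power_add_numeral2)
      ultimately have "\<kappa> / m ^ 6 * m ^ 8 = m\<^sup>2 * \<kappa>" by (simp only:)
      then show ?thesis unfolding c_def left_diff_distrib by simp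
    qed
    finally have "(\<Sum>p\<in>B. t p) \<le> c * m ^ 8" .
    moreover have "(\<Sum>p\<in>B. t p) = (\<Sum>p\<in>A \<times> A. \<Sum>q\<in>A \<times> A. t (p, q))"
      unfolding B_def sum.cartesian_product by simp
    ultimately show ?thesis
      by (simp add: t_def D_def x_def case_prod_unfold)
  qed
  then show ?thesis using c unfolding m_def by blast
qed


section \<open>Cantor sets built by adding a leading digit, and their Riesz products\<close>

lemma cantor_set_0 [simp]: "cantor_set M A 0 = {0}"
  by (simp add: cantor_set_def)

lemma cantor_set_Suc:
  "cantor_set M A (Suc k) = (\<lambda>(c, a). c + a * M ^ k) ` (cantor_set M A k \<times> A)"
proof (intro equalityI subsetI)
  fix x assume "x \<in> cantor_set M A (Suc k)"
  then obtain a where a: "x = (\<Sum>j<Suc k. a j * M ^ j)" "\<forall>j<Suc k. a j \<in> A"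
    by (auto simp: cantor_set_def)
  then have "(\<Sum>j<k. a j * M ^ j, a k) \<in> cantor_set M A k \<times> A"
    by (auto simp: cantor_set_def)
  then show "x \<in> (\<lambda>(c, a). c + a * M ^ k) ` (cantor_set M A k \<times> A)"
    using a(1) by (force intro: image_eqI)
next
  fix x assume "x \<in> (\<lambda>(c, a). c + a * M ^ k) ` (cantor_set M A k \<times> A)"
  then obtain a b where a: "x = (\<Sum>j<k. a j * M ^ j) + b * M ^ k" "\<forall>j<k. a j \<in> A" "b \<in> A"
    by (auto simp: cantor_set_def)
  have "x = (\<Sum>j<Suc k. (a(k := b)) j * M ^ j)" using a by simp
  moreover have "\<forall>j<Suc k. (a(k := b)) j \<in> A" using a by (auto simp: less_Suc_eq)
  ultimately show "x \<in> cantor_set M A (Suc k)" unfolding cantor_set_def by blast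
qed

lemma cantor_set_less:
  assumes "A \<subseteq> {0..<M}" "c \<in> cantor_set M A k"
  shows "c < M ^ k"
  using assms(2)
proof (induction k arbitrary: c)
  case (Suc k)
  then obtain c' a where c: "c = c' + a * M ^ k" "c' < M ^ k" "a < M"
    using assms(1) by (auto simp: cantor_set_Suc)
  then have "c < (a + 1) * M ^ k" by simp
  also have "\<dots> \<le> M * M ^ k" using c by (intro mult_right_mono) auto
  finally show ?case by simp
qed simp

lemma inj_on_cantor_Suc:
  assumes "A \<subseteq> {0..<M}"
  shows "inj_on (\<lambda>(c, a). c + a * M ^ k) (cantor_set M A k \<times> A)"
proof (rule inj_onI, clarify)
  fix c a c' a'
  assume c: "c \<in> cantor_set M A k" "c' \<in> cantor_set M A k"
    and eq: "c + a * M ^ k = c' + a' * M ^ k"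
  have lt: "c < M ^ k" "c' < M ^ k" using c assms cantor_set_less by auto
  have "(c + a * M ^ k) mod M ^ k = (c' + a' * M ^ k) mod M ^ k" using eq by simp
  then have "c = c'" using lt by simp
  moreover have "M ^ k \<noteq> 0" using lt by linarith
  ultimately show "c = c' \<and> a = a'" using eq by auto
qed

lemma finite_cantor_set [simp]:
  assumes "A \<subseteq> {0..<M}" shows "finite (cantor_set M A k)"
proof (rule finite_subset)
  show "cantor_set M A k \<subseteq> {..<M ^ k}" using cantor_set_less[OF assms] by blast
qed simp

lemma card_cantor_set:
  assumes "A \<subseteq> {0..<M}" shows "card (cantor_set M A k) = card A ^ k"
  by (induction k)
    (simp_all add: cantor_set_Suc card_image[OF inj_on_cantor_Suc[OF assms]] card_cartesian_product)

lemma sum_cantor_Suc: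
  fixes f :: "nat \<Rightarrow> 'a :: comm_monoid_add"
  assumes "A \<subseteq> {0..<M}"
  shows "(\<Sum>c\<in>cantor_set M A (Suc k). f c) = (\<Sum>c\<in>cantor_set M A k. \<Sum>a\<in>A. f (c + a * M ^ k))"
  unfolding cantor_set_Suc sum.reindex[OF inj_on_cantor_Suc[OF assms]] sum.cartesian_product
  by (simp add: case_prod_unfold o_def)

lemma sum_cantor_diff_Suc:
  fixes f :: "int \<Rightarrow> real"
  assumes "A \<subseteq> {0..<M}"
  shows "(\<Sum>a\<in>cantor_set M A (Suc k). \<Sum>b\<in>cantor_set M A (Suc k). f (int a - int b)) =
    (\<Sum>a\<in>cantor_set M A k. \<Sum>b\<in>cantor_set M A k. \<Sum>(\<alpha>, \<beta>)\<in>A \<times> A.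
      f (int a - int b + (int \<alpha> - int \<beta>) * int M ^ k))"
proof -
  have "(\<Sum>a\<in>cantor_set M A (Suc k). \<Sum>b\<in>cantor_set M A (Suc k). f (int a - int b)) =
    (\<Sum>a\<in>cantor_set M A k. \<Sum>\<alpha>\<in>A. \<Sum>b\<in>cantor_set M A k. \<Sum>\<beta>\<in>A.
      f (int (a + \<alpha> * M ^ k) - int (b + \<beta> * M ^ k)))"
    by (simp only: sum_cantor_Suc[OF assms])
  also have "\<dots> = (\<Sum>a\<in>cantor_set M A k. \<Sum>b\<in>cantor_set M A k. \<Sum>\<alpha>\<in>A. \<Sum>\<beta>\<in>A.
      f (int (a + \<alpha> * M ^ k) - int (b + \<beta> * M ^ k)))"
    by (intro sum.cong refl sum.swap)
  also have "\<dots> = (\<Sum>a\<in>cantor_set M A k. \<Sum>b\<in>cantor_set M A k. \<Sum>(\<alpha>, \<beta>)\<in>A \<times> A.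
      f (int a - int b + (int \<alpha> - int \<beta>) * int M ^ k))"
    unfolding sum.cartesian_product[symmetric]
    by (intro sum.cong refl arg_cong[of _ _ f]) (simp add: algebra_simps)
  finally show ?thesis .
qed

lemma sum_ee_cantor_set:
  assumes "A \<subseteq> {0..<M}"
  shows "(\<Sum>c\<in>cantor_set M A k. ee (x * real c)) = (\<Prod>s<k. digit_sum A (x * real M ^ s))"
proof (induction k)
  case (Suc k)
  have "(\<Sum>c\<in>cantor_set M A (Suc k). ee (x * real c)) =
      (\<Sum>c\<in>cantor_set M A k. \<Sum>a\<in>A. ee (x * real c) * ee (x * real M ^ k * real a))"
    unfolding sum_cantor_Suc[OF assms] ee_add[symmetric]
    by (intro sum.cong refl arg_cong[of _ _ ee]) (simp add: algebra_simps)
  also have "\<dots> = (\<Sum>c\<in>cantor_set M A k. ee (x * real c)) * digit_sum A (x * real M ^ k)"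
    by (simp add: digit_sum_def sum_product)
  finally show ?case using Suc by simp
qed simp

text \<open>The squared modulus of the exponential sum over the Cantor set at frequency
  \<open>m / M ^ k\<close>. The first \<open>r\<close> factors depend only on \<open>m\<close>
  modulo \<open>M ^ r\<close>, so a new leading digit of \<open>m\<close> appends one factor and
  leaves the others alone.\<close>

definition riesz_product :: "nat \<Rightarrow> nat set \<Rightarrow> nat \<Rightarrow> int \<Rightarrow> real" where
  "riesz_product M A k m = (\<Prod>r<k. (cmod (digit_sum A (of_int m / real M ^ Suc r)))\<^sup>2)"

lemma riesz_product_nonneg [simp]: "0 \<le> riesz_product M A k m"
  by (simp add: riesz_product_def prod_nonneg)

lemma riesz_product_Suc:
  assumes M: "0 < M"
  shows "riesz_product M A (Suc k) (m + d * int M ^ k) =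
    riesz_product M A k m * (cmod (digit_sum A ((of_int m / real M ^ k + of_int d) / real M)))\<^sup>2"
proof -
  have "digit_sum A (of_int (m + d * int M ^ k) / real M ^ Suc r) = digit_sum A (of_int m / real M ^ Suc r)"
    if "r < k" for r
  proof -
    have "real M ^ k = real M ^ (k - Suc r) * real M ^ Suc r"
      using that by (subst power_add[symmetric]) simp
    then have "of_int (m + d * int M ^ k) / real M ^ Suc r =
        of_int m / real M ^ Suc r + of_int (d * int M ^ (k - Suc r))"
      using M by (simp add: add_divide_distrib)
    then show ?thesis by (simp only: digit_sum_add_int)
  qed
  moreover have "of_int (m + d * int M ^ k) / real M ^ Suc k = (of_int m / real M ^ k + of_int d) / real M"
    using M by (simp add: field_simps)
  ultimately show ?thesis by (simp add: riesz_product_def del: power_Suc)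
qed

lemma schatten_sum_cantor:
  assumes A: "A \<subseteq> {0..<M}" and M: "0 < M"
  shows "schatten_sum (M ^ k) id (int ` cantor_set M A k) id (int ` cantor_set M A k) =
    (\<Sum>a\<in>cantor_set M A k. \<Sum>b\<in>cantor_set M A k. riesz_product M A k (int a - int b))"
proof -
  have "(cmod (\<Sum>c\<in>cantor_set M A k. ee (of_int (m * int c) / real (M ^ k))))\<^sup>2 = riesz_product M A k m" for m
  proof -
    have "(\<Sum>c\<in>cantor_set M A k. ee (of_int (m * int c) / real (M ^ k))) =
        (\<Prod>s<k. digit_sum A (of_int m / real M ^ k * real M ^ s))"
      using sum_ee_cantor_set[OF A, where k = k and x = "of_int m / real M ^ k"] by simp
    \<comment> \<open>The order is reversed: the lowest digit of \<open>c\<close> belongs to the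
      factor that sees all digits of \<open>m\<close>.\<close>
    also have "\<dots> = (\<Prod>s<k. digit_sum A (of_int m / real M ^ k * real M ^ (k - Suc s)))"
      by (rule prod.nat_diff_reindex[symmetric])
    also have "\<dots> = (\<Prod>s<k. digit_sum A (of_int m / real M ^ Suc s))"
    proof (intro prod.cong refl arg_cong[of _ _ "digit_sum A"])
      fix s assume "s \<in> {..<k}"
      then have "real M ^ k = real M ^ (k - Suc s) * real M ^ Suc s"
        by (subst power_add[symmetric]) simp
      then show "of_int m / real M ^ k * real M ^ (k - Suc s) = of_int m / real M ^ Suc s"
        using M by simp
    qed
    finally show ?thesis by (simp add: riesz_product_def prod_norm[symmetric] prod_power_distrib)
  qed
  moreover have "schatten_sum (M ^ k) id (int ` cantor_set M A k) id (int ` cantor_set M A k) =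
      schatten_sum (M ^ k) int (cantor_set M A k) int (cantor_set M A k)"
    by (simp add: schatten_sum_def sum.reindex)
  ultimately show ?thesis by (simp only: schatten_sum_def)
qed

text \<open>Digits are added two at a time because one may gain nothing: for \<open>M = 4\<close>,
  \<open>A = {0, 2}\<close> and \<open>y = 0\<close> every one-digit factor is maximal. The
  two-digit bound is uniform in \<open>y\<close>, that is, in all earlier digits, and therefore
  iterates.\<close>

theorem schatten_sum_cantor_gain:
  assumes A: "A \<subseteq> {0..<M}" "2 \<le> card A"
  obtains c where "0 < c" "c < 1"
    "\<And>k. schatten_sum (M ^ k) id (int ` cantor_set M A k) id (int ` cantor_set M A k)
      \<le> real (card A) ^ (4 * k) * c ^ (k div 2)"
proof -
  obtain c where c: "0 < c" "c < 1" and gain: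
    "\<And>y. (\<Sum>(\<alpha>, \<beta>)\<in>A \<times> A. \<Sum>(\<alpha>', \<beta>')\<in>A \<times> A.
        (cmod (digit_sum A ((y + (real \<alpha> - real \<beta>)) / real M)))\<^sup>2 *
        (cmod (digit_sum A (((y + (real \<alpha> - real \<beta>)) / real M + (real \<alpha>' - real \<beta>')) / real M)))\<^sup>2)
      \<le> c * real (card A) ^ 8"
    using two_digit_gain[OF A] by blast
  obtain a where "a \<in> A" using A(2) by fastforce
  then have M: "0 < M" using A(1) by auto
  define q where "q = real (card A)"
  define S where "S k = (\<Sum>a\<in>cantor_set M A k. \<Sum>b\<in>cantor_set M A k. riesz_product M A k (int a - int b))" for k
  have S0: "S 0 = 1" by (simp add: S_def riesz_product_def)
  \<comment> \<open>The trivial one-digit step only starts the odd values of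
    \<open>k\<close>.\<close>
  have S1: "S (Suc k) \<le> q ^ 4 * S k" for k
  proof -
    have "S (Suc k) \<le> (\<Sum>a\<in>cantor_set M A k. \<Sum>b\<in>cantor_set M A k. q ^ 4 * riesz_product M A k (int a - int b))"
      unfolding S_def sum_cantor_diff_Suc[OF A(1)]
    proof (intro sum_mono)
      fix a b
      let ?m = "int a - int b"
      have "(\<Sum>(\<alpha>, \<beta>)\<in>A \<times> A. riesz_product M A (Suc k) (?m + (int \<alpha> - int \<beta>) * int M ^ k)) \<le>
          (\<Sum>(\<alpha>, \<beta>)\<in>A \<times> A. riesz_product M A k ?m * q\<^sup>2)"
        unfolding riesz_product_Suc[OF M] case_prod_unfold q_def
        by (intro sum_mono mult_left_mono power_mono cmod_digit_sum_le) auto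
      also have "\<dots> = q ^ 4 * riesz_product M A k ?m"
        by (simp add: card_cartesian_product q_def power4_eq_xxxx power2_eq_square)
      finally show "(\<Sum>(\<alpha>, \<beta>)\<in>A \<times> A. riesz_product M A (Suc k) (?m + (int \<alpha> - int \<beta>) * int M ^ k)) \<le>
          q ^ 4 * riesz_product M A k ?m" .
    qed
    then show ?thesis by (simp add: S_def sum_distrib_left)
  qed
  have S2: "S (Suc (Suc k)) \<le> c * q ^ 8 * S k" for k
  proof -
    have "S (Suc (Suc k)) \<le> (\<Sum>a\<in>cantor_set M A k. \<Sum>b\<in>cantor_set M A k. c * q ^ 8 * riesz_product M A k (int a - int b))"
      unfolding S_def sum_cantor_diff_Suc[OF A(1), of "riesz_product M A (Suc (Suc k))"]
        sum_cantor_diff_Suc[OF A(1), of "\<lambda>m. \<Sum>(\<alpha>, \<beta>)\<in>A \<times> A.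
          riesz_product M A (Suc (Suc k)) (m + (int \<alpha> - int \<beta>) * int M ^ Suc k)" k]
    proof (intro sum_mono)
      fix a b
      let ?m = "int a - int b"
      define y where "y = real_of_int ?m / real M ^ k"
      have *: "riesz_product M A (Suc (Suc k)) (?m + d * int M ^ k + d' * int M ^ Suc k) =
          riesz_product M A k ?m * ((cmod (digit_sum A ((y + of_int d) / real M)))\<^sup>2 *
          (cmod (digit_sum A (((y + of_int d) / real M + of_int d') / real M)))\<^sup>2)" for d d'
      proof -
        have "real_of_int (?m + d * int M ^ k) / real M ^ Suc k = (y + of_int d) / real M"
          using M by (simp add: y_def field_simps)
        then show ?thesis
          by (simp only: riesz_product_Suc[OF M] y_def[symmetric] mult.assoc)
      qed
      have "(\<Sum>(\<alpha>, \<beta>)\<in>A \<times> A. \<Sum>(\<alpha>', \<beta>')\<in>A \<times> A.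
          riesz_product M A (Suc (Suc k)) (?m + (int \<alpha> - int \<beta>) * int M ^ k + (int \<alpha>' - int \<beta>') * int M ^ Suc k)) =
          riesz_product M A k ?m * (\<Sum>(\<alpha>, \<beta>)\<in>A \<times> A. \<Sum>(\<alpha>', \<beta>')\<in>A \<times> A.
        (cmod (digit_sum A ((y + (real \<alpha> - real \<beta>)) / real M)))\<^sup>2 *
        (cmod (digit_sum A (((y + (real \<alpha> - real \<beta>)) / real M + (real \<alpha>' - real \<beta>')) / real M)))\<^sup>2)"
        unfolding * case_prod_unfold sum_distrib_left by simp
      also have "\<dots> \<le> riesz_product M A k ?m * (c * q ^ 8)"
        unfolding q_def by (intro mult_left_mono gain) auto
      finally show "(\<Sum>(\<alpha>, \<beta>)\<in>A \<times> A. \<Sum>(\<alpha>', \<beta>')\<in>A \<times> A.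
          riesz_product M A (Suc (Suc k)) (?m + (int \<alpha> - int \<beta>) * int M ^ k + (int \<alpha>' - int \<beta>') * int M ^ Suc k)) \<le>
          c * q ^ 8 * riesz_product M A k ?m" by (simp add: mult.commute)
    qed
    then show ?thesis by (simp add: S_def sum_distrib_left)
  qed
  have "S k \<le> q ^ (4 * k) * c ^ (k div 2)" for k
  proof (induction k rule: induct_nat_012)
    case 0 then show ?case by (simp add: S0)
  next
    case 1 then show ?case using S1[of 0] by (simp add: S0)
  next
    case (ge2 k)
    have "S (Suc (Suc k)) \<le> c * q ^ 8 * (q ^ (4 * k) * c ^ (k div 2))"
      by (rule order_trans[OF S2 mult_left_mono[OF ge2(1)]]) (use c in \<open>simp add: q_def\<close>)
    also have "\<dots> = q ^ (8 + 4 * k) * c ^ Suc (k div 2)" by (simp add: power_add del: power_add_numeral)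
    also have "\<dots> = q ^ (4 * Suc (Suc k)) * c ^ (Suc (Suc k) div 2)" by simp
    finally show ?case .
  qed
  then show thesis using that[of c] c by (simp add: schatten_sum_cantor[OF A(1) M] S_def q_def)
qed

section \<open>Rapid decay of smoothly cut off exponential sums\<close>

definition smooth_fun :: "(real \<Rightarrow> real) \<Rightarrow> bool" where
  "smooth_fun f \<longleftrightarrow> (\<forall>n x. (deriv ^^ n) f field_differentiable (at x))"

definition fdiff :: "real \<Rightarrow> (real \<Rightarrow> real) \<Rightarrow> real \<Rightarrow> real" where
  "fdiff h f x = f (x + h) - f x"

lemma DERIV_higher:
  "smooth_fun f \<Longrightarrow> ((deriv ^^ n) f has_real_derivative (deriv ^^ Suc n) f x) (at x)"
  unfolding smooth_fun_def using DERIV_deriv_iff_field_differentiable by force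

lemma higher_deriv_fdiff:
  assumes "smooth_fun f"
  shows "(deriv ^^ n) (fdiff h f) = fdiff h ((deriv ^^ n) f)"
proof (induction n)
  case 0 then show ?case by simp
next
  case (Suc n)
  have "((\<lambda>x. fdiff h ((deriv ^^ n) f) x) has_real_derivative fdiff h ((deriv ^^ Suc n) f) x) (at x)" for x
  proof -
    have 1: "((\<lambda>x. (deriv ^^ n) f (x + h)) has_real_derivative (deriv ^^ Suc n) f (x + h)) (at x)"
      using DERIV_shift[of "(deriv ^^ n) f" "(deriv ^^ Suc n) f (x + h)" x h] DERIV_higher[OF assms] by blast
    show ?thesis unfolding fdiff_def by (intro DERIV_diff 1 DERIV_higher[OF assms])
  qed
  then have "deriv (fdiff h ((deriv ^^ n) f)) = fdiff h ((deriv ^^ Suc n) f)"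
    by (intro ext DERIV_imp_deriv) (simp add: eta_contract_eq)
  then show ?case using Suc by simp
qed

lemma smooth_fun_fdiff:
  assumes "smooth_fun f" shows "smooth_fun (fdiff h f)"
  unfolding smooth_fun_def
proof (intro allI)
  fix n x
  have "((\<lambda>x. (deriv ^^ n) f (x + h)) has_real_derivative (deriv ^^ Suc n) f (x + h)) (at x)"
    using DERIV_shift[of "(deriv ^^ n) f" "(deriv ^^ Suc n) f (x + h)" x h] DERIV_higher[OF assms] by blast
  then have "((\<lambda>x. (deriv ^^ n) f (x + h) - (deriv ^^ n) f x) has_real_derivative
      (deriv ^^ Suc n) f (x + h) - (deriv ^^ Suc n) f x) (at x)"
    by (intro DERIV_diff DERIV_higher[OF assms])
  moreover have "fdiff h ((deriv ^^ n) f) = (\<lambda>x. (deriv ^^ n) f (x + h) - (deriv ^^ n) f x)"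
    by (rule ext) (simp add: fdiff_def)
  ultimately show "(deriv ^^ n) (fdiff h f) field_differentiable (at x)"
    unfolding higher_deriv_fdiff[OF assms] field_differentiable_def by metis
qed

text \<open>The mean value theorem gains one factor \<open>h\<close> per difference: applied to
  \<open>(deriv ^^ n) f\<close>, it bounds the \<open>n\<close>-th derivative of
  \<open>fdiff h f\<close>, which takes the place of \<open>f\<close> in the induction.\<close>

lemma fdiff_power_bound:
  assumes "smooth_fun f" "0 \<le> h" "\<And>x. \<bar>(deriv ^^ n) f x\<bar> \<le> C"
  shows "\<bar>(fdiff h ^^ n) f x\<bar> \<le> h ^ n * C"
  using assms
proof (induction n arbitrary: f C)
  case 0 then show ?case by simp
next
  case (Suc n)
  have "\<bar>(deriv ^^ n) (fdiff h f) x\<bar> \<le> h * C" for x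
  proof (cases "h = 0")
    case True then show ?thesis by (simp add: higher_deriv_fdiff[OF Suc.prems(1)] fdiff_def)
  next
    case False
    then have h: "0 < h" using Suc.prems(2) by simp
    obtain z where "(deriv ^^ n) f (x + h) - (deriv ^^ n) f x = (x + h - x) * (deriv ^^ Suc n) f z"
      using MVT2[of x "x + h" "(deriv ^^ n) f" "(deriv ^^ Suc n) f"] h DERIV_higher[OF Suc.prems(1)] by auto
    then show ?thesis
      using h Suc.prems(3)[of z] by (simp add: higher_deriv_fdiff[OF Suc.prems(1)] fdiff_def abs_mult)
  qed
  then have "\<bar>(fdiff h ^^ n) (fdiff h f) x\<bar> \<le> h ^ n * (h * C)"
    using Suc.IH[OF smooth_fun_fdiff[OF Suc.prems(1)] Suc.prems(2)] by blast
  then show ?case by (simp add: funpow_swap1 mult_ac)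
qed

lemma smooth_cutoff_deriv_bounded:
  assumes "smooth_cutoff chi"
  shows "\<exists>C\<ge>0. \<forall>x. \<bar>(deriv ^^ n) chi x\<bar> \<le> C"
proof -
  define K where "K = closure {x. chi x \<noteq> 0}"
  have K: "compact K" and sm: "smooth_fun chi"
    using assms by (auto simp: smooth_cutoff_def K_def smooth_fun_def)
  have z: "(deriv ^^ n) chi x = 0" if "x \<notin> K" for x
  proof -
    have "eventually (\<lambda>y. y \<in> - K) (nhds x)"
      using that K by (intro eventually_nhds_in_open) (auto simp: K_def)
    then have "eventually (\<lambda>y. chi y = (\<lambda>_. 0) y) (nhds x)"
      by eventually_elim (use closure_subset[of "{x. chi x \<noteq> 0}"] K_def in blast)
    then have "(deriv ^^ n) chi x = (deriv ^^ n) (\<lambda>_. 0) x"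
      by (intro higher_deriv_cong_ev) auto
    also have "(deriv ^^ n) (\<lambda>_. 0) = (\<lambda>_ :: real. 0 :: real)" by (induction n) auto
    finally show ?thesis by simp
  qed
  have "continuous_on K ((deriv ^^ n) chi)"
    using sm by (intro differentiable_imp_continuous_on)
      (auto simp: smooth_fun_def differentiable_on_def field_differentiable_imp_differentiable
        intro: differentiable_at_withinI)
  then have "bounded ((deriv ^^ n) chi ` K)" using K compact_continuous_image compact_imp_bounded by blast
  then obtain C where C: "\<And>x. x \<in> K \<Longrightarrow> \<bar>(deriv ^^ n) chi x\<bar> \<le> C"
    by (auto simp: bounded_iff)
  have "\<bar>(deriv ^^ n) chi x\<bar> \<le> max C 0" for x
    using C[of x] z[of x] by (cases "x \<in> K") auto
  then show ?thesis by (intro exI[of _ "max C 0"]) auto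
qed

text \<open>Abel summation without boundary terms, as \<open>a\<close> vanishes outside
  \<open>{s..<t}\<close>. The left range starts at \<open>s - 1\<close>, where the forward
  difference may already be nonzero.\<close>

lemma summation_by_parts:
  fixes a :: "int \<Rightarrow> real"
  assumes "\<And>m. m < s \<or> t \<le> m \<Longrightarrow> a m = 0"
  shows "(\<Sum>m\<in>{s-1..<t}. of_real (a (m + 1) - a m) * ee (of_int m * \<theta>)) =
    (ee (- \<theta>) - 1) * (\<Sum>m\<in>{s..<t}. of_real (a m) * ee (of_int m * \<theta>))"
proof -
  have "(\<Sum>m\<in>{s-1..<t}. of_real (a (m + 1)) * ee (of_int m * \<theta>)) =
      (\<Sum>m\<in>{s..<t+1}. ee (- \<theta>) * (of_real (a m) * ee (of_int m * \<theta>)))"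
  proof (rule sum.reindex_bij_witness[of _ "\<lambda>m. m - 1" "\<lambda>m. m + 1"])
    fix m :: int
    have "ee (of_int m * \<theta>) = ee (- \<theta>) * ee (of_int (m + 1) * \<theta>)"
      by (simp add: ee_add[symmetric] distrib_right)
    then show "ee (- \<theta>) * (of_real (a (m + 1)) * ee (of_int (m + 1) * \<theta>)) =
        of_real (a (m + 1)) * ee (of_int m * \<theta>)" by simp
  qed auto
  also have "\<dots> = (\<Sum>m\<in>{s..<t}. ee (- \<theta>) * (of_real (a m) * ee (of_int m * \<theta>)))"
    using assms by (intro sum.mono_neutral_right) auto
  finally have 1: "(\<Sum>m\<in>{s-1..<t}. of_real (a (m + 1)) * ee (of_int m * \<theta>)) =
      ee (- \<theta>) * (\<Sum>m\<in>{s..<t}. of_real (a m) * ee (of_int m * \<theta>))"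
    by (simp add: sum_distrib_left)
  have 2: "(\<Sum>m\<in>{s-1..<t}. of_real (a m) * ee (of_int m * \<theta>)) =
      (\<Sum>m\<in>{s..<t}. of_real (a m) * ee (of_int m * \<theta>))"
    using assms by (intro sum.mono_neutral_right) auto
  show ?thesis using 1 2 by (simp add: left_diff_distrib sum_subtractf)
qed

lemma summation_by_parts_power:
  fixes a :: "int \<Rightarrow> real"
  assumes "\<And>m. m < s \<or> t \<le> m \<Longrightarrow> a m = 0"
  shows "(\<Sum>m\<in>{s - int n..<t}. of_real (((\<lambda>b m. b (m + 1) - b m) ^^ n) a m) * ee (of_int m * \<theta>)) =
    (ee (- \<theta>) - 1) ^ n * (\<Sum>m\<in>{s..<t}. of_real (a m) * ee (of_int m * \<theta>))"
  using assms
proof (induction n arbitrary: a s)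
  case 0 then show ?case by simp
next
  case (Suc n)
  let ?D = "\<lambda>(b :: int \<Rightarrow> real) m. b (m + 1) - b m"
  have "?D a m = 0" if "m < s - 1 \<or> t \<le> m" for m
    using that Suc.prems[of m] Suc.prems[of "m + 1"] by auto
  from Suc.IH[of "s - 1" "?D a", OF this]
  have IH: "(\<Sum>m\<in>{s - 1 - int n..<t}. of_real ((?D ^^ n) (?D a) m) * ee (of_int m * \<theta>)) =
    (ee (- \<theta>) - 1) ^ n * (\<Sum>m\<in>{s - 1..<t}. of_real (?D a m) * ee (of_int m * \<theta>))" by blast
  have "s - int (Suc n) = s - 1 - int n" by simp
  then show ?case
    using IH summation_by_parts[of s t a \<theta>, OF Suc.prems]
    by (simp only: funpow_Suc_right o_apply power_Suc2 mult.assoc)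
qed

lemma fdiff_sample:
  "((\<lambda>b m. b (m + 1) - b m) ^^ n) (\<lambda>m :: int. f (of_int m * h)) m = (fdiff h ^^ n) f (of_int m * h)"
proof (induction n arbitrary: f)
  case (Suc n)
  have "(\<lambda>m :: int. f (of_int (m + 1) * h) - f (of_int m * h)) = (\<lambda>m. fdiff h f (of_int m * h))"
    by (simp add: fdiff_def distrib_right)
  then show ?case using Suc[of "fdiff h f"] by (simp only: funpow_Suc_right o_apply)
qed simp

lemma smooth_cutoff_range:
  assumes "smooth_cutoff chi"
  shows "0 \<le> chi x" "chi x \<le> 1" "x \<le> 0 \<Longrightarrow> chi x = 0" "1 \<le> x \<Longrightarrow> chi x = 0"
proof -
  have "closure {x. chi x \<noteq> 0} \<subseteq> {0<..<1}" "range chi \<subseteq> {0..1}"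
    using assms by (auto simp: smooth_cutoff_def)
  then show "0 \<le> chi x" "chi x \<le> 1" "x \<le> 0 \<Longrightarrow> chi x = 0" "1 \<le> x \<Longrightarrow> chi x = 0"
    using closure_subset[of "{x. chi x \<noteq> 0}"] by (auto simp: image_subset_iff subset_iff)
qed

text \<open>Keeps the phase away from nonzero integers: if two positions lie in the unit interval
  and one of them in the support, they differ by at most \<open>1 - c\<close>.\<close>

lemma smooth_cutoff_margin:
  assumes "smooth_cutoff chi"
  shows "\<exists>c>0. c \<le> 1 / 2 \<and> (\<forall>x. chi x \<noteq> 0 \<longrightarrow> c \<le> x \<and> x \<le> 1 - c)"
proof (cases "closure {x. chi x \<noteq> 0} = {}")
  case True
  then have "chi x = 0" for x using closure_subset by blast
  then show ?thesis by (intro exI[of _ "1 / 2"]) auto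
next
  case False
  define K where "K = closure {x. chi x \<noteq> 0}"
  have K: "compact K" "K \<noteq> {}" "K \<subseteq> {0<..<1}" using assms False by (auto simp: smooth_cutoff_def K_def)
  obtain l where l: "l \<in> K" "\<And>x. x \<in> K \<Longrightarrow> l \<le> x" using compact_attains_inf[OF K(1,2)] by blast
  obtain u where u: "u \<in> K" "\<And>x. x \<in> K \<Longrightarrow> x \<le> u" using compact_attains_sup[OF K(1,2)] by blast
  have "0 < l" "u < 1" using l u K by auto
  define c where "c = min (min l (1 - u)) (1 / 2)"
  have "c \<le> l" "c \<le> 1 - u" "c \<le> 1 / 2" unfolding c_def by (simp_all only: min.cobounded2 min.coboundedI1 min.cobounded1)
  moreover have "l \<le> x \<and> x \<le> u" if "chi x \<noteq> 0" for x
    using that closure_subset[of "{x. chi x \<noteq> 0}"] l(2) u(2) unfolding K_def by blast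
  moreover have "0 < c" using \<open>0 < l\<close> \<open>u < 1\<close> by (simp add: c_def)
  ultimately show ?thesis by (intro exI[of _ c]) force
qed

text \<open>Discrete non-stationary phase: each summation by parts trades a factor
  \<open>ee \<theta> - 1\<close>, up to conjugation, for a difference of \<open>chi\<close> with
  step \<open>1 / L\<close>. The product form avoids a case distinction on
  \<open>ee \<theta> = 1\<close>.\<close>

lemma smooth_sum_decay:
  assumes chi: "smooth_cutoff chi"
  obtains C where "0 \<le> C"
    "\<And>L \<theta>. 0 < L \<Longrightarrow>
      cmod (\<Sum>m<L. of_real (chi (real m / real L)) * ee (real m * \<theta>)) * (real L * cmod (ee \<theta> - 1)) ^ n
        \<le> C * real L"
proof -
  obtain C where C: "0 \<le> C" "\<And>x. \<bar>(deriv ^^ n) chi x\<bar> \<le> C"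
    using smooth_cutoff_deriv_bounded[OF chi] by blast
  have sm: "smooth_fun chi" using chi by (simp add: smooth_cutoff_def smooth_fun_def)
  have "cmod (\<Sum>m<L. of_real (chi (real m / real L)) * ee (real m * \<theta>)) * (real L * cmod (ee \<theta> - 1)) ^ n
        \<le> (real n + 1) * C * real L" if L: "0 < L" for L \<theta>
  proof -
    define a where "a m = chi (of_int m * (1 / real L))" for m :: int
    have a0: "a m = 0" if "m < 0 \<or> int L \<le> m" for m
      using that smooth_cutoff_range(3,4)[OF chi] L by (auto simp: a_def field_simps)
    have s: "(\<Sum>m<L. of_real (chi (real m / real L)) * ee (real m * \<theta>)) =
        (\<Sum>m\<in>{0..<int L}. of_real (a m) * ee (of_int m * \<theta>))"
      by (rule sum.reindex_bij_witness[of _ nat int]) (auto simp: a_def)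
    have n1: "cmod (ee (- \<theta>) - 1) = cmod (ee \<theta> - 1)"
      using complex_mod_cnj[of "ee \<theta> - 1"] by simp
    have "cmod (\<Sum>m\<in>{0..<int L}. of_real (a m) * ee (of_int m * \<theta>)) * cmod (ee \<theta> - 1) ^ n =
        cmod ((ee (- \<theta>) - 1) ^ n * (\<Sum>m\<in>{0..<int L}. of_real (a m) * ee (of_int m * \<theta>)))"
      by (simp add: norm_mult norm_power n1)
    also have "\<dots> = cmod (\<Sum>m\<in>{0 - int n..<int L}.
        of_real (((\<lambda>b m. b (m + 1) - b m) ^^ n) a m) * ee (of_int m * \<theta>))"
      using summation_by_parts_power[of 0 "int L" a n \<theta>, OF a0] by simp
    also have "\<dots> \<le> (\<Sum>m\<in>{0 - int n..<int L}. (1 / real L) ^ n * C)"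
    proof (rule order_trans[OF norm_sum sum_mono])
      fix m
      have "((\<lambda>b m. b (m + 1) - b m) ^^ n) a m = (fdiff (1 / real L) ^^ n) chi (of_int m * (1 / real L))"
        unfolding a_def[abs_def] by (rule fdiff_sample)
      moreover have "\<bar>(fdiff (1 / real L) ^^ n) chi (of_int m * (1 / real L))\<bar> \<le> (1 / real L) ^ n * C"
        by (rule fdiff_power_bound[OF sm _ C(2)]) simp
      ultimately show "cmod (of_real (((\<lambda>b m. b (m + 1) - b m) ^^ n) a m) * ee (of_int m * \<theta>)) \<le>
          (1 / real L) ^ n * C" by (simp add: norm_mult)
    qed
    \<comment> \<open>Each of the \<open>n\<close> differences has widened the range by one, hence
      \<open>L + n\<close> terms.\<close>
    also have "\<dots> = (real L + real n) * ((1 / real L) ^ n * C)" by simp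
    finally have "cmod (\<Sum>m<L. of_real (chi (real m / real L)) * ee (real m * \<theta>)) * cmod (ee \<theta> - 1) ^ n
        * real L ^ n \<le> (real L + real n) * ((1 / real L) ^ n * C) * real L ^ n"
      unfolding s by (intro mult_right_mono) auto
    also have "\<dots> = (real L + real n) * C" using L by (simp add: power_divide)
    also have "\<dots> \<le> (real n + 1) * C * real L"
    proof -
      have "real n * 1 \<le> real n * real L" using L by (intro mult_left_mono) auto
      then have "real L + real n \<le> (real n + 1) * real L" by (simp add: algebra_simps)
      then show ?thesis using mult_right_mono[OF _ C(1)] by (fastforce simp: mult_ac)
    qed
    finally show ?thesis by (simp add: power_mult_distrib mult_ac)
  qed
  then show thesis using that[of "(real n + 1) * C"] C(1) by simp
qed

section \<open>Lower bounds for the modulus of \<open>ee t - 1\<close>\<close>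

lemma sin_ge_quarter:
  assumes "0 \<le> x" "x \<le> pi / 2" shows "x / 4 \<le> sin (x :: real)"
proof (cases "x \<le> pi / 3")
  case True
  show ?thesis
  proof (cases "x = 0")
    case False
    then have "0 < x" using assms by simp
    then obtain z where z: "0 < z" "z < x" "sin x - sin 0 = (x - 0) * cos z"
      using MVT2[of 0 x sin cos] DERIV_sin by blast
    have "cos (pi / 3) \<le> cos z" using z True by (intro cos_monotone_0_pi_le) auto
    then have "x * (1 / 2) \<le> x * cos z" using \<open>0 < x\<close> by (intro mult_left_mono) (auto simp: cos_60)
    then show ?thesis using z \<open>0 < x\<close> by simp
  qed simp
next
  case False
  have "sin (pi / 3) \<le> sin x" using False assms by (intro sin_monotone_2pi_le) auto
  moreover have "1 / 2 \<le> sin (pi / 3)" by (simp add: sin_60)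
  moreover have "x < 2" using assms pi_less_4 by linarith
  ultimately show ?thesis by linarith
qed

text \<open>The modulus is \<open>2 * \<bar>sin (pi * t)\<bar>\<close>, comparable to the distance
  from \<open>t\<close> to the integers. When \<open>\<bar>t\<bar>\<close> exceeds one half, the
  nearest integer is not 0 and the distance is only known to be at least \<open>c\<close>; hence the
  factor \<open>c\<close>.\<close>

lemma cmod_ee_minus_one_ge:
  assumes c: "0 < c" "c \<le> 1 / 2" and t: "\<bar>t\<bar> \<le> 1 - c"
  shows "c * \<bar>t\<bar> \<le> cmod (ee t - 1)"
proof -
  have "ee t - 1 = ee (t / 2) * (ee (t / 2) - ee (- (t / 2)))"
    by (simp add: right_diff_distrib ee_add[symmetric])
  moreover have "ee (t / 2) - ee (- (t / 2)) = 2 * \<i> * of_real (sin (pi * t))"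
    by (simp add: ee_def complex_eq_iff)
  ultimately have eq: "cmod (ee t - 1) = 2 * \<bar>sin (pi * t)\<bar>" by (simp add: norm_mult)
  have abs: "\<bar>sin (pi * t)\<bar> = \<bar>sin (pi * \<bar>t\<bar>)\<bar>" by (cases "0 \<le> t") auto
  have "c * \<bar>t\<bar> / 2 \<le> sin (pi * \<bar>t\<bar>)"
  proof (cases "\<bar>t\<bar> \<le> 1 / 2")
    case True
    have "pi * \<bar>t\<bar> \<le> pi * (1 / 2)" using True by (intro mult_left_mono) auto
    then have "pi * \<bar>t\<bar> / 4 \<le> sin (pi * \<bar>t\<bar>)" by (intro sin_ge_quarter) auto
    moreover have "2 * (c * \<bar>t\<bar>) \<le> pi * \<bar>t\<bar>"
    proof -
      have "2 * c \<le> pi" using c pi_gt3 by linarith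
      then show ?thesis using mult_right_mono[of "2 * c" pi "\<bar>t\<bar>"] by simp
    qed
    ultimately show ?thesis by linarith
  next
    case False
    define s where "s = 1 - \<bar>t\<bar>"
    have s: "c \<le> s" "s \<le> 1 / 2" using t False by (auto simp: s_def)
    have "sin (pi * \<bar>t\<bar>) = sin (pi - pi * s)" by (simp add: s_def right_diff_distrib)
    also have "\<dots> = sin (pi * s)" by simp
    finally have e: "sin (pi * \<bar>t\<bar>) = sin (pi * s)" .
    have "pi * s \<le> pi * (1 / 2)" using s by (intro mult_left_mono) auto
    then have "pi * s / 4 \<le> sin (pi * s)" using s c by (intro sin_ge_quarter) auto
    moreover have "2 * s \<le> pi * s" using pi_gt3 s c by (intro mult_right_mono) auto
    moreover have "c * \<bar>t\<bar> \<le> s * 1" using s c t by (intro mult_mono) auto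
    ultimately show ?thesis using e by linarith
  qed
  then show ?thesis using eq abs by linarith
qed

section \<open>The structure of the open baker's map\<close>

lemma dft_mat_index:
  assumes "j < n" "l < n"
  shows "dft_mat n $$ (j, l) = of_real (1 / sqrt (real n)) * ee (- (real j * real l / real n))"
proof -
  have e: "- (2 * complex_of_real pi * \<i> * of_nat j * of_nat l) / of_nat n =
      \<i> * of_real (2 * pi * - (real j * real l / real n))" by simp
  have "dft_mat n $$ (j, l) = of_real (1 / sqrt (real n)) *
      exp (- (2 * complex_of_real pi * \<i> * of_nat j * of_nat l) / of_nat n)"
    using assms by (simp add: dft_mat_def)
  then show ?thesis by (simp only: e ee_def cis_conv_exp)
qed

lemma dft_mat_carrier [simp]: "dft_mat n \<in> carrier_mat n n"
  by (simp add: dft_mat_def)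

lemma sum_ee_orthogonal:
  assumes n: "0 < n" "j < n" "l < n"
  shows "(\<Sum>m<n. ee (real m * real j / real n) * ee (- (real m * real l / real n))) =
    (if j = l then of_nat n else 0)"
proof -
  have "(\<Sum>m<n. ee (real m * real j / real n) * ee (- (real m * real l / real n))) =
      (\<Sum>m<n. ee (real m * (of_int (int j - int l) / real n)))"
    unfolding ee_add[symmetric]
    by (intro sum.cong refl arg_cong[of _ _ ee]) (simp add: diff_divide_distrib right_diff_distrib)
  also have "\<dots> = (if int n dvd int j - int l then of_nat n else 0)"
    by (rule sum_roots_of_unity[OF n(1)])
  also have "int n dvd int j - int l \<longleftrightarrow> j = l"
  proof
    assume "int n dvd int j - int l"
    moreover have "\<bar>int j - int l\<bar> < int n" using n by linarith
    ultimately show "j = l" using zdvd_imp_le[of "int n" "\<bar>int j - int l\<bar>"] by fastforce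
  qed simp
  finally show ?thesis .
qed

lemma dft_mat_unitary:
  assumes n: "0 < n"
  shows "mat_adjoint (dft_mat n) * dft_mat n = 1\<^sub>m n"
proof (rule eq_matI)
  have c: "mat_adjoint (dft_mat n) \<in> carrier_mat n n" by simp
  fix j l assume "j < dim_row (1\<^sub>m n)" "l < dim_col (1\<^sub>m n)"
  then have jl: "j < n" "l < n" by auto
  have "(mat_adjoint (dft_mat n) * dft_mat n) $$ (j, l) =
      (\<Sum>m<n. (of_real (1 / sqrt (real n)) * of_real (1 / sqrt (real n))) *
        (ee (real m * real j / real n) * ee (- (real m * real l / real n))))"
    using jl by (simp add: mult_mat_index[OF c dft_mat_carrier] mat_adjoint_index[OF dft_mat_carrier]
        dft_mat_index mult_ac del: index_mult_mat(1))
  also have "\<dots> = of_real (1 / real n) * (if j = l then of_nat n else 0)"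
  proof -
    have "1 / sqrt (real n) * (1 / sqrt (real n)) = 1 / real n" by simp
    then show ?thesis
      by (simp only: sum_distrib_left[symmetric] sum_ee_orthogonal[OF n jl] of_real_mult[symmetric])
  qed
  also have "\<dots> = 1\<^sub>m n $$ (j, l)" using jl n by simp
  finally show "(mat_adjoint (dft_mat n) * dft_mat n) $$ (j, l) = 1\<^sub>m n $$ (j, l)" .
qed (use carrier_matD[OF dft_mat_carrier[of n]] in \<open>simp_all add: mat_adjoint_def\<close>)

lemma diag_block_mat_replicate:
  assumes A: "A \<in> carrier_mat L L" and L: "0 < L"
  shows "diag_block_mat (replicate m A) =
    Matrix.mat (m * L) (m * L) (\<lambda>(i, j). if i div L = j div L then A $$ (i mod L, j mod L) else 0)"
proof (induction m)
  case 0 then show ?case by (auto intro!: eq_matI)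
next
  case (Suc m)
  define D where "D = Matrix.mat (m * L) (m * L)
    (\<lambda>(i, j). if i div L = j div L then A $$ (i mod L, j mod L) else 0)"
  have D: "D \<in> carrier_mat (m * L) (m * L)" by (simp add: D_def)
  have eq: "diag_block_mat (replicate (Suc m) A) = four_block_mat A (0\<^sub>m L (m * L)) (0\<^sub>m (m * L) L) D"
    using A carrier_matD[OF D] by (simp add: Let_def Suc D_def[symmetric])
  have ge: "i div L = Suc ((i - L) div L)" "(i - L) mod L = i mod L" if "\<not> i < L" for i
    using that L by (simp_all add: le_div_geq le_mod_geq)
  show ?case unfolding eq
  proof (rule eq_matI)
    fix i j assume "i < dim_row (Matrix.mat (Suc m * L) (Suc m * L)
        (\<lambda>(i, j). if i div L = j div L then A $$ (i mod L, j mod L) else 0))"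
      "j < dim_col (Matrix.mat (Suc m * L) (Suc m * L)
        (\<lambda>(i, j). if i div L = j div L then A $$ (i mod L, j mod L) else 0))"
    then have ij: "i < L + m * L" "j < L + m * L" by auto
    have "four_block_mat A (0\<^sub>m L (m * L)) (0\<^sub>m (m * L) L) D $$ (i, j) =
        (if i < L then if j < L then A $$ (i, j) else 0 else if j < L then 0 else D $$ (i - L, j - L))"
      using ij A D by auto
    also have "\<dots> = (if i div L = j div L then A $$ (i mod L, j mod L) else 0)"
      using ij by (cases "i < L"; cases "j < L") (auto simp: D_def ge)
    finally show "four_block_mat A (0\<^sub>m L (m * L)) (0\<^sub>m (m * L) L) D $$ (i, j) =
        Matrix.mat (Suc m * L) (Suc m * L)
          (\<lambda>(i, j). if i div L = j div L then A $$ (i mod L, j mod L) else 0) $$ (i, j)"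
      using ij by simp
  qed (use A D in auto)
qed

lemma sum_blocks:
  fixes f :: "nat \<Rightarrow> 'a :: comm_monoid_add"
  shows "(\<Sum>g<M * L. f g) = (\<Sum>q<M. \<Sum>m<L. f (q * L + m))"
proof -
  have "(\<Sum>g<M * L. f g) = (\<Sum>q<M. sum f {q * L..<q * L + L})" by (rule sum.nat_group[symmetric])
  also have "\<dots> = (\<Sum>q<M. \<Sum>m<L. f (q * L + m))"
  proof (rule sum.cong[OF refl])
    fix q
    have "sum f {0 + q * L..<L + q * L} = (\<Sum>m\<in>{0..<L}. f (m + q * L))"
      by (rule sum.shift_bounds_nat_ivl)
    then show "sum f {q * L..<q * L + L} = (\<Sum>m<L. f (q * L + m))"
      by (simp add: add.commute atLeast0LessThan)
  qed
  finally show ?thesis .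
qed

lemma block_index:
  assumes "q < M" "m < (L :: nat)"
  shows "q * L + m < M * L" "(q * L + m) div L = q" "(q * L + m) mod L = m"
proof -
  have "q * L + m < (q + 1) * L" using assms by simp
  also have "\<dots> \<le> M * L" using assms by (intro mult_right_mono) auto
  finally show "q * L + m < M * L" .
qed (use assms in auto)

locale baker =
  fixes M :: nat and A :: "nat set" and chi :: "real \<Rightarrow> real" and k :: nat
  assumes A: "A \<subseteq> {0..<M}" and M: "2 \<le> M" and chi: "smooth_cutoff chi" and k: "0 < k"
begin

definition N :: nat where "N = M ^ k"
definition L :: nat where "L = M ^ (k - 1)"
definition B :: "complex mat" where "B = open_baker_map M A chi k"
definition F :: "complex mat" where "F = dft_mat N"
definition W :: "complex mat" where
  "W = Matrix.mat N N (\<lambda>(g, p). if g div L = p div L then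
      of_real (chi (real (g mod L) / real L)) * dft_mat L $$ (g mod L, p mod L) *
      of_real (chi (real (p mod L) / real L)) else 0)"
definition IA :: "complex mat" where "IA = mat_diag N (\<lambda>p. if p div L \<in> A then 1 else 0)"

lemma NL: "N = M * L" "0 < L" "0 < N"
proof -
  show "N = M * L" unfolding N_def L_def by (rule power_eq_if[THEN trans]) (use k in simp)
  show "0 < L" "0 < N" unfolding N_def L_def using M by simp_all
qed

lemma carriers [simp]:
  "F \<in> carrier_mat N N" "W \<in> carrier_mat N N" "IA \<in> carrier_mat N N" "mat_adjoint F \<in> carrier_mat N N"
  by (auto simp: F_def W_def IA_def)

lemma B_eq: "B = mat_adjoint F * W * IA"
proof -
  have 1: "M ^ k div M = L" using NL M by (simp add: N_def)
  have "cutoff_mat chi L * dft_mat L * cutoff_mat chi L = Matrix.mat L L (\<lambda>(i, j).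
      of_real (chi (real i / real L)) * dft_mat L $$ (i, j) * of_real (chi (real j / real L)))"
    unfolding cutoff_mat_def
    by (subst mat_diag_mult_left[of _ L L], simp, subst mat_diag_mult_right[of _ L L], simp)
      (auto intro!: eq_matI)
  then have "diag_block_mat (replicate M (cutoff_mat chi L * dft_mat L * cutoff_mat chi L)) = W"
    using NL by (simp add: diag_block_mat_replicate[of _ L] W_def)
      (auto intro!: eq_matI)
  moreover have "alphabet_mat M A N = IA"
  proof -
    have "M * p div N = p div L" for p using NL M by (simp add: div_mult_mult1)
    then show ?thesis by (simp add: alphabet_mat_def IA_def)
  qed
  ultimately show ?thesis by (simp add: B_def open_baker_map_def Let_def 1 F_def N_def)
qed

lemma B_carrier [simp]: "B \<in> carrier_mat N N"
  by (simp add: B_eq mult_carrier_mat[of _ N N _ N])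

lemma F_unitary: "mat_adjoint F * F = 1\<^sub>m N" "F * mat_adjoint F = 1\<^sub>m N"
proof -
  show 1: "mat_adjoint F * F = 1\<^sub>m N" using dft_mat_unitary NL by (simp add: F_def)
  show "F * mat_adjoint F = 1\<^sub>m N" by (rule mat_mult_left_right_inverse[OF _ _ 1]) simp_all
qed

lemma adjoint_F_transpose: "transpose_mat (mat_adjoint F) = mat_adjoint F"
proof (rule eq_matI)
  have F: "F \<in> carrier_mat N N" by simp
  show "transpose_mat (mat_adjoint F) $$ (i, j) = mat_adjoint F $$ (i, j)"
    if "i < dim_row (mat_adjoint F)" "j < dim_col (mat_adjoint F)" for i j
    using that carrier_matD[OF carriers(4)]
    by (simp add: mat_adjoint_index[OF F]) (simp add: F_def dft_mat_index mult.commute)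
qed (use carrier_matD[OF carriers(4)] in simp_all)

lemma dft_mat_sym: "i < n \<Longrightarrow> j < n \<Longrightarrow> dft_mat n $$ (i, j) = dft_mat n $$ (j, i)"
  by (simp add: dft_mat_index mult.commute)

lemma W_transpose: "transpose_mat W = W"
  using NL by (intro eq_matI) (auto simp: W_def dft_mat_sym[of "_ mod L" L "_ mod L"])

lemma IA_W: "IA * W = W * IA"
  unfolding IA_def
  by (simp add: mat_diag_mult_left[OF carriers(2)] mat_diag_mult_right[OF carriers(2)])
    (auto simp: W_def intro!: eq_matI)

text \<open>The quantization of the baker relation is symmetric under exchanging position and
  frequency, so localization in position and in frequency are the same statement.\<close>

lemma F_B_F: "F * B * mat_adjoint F = transpose_mat B"
proof -
  note m = mult_carrier_mat[of _ N N _ N]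
  note a = assoc_mult_mat[of _ N N _ N _ N]
  have FF: "F * (mat_adjoint F * Y) = Y" if "Y \<in> carrier_mat N N" for Y
    using a[of F "mat_adjoint F" Y] F_unitary that by simp
  have "F * B * mat_adjoint F = W * (IA * mat_adjoint F)"
    by (simp add: B_eq a m FF)
  moreover have "transpose_mat B = transpose_mat IA * (transpose_mat W * transpose_mat (mat_adjoint F))"
    by (simp add: B_eq transpose_mult[of _ N N _ N] m)
  moreover have "transpose_mat IA = IA" by (auto simp: IA_def mat_diag_def intro!: eq_matI)
  ultimately show ?thesis
    using IA_W a[of IA W "mat_adjoint F"] a[of W IA "mat_adjoint F"]
    by (simp add: W_transpose adjoint_F_transpose)
qed

lemma F_B_pow_F: "F * (B ^\<^sub>m s) * mat_adjoint F = transpose_mat (B ^\<^sub>m s)"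
proof (induction s)
  case 0 then show ?case using F_unitary carrier_matD[OF B_carrier] right_mult_one_mat[OF carriers(1)] by simp
next
  case (Suc s)
  note m = mult_carrier_mat[of _ N N _ N]
  note a = assoc_mult_mat[of _ N N _ N _ N]
  have FF: "mat_adjoint F * (F * Y) = Y" if "Y \<in> carrier_mat N N" for Y
    using a[of "mat_adjoint F" F Y] F_unitary that by simp
  have "F * (B ^\<^sub>m Suc s) * mat_adjoint F = (F * B * mat_adjoint F) * (F * (B ^\<^sub>m s) * mat_adjoint F)"
  proof -
    have "B ^\<^sub>m Suc s = B * B ^\<^sub>m s"
      by (induction s) (simp_all add: a m carrier_matD[OF B_carrier])
    then show ?thesis by (simp add: a m FF)
  qed
  also have "\<dots> = transpose_mat (B ^\<^sub>m s * B)"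
    by (simp add: Suc F_B_F transpose_mult[of _ N N _ N])
  finally show ?case by simp
qed

text \<open>Without the cutoffs the block matrix \<open>W0\<close> is unitary; the cutoffs and the
  alphabet restriction are diagonal with entries of modulus at most 1.\<close>

lemma contraction_B: "contraction N B"
proof -
  define W0 where "W0 = Matrix.mat N N (\<lambda>(g, p). if g div L = p div L then
      dft_mat L $$ (g mod L, p mod L) else 0)"
  define D where "D = mat_diag N (\<lambda>p. complex_of_real (chi (real (p mod L) / real L)))"
  have c: "W0 \<in> carrier_mat N N" "mat_adjoint W0 \<in> carrier_mat N N" by (auto simp: W0_def)
  have "mat_adjoint W0 * W0 = 1\<^sub>m N"
  proof (rule eq_matI)
    fix p p' assume "p < dim_row (1\<^sub>m N)" "p' < dim_col (1\<^sub>m N)"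
    then have p: "p < N" "p' < N" by auto
    have pq: "p div L < M" using p NL by (simp add: less_mult_imp_div_less)
    have "(mat_adjoint W0 * W0) $$ (p, p') = (\<Sum>g<N. cnj (W0 $$ (g, p)) * W0 $$ (g, p'))"
      using p by (simp add: mult_mat_index[OF c(2,1)] mat_adjoint_index[OF c(1)] del: index_mult_mat(1))
    also have "\<dots> = (\<Sum>q<M. \<Sum>m<L. cnj (W0 $$ (q * L + m, p)) * W0 $$ (q * L + m, p'))"
      unfolding NL(1) by (rule sum_blocks)
    also have "\<dots> = (\<Sum>q<M. if q = p div L then (if p div L = p' div L then
        (\<Sum>m<L. cnj (dft_mat L $$ (m, p mod L)) * dft_mat L $$ (m, p' mod L)) else 0) else 0)"
    proof (rule sum.cong[OF refl])
      fix q assume "q \<in> {..<M}"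
      then have q: "q < M" by simp
      have W0: "W0 $$ (q * L + m, p) = (if q = p div L then dft_mat L $$ (m, p mod L) else 0)"
        if "m < L" "p < N" for m p
        using that block_index[OF q that(1)] NL(1) by (simp add: W0_def)
      show "(\<Sum>m<L. cnj (W0 $$ (q * L + m, p)) * W0 $$ (q * L + m, p')) =
          (if q = p div L then (if p div L = p' div L then
            (\<Sum>m<L. cnj (dft_mat L $$ (m, p mod L)) * dft_mat L $$ (m, p' mod L)) else 0) else 0)"
        using p by (simp add: W0)
    qed
    also have "\<dots> = (if p div L = p' div L then
        (\<Sum>m<L. cnj (dft_mat L $$ (m, p mod L)) * dft_mat L $$ (m, p' mod L)) else 0)"
      using pq by simp
    also have "(\<Sum>m<L. cnj (dft_mat L $$ (m, p mod L)) * dft_mat L $$ (m, p' mod L)) =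
        (mat_adjoint (dft_mat L) * dft_mat L) $$ (p mod L, p' mod L)"
      using NL(2) by (simp add: mult_mat_index[of _ L L _ L] mat_adjoint_index[of _ L L] del: index_mult_mat(1))
    also have "(if p div L = p' div L then (mat_adjoint (dft_mat L) * dft_mat L) $$ (p mod L, p' mod L) else 0)
        = 1\<^sub>m N $$ (p, p')"
    proof -
      have "p = p' \<longleftrightarrow> p div L = p' div L \<and> p mod L = p' mod L" by (metis div_mult_mod_eq)
      then show ?thesis using p NL(2) dft_mat_unitary[OF NL(2)] by simp
    qed
    finally show "(mat_adjoint W0 * W0) $$ (p, p') = 1\<^sub>m N $$ (p, p')" .
  qed (use c in \<open>auto simp: carrier_matD[OF c(2)] simp del: mat_adjoint_carrier\<close>)
  then have "contraction N W0" using contraction_unitary c by blast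
  moreover have "contraction N D"
    unfolding D_def by (rule contraction_diag) (use smooth_cutoff_range[OF chi] in auto)
  moreover have "W = D * W0 * D"
    unfolding D_def
    by (simp add: mat_diag_mult_left[OF c(1)] mat_diag_mult_right[of _ N N])
      (auto simp: W_def W0_def intro!: eq_matI)
  moreover have "contraction N IA" unfolding IA_def by (rule contraction_diag) auto
  moreover have "contraction N (mat_adjoint F)"
    using contraction_adjoint contraction_unitary F_unitary by simp
  ultimately show ?thesis unfolding B_eq by (auto intro: contraction_mult)
qed

text \<open>With \<open>j = p mod L\<close>, site \<open>q * L + m\<close> carries the phase
  \<open>q * i / M + m * i / N\<close> from the outer transform and \<open>- m * j / L\<close> from
  the block. The sum over \<open>m\<close> thus oscillates at frequency
  \<open>(i - M * j) / N\<close>, which measures how far \<open>i\<close> is from the classical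
  image \<open>M * j\<close> of \<open>p\<close>.\<close>

lemma B_index:
  assumes i: "i < N" and p: "p < N"
  shows "cmod (B $$ (i, p)) \<le> (if p div L \<in> A \<and> chi (real (p mod L) / real L) \<noteq> 0 then
    1 / real L * cmod (\<Sum>m<L. of_real (chi (real m / real L)) *
      ee (real m * ((real i - real M * real (p mod L)) / real N))) else 0)"
proof -
  define q j where "q = p div L" and "j = p mod L"
  have q: "q < M" and j: "j < L" using p NL by (auto simp: q_def j_def less_mult_imp_div_less)
  have c: "mat_adjoint F * W \<in> carrier_mat N N" by (simp add: mult_carrier_mat[of _ N N _ N])
  let ?s = "\<Sum>m<L. of_real (chi (real m / real L)) * ee (real m * ((real i - real M * real j) / real N))"
  have "(mat_adjoint F * W) $$ (i, p) = (\<Sum>g<N. cnj (F $$ (g, i)) * W $$ (g, p))"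
    using i p by (simp add: mult_mat_index[of _ N N _ N] mat_adjoint_index[of _ N N] del: index_mult_mat(1))
  also have "\<dots> = (\<Sum>q'<M. \<Sum>m<L. cnj (F $$ (q' * L + m, i)) * W $$ (q' * L + m, p))"
    unfolding NL(1) by (rule sum_blocks)
  also have "\<dots> = (\<Sum>q'<M. if q' = q then (\<Sum>m<L. cnj (F $$ (q * L + m, i)) * W $$ (q * L + m, p)) else 0)"
  proof (rule sum.cong[OF refl])
    fix q' assume "q' \<in> {..<M}"
    then have q': "q' < M" by simp
    have "W $$ (q' * L + m, p) = 0" if "m < L" "q' \<noteq> q" for m
      using that p block_index[OF q' that(1)] NL(1) by (simp add: W_def q_def)
    then show "(\<Sum>m<L. cnj (F $$ (q' * L + m, i)) * W $$ (q' * L + m, p)) =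
        (if q' = q then (\<Sum>m<L. cnj (F $$ (q * L + m, i)) * W $$ (q * L + m, p)) else 0)"
      by simp
  qed
  also have "\<dots> = (\<Sum>m<L. cnj (F $$ (q * L + m, i)) * W $$ (q * L + m, p))"
    using q by simp
  also have "\<dots> = (\<Sum>m<L. (of_real (chi (real j / real L)) * of_real (1 / sqrt (real N) * (1 / sqrt (real L))) *
      ee (real q * real i / real M)) *
      (of_real (chi (real m / real L)) * ee (real m * ((real i - real M * real j) / real N))))"
  proof (intro sum.cong refl)
    fix m assume m: "m \<in> {..<L}"
    have lt: "q * L + m < N" using block_index(1)[OF q, of m L] m NL by simp
    have "ee (real (q * L + m) * real i / real N) * ee (- (real m * real j / real L)) =
        ee (real q * real i / real M) * ee (real m * ((real i - real M * real j) / real N))"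
      unfolding ee_add[symmetric] NL(1) using NL(2) M
      by (intro arg_cong[of _ _ ee]) (simp add: field_simps)
    moreover have "cnj (F $$ (q * L + m, i)) = of_real (1 / sqrt (real N)) * ee (real (q * L + m) * real i / real N)"
      using lt i by (simp add: F_def dft_mat_index)
    moreover have "W $$ (q * L + m, p) = of_real (chi (real m / real L)) *
        (of_real (1 / sqrt (real L)) * ee (- (real m * real j / real L))) * of_real (chi (real j / real L))"
      using lt p m j by (simp add: W_def q_def[symmetric] j_def[symmetric] dft_mat_index)
    ultimately show "cnj (F $$ (q * L + m, i)) * W $$ (q * L + m, p) =
      (of_real (chi (real j / real L)) * of_real (1 / sqrt (real N) * (1 / sqrt (real L))) *
      ee (real q * real i / real M)) *
      (of_real (chi (real m / real L)) * ee (real m * ((real i - real M * real j) / real N)))"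
      by (simp add: mult_ac)
  qed
  finally have e: "(mat_adjoint F * W) $$ (i, p) =
      (of_real (chi (real j / real L)) * of_real (1 / sqrt (real N) * (1 / sqrt (real L))) *
      ee (real q * real i / real M)) * ?s"
    by (simp add: sum_distrib_left)
  have "cmod ((mat_adjoint F * W) $$ (i, p)) =
      \<bar>chi (real j / real L)\<bar> * (1 / sqrt (real N) * (1 / sqrt (real L))) * cmod ?s"
    unfolding e norm_mult by (simp add: norm_divide norm_mult)
  also have "\<dots> \<le> (if chi (real j / real L) \<noteq> 0 then 1 / real L * cmod ?s else 0)"
  proof (cases "chi (real j / real L) = 0")
    case False
    \<comment> \<open>The exact prefactor is \<open>1 / sqrt (N * L)\<close>; a factor
      \<open>1 / sqrt M\<close> is given away.\<close>
    have "L \<le> N" using NL M by simp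
    then have "1 / sqrt (real N) \<le> 1 / sqrt (real L)" using NL by (intro divide_left_mono) auto
    then have "1 / sqrt (real N) * (1 / sqrt (real L)) \<le> 1 / sqrt (real L) * (1 / sqrt (real L))"
      by (intro mult_right_mono) auto
    also have "\<dots> = 1 / real L" by simp
    finally have "\<bar>chi (real j / real L)\<bar> * (1 / sqrt (real N) * (1 / sqrt (real L))) \<le> 1 * (1 / real L)"
      using smooth_cutoff_range[OF chi] by (intro mult_mono) auto
    then show ?thesis using False mult_right_mono[OF _ norm_ge_zero[of ?s]] by fastforce
  qed simp
  finally have "cmod ((mat_adjoint F * W) $$ (i, p)) \<le>
    (if chi (real j / real L) \<noteq> 0 then 1 / real L * cmod ?s else 0)" .
  moreover have "B $$ (i, p) = (mat_adjoint F * W) $$ (i, p) * (if q \<in> A then 1 else 0)"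
    using i p by (simp add: B_eq IA_def mat_diag_mult_right[OF c] q_def del: index_mult_mat(1))
  ultimately show ?thesis
    unfolding q_def[symmetric] j_def[symmetric]
    by (cases "q \<in> A"; cases "chi (real j / real L) = 0") simp_all
qed

end

section \<open>Propagation of localization\<close>

text \<open>The order of quantifiers is the point: \<open>C\<close> depends on \<open>chi\<close>,
  \<open>M\<close> and \<open>n\<close> only, so the decay is uniform in \<open>k\<close>, and
  \<open>R\<close> may grow with \<open>k\<close>.\<close>

lemma kernel_decay:
  assumes chi: "smooth_cutoff chi" and M: "2 \<le> M"
  shows "\<exists>C\<ge>0. \<forall>A k R i p. baker M A chi k \<longrightarrow> 0 < R \<longrightarrow> i < M ^ k \<longrightarrow> p < M ^ k \<longrightarrow>
    R < \<bar>real i - real M * real (p mod M ^ (k - 1))\<bar> \<longrightarrow>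
    cmod (open_baker_map M A chi k $$ (i, p)) \<le> C / R ^ n"
proof -
  obtain C where C: "0 \<le> C" "\<And>L \<theta>. 0 < L \<Longrightarrow>
      cmod (\<Sum>m<L. of_real (chi (real m / real L)) * ee (real m * \<theta>)) * (real L * cmod (ee \<theta> - 1)) ^ n
        \<le> C * real L"
    using smooth_sum_decay[OF chi, of n] by blast
  obtain c where c: "0 < c" "c \<le> 1 / 2" "\<And>x. chi x \<noteq> 0 \<Longrightarrow> c \<le> x \<and> x \<le> 1 - c"
    using smooth_cutoff_margin[OF chi] by blast
  \<comment> \<open>As \<open>L / N = 1 / M\<close>, the quantity \<open>L * cmod (ee t - 1)\<close>
    is at least \<open>L * c * R / N = q * R\<close>.\<close>
  define q where "q = c / real M"
  have q: "0 < q" using c M by (simp add: q_def)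
  show ?thesis
  proof (intro exI[of _ "C / q ^ n"] conjI allI impI)
    show "0 \<le> C / q ^ n" using C q by simp
    fix A k R i p
    assume bk: "baker M A chi k" and R: "0 < R" and i: "i < M ^ k" and p: "p < M ^ k"
      and far: "R < \<bar>real i - real M * real (p mod M ^ (k - 1))\<bar>"
    interpret baker M A chi k by (rule bk)
    define j where "j = p mod L"
    define t where "t = (real i - real M * real j) / real N"
    define s where "s = cmod (\<Sum>m<L. of_real (chi (real m / real L)) * ee (real m * t))"
    have B: "cmod (B $$ (i, p)) \<le> (if p div L \<in> A \<and> chi (real j / real L) \<noteq> 0 then 1 / real L * s else 0)"
    proof -
      have "i < N" "p < N" using i p by (simp_all add: N_def)
      from B_index[OF this] show ?thesis unfolding s_def t_def j_def .
    qed
    show "cmod (open_baker_map M A chi k $$ (i, p)) \<le> C / q ^ n / R ^ n"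
    proof (cases "chi (real j / real L) = 0")
      case True
      then show ?thesis using B C q R by (simp add: B_def)
    next
      case False
      have jL: "real M * real j / real N = real j / real L" using NL M by simp
      have "c \<le> real j / real L" "real j / real L \<le> 1 - c" using c(3)[OF False] by auto
      moreover have "0 \<le> real i / real N" "real i / real N < 1"
      proof -
        have "i < N" using i by (simp add: N_def)
        then show "0 \<le> real i / real N" "real i / real N < 1" by simp_all
      qed
      ultimately have "\<bar>t\<bar> \<le> 1 - c" unfolding t_def diff_divide_distrib jL by linarith
      then have "c * \<bar>t\<bar> \<le> cmod (ee t - 1)" by (rule cmod_ee_minus_one_ge[OF c(1,2)])
      moreover have "R / real N \<le> \<bar>t\<bar>"
        using far NL by (simp add: t_def j_def L_def abs_divide divide_right_mono)
      ultimately have "c * (R / real N) \<le> cmod (ee t - 1)"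
        using c by (meson mult_left_mono order_trans less_imp_le)
      then have "real L * (c * (R / real N)) \<le> real L * cmod (ee t - 1)" by (rule mult_left_mono) simp
      moreover have "real L * (c * (R / real N)) = q * R" using NL M by (simp add: q_def)
      ultimately have "(q * R) ^ n \<le> (real L * cmod (ee t - 1)) ^ n" using q R by (intro power_mono) auto
      then have "s * (q * R) ^ n \<le> s * (real L * cmod (ee t - 1)) ^ n"
        by (rule mult_left_mono) (simp add: s_def)
      also have "\<dots> \<le> C * real L" unfolding s_def by (rule C(2)) (rule NL(2))
      finally have "1 / real L * s \<le> C / (q * R) ^ n"
        using q R NL(2) by (simp add: field_simps)
      then show ?thesis using B C q R by (auto simp: B_def power_mult_distrib split: if_splits)
    qed
  qed
qed

context baker
begin

text \<open>Points with a pseudo-orbit of the expanding map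
  \<open>p \<mapsto> M * (p mod L)\<close>, allowed an error \<open>R\<close> per step, that meets
  blocks with digit in \<open>A\<close> for \<open>s\<close> steps. The recursion prepends a step,
  matching \<open>B ^\<^sub>m Suc s = B ^\<^sub>m s * B\<close>.\<close>

primrec nbhd :: "real \<Rightarrow> nat \<Rightarrow> nat set" where
  "nbhd R 0 = {..<N}"
| "nbhd R (Suc s) = {p. p < N \<and> p div L \<in> A \<and>
    (\<exists>i\<in>nbhd R s. \<bar>real i - real M * real (p mod L)\<bar> \<le> R)}"

lemma nbhd_subset: "nbhd R s \<subseteq> {..<N}"
  by (cases s) auto

text \<open>A column of \<open>B\<close> outside \<open>nbhd R (Suc s)\<close> has only entries of
  size \<eta> in the rows from \<open>nbhd R s\<close>; the other rows fall under the induction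
  hypothesis. As \<open>B\<close> is a contraction, errors add up without being amplified.\<close>

lemma hs_outside_nbhd:
  assumes \<eta>: "0 \<le> \<eta>"
    and far: "\<And>i p. i < N \<Longrightarrow> p < N \<Longrightarrow> R < \<bar>real i - real M * real (p mod L)\<bar> \<Longrightarrow>
      cmod (B $$ (i, p)) \<le> \<eta>"
  shows "hs (B ^\<^sub>m s * ind N (- nbhd R s)) \<le> real s * (real N * \<eta>)"
proof (induction s)
  case 0
  have "B ^\<^sub>m 0 * ind N (- nbhd R 0) = 0\<^sub>m N N"
    using carrier_matD[OF B_carrier] by (intro eq_matI) (auto simp: mat_diag_def)
  moreover have "hs (0\<^sub>m N N) = 0" by (auto simp: hs_eq[of _ N N] L2_set_def intro!: sum.neutral)
  ultimately show ?case by simp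
next
  case (Suc s)
  note m = mult_carrier_mat[of _ N N _ N]
  note a = assoc_mult_mat[of _ N N _ N _ N]
  have Bs: "B ^\<^sub>m s \<in> carrier_mat N N" by simp
  define Y where "Y = B * ind N (- nbhd R (Suc s))"
  have Y: "Y \<in> carrier_mat N N" by (simp add: Y_def m)
  have "ind N (nbhd R s) * Y + ind N (- nbhd R s) * Y = Y"
    using Y by (intro eq_matI) (auto simp: mat_diag_mult_left[OF Y])
  then have "B ^\<^sub>m Suc s * ind N (- nbhd R (Suc s)) =
      B ^\<^sub>m s * (ind N (nbhd R s) * Y + ind N (- nbhd R s) * Y)"
    by (simp add: Y_def a m)
  also have "\<dots> = B ^\<^sub>m s * (ind N (nbhd R s) * Y) + B ^\<^sub>m s * ind N (- nbhd R s) * Y"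
    using Y by (simp add: mult_add_distrib_mat[of _ N N _ N] a m)
  finally have "hs (B ^\<^sub>m Suc s * ind N (- nbhd R (Suc s))) \<le>
      hs (B ^\<^sub>m s * (ind N (nbhd R s) * Y)) + hs (B ^\<^sub>m s * ind N (- nbhd R s) * Y)"
    using hs_triangle[of "B ^\<^sub>m s * (ind N (nbhd R s) * Y)" N N "B ^\<^sub>m s * ind N (- nbhd R s) * Y"] Y
    by (simp add: m)
  also have "hs (B ^\<^sub>m s * (ind N (nbhd R s) * Y)) \<le> hs (ind N (nbhd R s) * Y)"
    using Y by (intro contractionD(2)[OF contraction_pow[OF contraction_B]]) (simp add: m)
  also have "hs (ind N (nbhd R s) * Y) \<le> real N * \<eta>"
  proof (rule hs_le_entry[OF _ \<eta>])
    fix i p assume ip: "i < N" "p < N"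
    have "cmod (B $$ (i, p)) \<le> \<eta>" if "i \<in> nbhd R s" "p \<notin> nbhd R (Suc s)"
    proof (cases "p div L \<in> A")
      case True
      then have "R < \<bar>real i - real M * real (p mod L)\<bar>" using that ip by (auto simp: not_le)
      then show ?thesis using far ip by blast
    next
      case False
      then show ?thesis using B_index[OF ip] \<eta> by simp
    qed
    moreover have "(ind N (nbhd R s) * Y) $$ (i, p) =
        (if i \<in> nbhd R s \<and> p \<in> - nbhd R (Suc s) then B $$ (i, p) else 0)"
      using ip unfolding Y_def ind_mult_index(1)[OF Y[unfolded Y_def] ip] ind_mult_index(2)[OF B_carrier ip]
      by simp
    ultimately show "cmod ((ind N (nbhd R s) * Y) $$ (i, p)) \<le> \<eta>" using \<eta> by (simp del: nbhd.simps)
  qed (use Y in \<open>simp add: m\<close>)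
  also have "hs (B ^\<^sub>m s * ind N (- nbhd R s) * Y) \<le> hs (B ^\<^sub>m s * ind N (- nbhd R s))"
  proof (rule contraction_right)
    show "contraction N Y" unfolding Y_def by (intro contraction_mult contraction_B contraction_ind)
  qed (simp add: m del: nbhd.simps)
  finally show ?case using Suc by (simp add: algebra_simps del: nbhd.simps)
qed

text \<open>The errors do not accumulate: going back one step divides by \<open>M\<close>, and
  \<open>2 * R \<le> M * R\<close>. The term \<open>M ^ (k - s)\<close> is the width of a cell fixed
  by \<open>s\<close> leading digits, which is 1 at \<open>s = k\<close>.\<close>

lemma nbhd_near_cantor_set:
  assumes "0 \<le> R" "s \<le> k" "p \<in> nbhd R s"
  shows "\<exists>c\<in>cantor_set M A s. \<bar>real p - real c * real M ^ (k - s)\<bar> \<le> real M ^ (k - s) + R"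
  using assms(2,3)
proof (induction s arbitrary: p)
  case 0
  then have "p < M ^ k" by (simp add: N_def)
  then have "real p \<le> real M ^ k" by (metis of_nat_less_iff of_nat_power less_imp_le)
  then have "real p \<le> real M ^ k + R" using assms(1) by linarith
  then show ?case by simp
next
  case (Suc s)
  define j where "j = p mod L"
  define q where "q = p div L"
  obtain i where i: "i \<in> nbhd R s" "\<bar>real i - real M * real j\<bar> \<le> R" and q: "q \<in> A"
    using Suc.prems by (auto simp: j_def q_def)
  obtain c where c: "c \<in> cantor_set M A s"
    "\<bar>real i - real c * real M ^ (k - s)\<bar> \<le> real M ^ (k - s) + R"
    using Suc.IH[of i] Suc.prems(1) i(1) by auto
  define u where "u = real M ^ (k - Suc s)"
  have ks: "real M ^ (k - s) = real M * u"
    using Suc.prems(1) by (simp add: u_def Suc_diff_Suc flip: power_Suc)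
  have "L = M ^ s * M ^ (k - Suc s)" using Suc.prems(1) by (simp add: L_def flip: power_add)
  then have L: "real L = real M ^ s * u" by (simp add: u_def)
  have p: "real p = real q * real L + real j"
    unfolding q_def j_def by (metis div_mult_mod_eq of_nat_add of_nat_mult)
  have "\<bar>real M * (real j - real c * u)\<bar> \<le> real M * u + 2 * R"
    using c(2) i(2) unfolding ks by (simp add: algebra_simps abs_le_iff)
  also have "\<dots> \<le> real M * (u + R)" using M assms(1) by (simp add: distrib_left mult_right_mono)
  finally have "\<bar>real j - real c * u\<bar> \<le> u + R" using M by (simp add: abs_mult)
  moreover have "real p - real (c + q * M ^ s) * u = real j - real c * u"
    unfolding p L by (simp add: algebra_simps)
  moreover have "c + q * M ^ s \<in> cantor_set M A (Suc s)"
    using c(1) q by (force simp: cantor_set_Suc)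
  ultimately show ?case unfolding u_def by metis
qed

lemma nbhd_cover:
  assumes "0 \<le> R"
  shows "int ` nbhd R k \<subseteq> (\<lambda>(c, h). c + h) ` (int ` cantor_set M A k \<times> {- \<lfloor>R + 1\<rfloor>..\<lfloor>R + 1\<rfloor>})"
proof
  fix x assume "x \<in> int ` nbhd R k"
  then obtain p where p: "p \<in> nbhd R k" "x = int p" by blast
  obtain c where c: "c \<in> cantor_set M A k" "\<bar>real p - real c\<bar> \<le> 1 + R"
    using nbhd_near_cantor_set[OF assms le_refl p(1)] by auto
  have "of_int \<bar>int p - int c\<bar> \<le> R + 1" using c(2) by simp
  then have "\<bar>int p - int c\<bar> \<le> \<lfloor>R + 1\<rfloor>" by (simp only: le_floor_iff)
  then have "int p - int c \<in> {- \<lfloor>R + 1\<rfloor>..\<lfloor>R + 1\<rfloor>}" by auto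
  then show "x \<in> (\<lambda>(c, h). c + h) ` (int ` cantor_set M A k \<times> {- \<lfloor>R + 1\<rfloor>..\<lfloor>R + 1\<rfloor>})"
    using c(1) p(2) by (intro image_eqI[of _ _ "(int c, int p - int c)"]) auto
qed

lemma card_range_le:
  assumes "1 \<le> R" shows "real (card {- \<lfloor>R + 1\<rfloor>..\<lfloor>R + 1\<rfloor>}) \<le> 5 * R"
proof -
  have "real (card {- \<lfloor>R + 1\<rfloor>..\<lfloor>R + 1\<rfloor>}) = 2 * of_int \<lfloor>R + 1\<rfloor> + 1"
    using assms by (simp add: algebra_simps)
  also have "\<dots> \<le> 5 * R" using assms of_int_floor_le[of "R + 1"] by linarith
  finally show ?thesis .
qed

lemma card_nbhd_le:
  assumes "1 \<le> R" shows "real (card (nbhd R k)) \<le> 5 * R * real (card A) ^ k"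
proof -
  have "card (nbhd R k) = card (int ` nbhd R k)" by (simp add: card_image)
  also have "\<dots> \<le> card ((\<lambda>(c, h). c + h) ` (int ` cantor_set M A k \<times> {- \<lfloor>R + 1\<rfloor>..\<lfloor>R + 1\<rfloor>}))"
    using assms by (intro card_mono nbhd_cover) (auto simp: finite_cantor_set[OF A])
  also have "\<dots> \<le> card (int ` cantor_set M A k \<times> {- \<lfloor>R + 1\<rfloor>..\<lfloor>R + 1\<rfloor>})"
    by (intro card_image_le) (auto simp: finite_cantor_set[OF A])
  also have "\<dots> = card A ^ k * card {- \<lfloor>R + 1\<rfloor>..\<lfloor>R + 1\<rfloor>}"
    by (simp add: card_cartesian_product card_image card_cantor_set[OF A])
  finally have "real (card (nbhd R k)) \<le> real (card A) ^ k * real (card {- \<lfloor>R + 1\<rfloor>..\<lfloor>R + 1\<rfloor>})"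
    by (metis of_nat_le_iff of_nat_mult of_nat_power)
  also have "\<dots> \<le> real (card A) ^ k * (5 * R)"
    by (intro mult_left_mono card_range_le assms) auto
  finally show ?thesis by (simp add: mult_ac)
qed

lemma schatten_sum_nbhd_le:
  assumes "1 \<le> R"
  shows "schatten_sum N id (int ` nbhd R k) id (int ` nbhd R k) \<le>
    (5 * R) ^ 4 * schatten_sum N id (int ` cantor_set M A k) id (int ` cantor_set M A k)"
proof -
  have "schatten_sum N id (int ` nbhd R k) id (int ` nbhd R k) \<le>
    real (card {- \<lfloor>R + 1\<rfloor>..\<lfloor>R + 1\<rfloor>}) ^ 4 *
      schatten_sum N id (int ` cantor_set M A k) id (int ` cantor_set M A k)"
    using assms by (intro schatten_sum_cover2[OF _ _ nbhd_cover]) (simp_all add: finite_cantor_set[OF A])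
  also have "\<dots> \<le> (5 * R) ^ 4 * schatten_sum N id (int ` cantor_set M A k) id (int ` cantor_set M A k)"
    by (intro mult_right_mono power_mono card_range_le assms) auto
  finally show ?thesis .
qed

end

section \<open>Eigenvalue counts\<close>

lemma length_filter_mult_le:
  assumes "0 \<le> t" "\<And>e. e \<in> set es \<Longrightarrow> 0 \<le> f e"
  shows "real (length (filter (\<lambda>e. t \<le> f e) es)) * t \<le> (\<Sum>e\<leftarrow>es. f e)"
  using assms(2) by (induction es) (auto simp: algebra_simps intro: add_increasing)

lemma contraction_entry_le_1:
  assumes K: "contraction n K" and ij: "i < n" "j < n"
  shows "cmod (K $$ (i, j)) \<le> 1"
proof -
  have c: "K \<in> carrier_mat n n" using contractionD(1)[OF K] .
  have "(hs (ind n {j}))\<^sup>2 = (\<Sum>a<n. \<Sum>b<n. if a = j \<and> b = j then 1 else 0)"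
    by (subst hs_sq[of _ n n]) (auto simp: mat_diag_def intro!: sum.cong)
  also have "\<dots> = (\<Sum>a<n. if a = j then 1 else 0)"
    using ij by (intro sum.cong refl) (auto simp: sum.delta)
  also have "\<dots> = 1" using ij by simp
  finally have "hs (ind n {j}) = 1" using hs_nonneg power2_eq_1_iff by (metis abs_of_nonneg abs_1 power2_eq_iff real_sqrt_abs real_sqrt_one)
  moreover have "cmod (K $$ (i, j)) \<le> hs (K * ind n {j})"
    using entry_le_hs[of "K * ind n {j}" n n i j] ij c
    by (simp add: mat_diag_mult_right[OF c])
  moreover have "hs (K * ind n {j}) \<le> hs (ind n {j})" by (intro contractionD(2)[OF K]) simp
  ultimately show ?thesis by simp
qed

context baker
begin

text \<open>All entries of \<open>G\<close> on \<open>X \<times> X\<close> have modulus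
  \<open>1 / sqrt N\<close>, so \<open>hs G\<close> sees only \<open>card X\<close>. The arithmetic
  of \<open>X\<close> enters through \<open>mat_adjoint G * G\<close>, whose entries are exponential
  sums over \<open>X\<close> at differences of its points.\<close>

lemma hs_compressed_dft:
  fixes X defines "G \<equiv> ind N X * mat_adjoint F * ind N X"
  assumes X: "X \<subseteq> {..<N}"
  shows "(hs G)\<^sup>2 = (real (card X))\<^sup>2 / real N"
    and "(hs (mat_adjoint G * G))\<^sup>2 = schatten_sum N id (int ` X) id (int ` X) / (real N)\<^sup>2"
proof -
  note m = mult_carrier_mat[of _ N N _ N]
  have G: "G \<in> carrier_mat N N" by (simp add: G_def m)
  have Gij: "G $$ (i, j) = (if i \<in> X \<and> j \<in> X then of_real (1 / sqrt (real N)) * ee (real i * real j / real N) else 0)"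
    if "i < N" "j < N" for i j
  proof -
    have "mat_adjoint F $$ (i, j) = of_real (1 / sqrt (real N)) * ee (real i * real j / real N)"
      using that by (simp add: mat_adjoint_index[OF carriers(1)]) (simp add: F_def dft_mat_index mult.commute)
    then show ?thesis using that unfolding G_def
      by (simp add: ind_mult_index[of _ N] m del: index_mult_mat(1))
  qed
  have sumX: "(\<Sum>i<N. if i \<in> X then f i else 0) = (\<Sum>i\<in>X. f i)" for f :: "nat \<Rightarrow> 'z :: comm_monoid_add"
    using X by (simp add: sum.If_cases Int_absorb1)
  have "(hs G)\<^sup>2 = (\<Sum>i<N. if i \<in> X then (\<Sum>j<N. if j \<in> X then 1 / real N else 0) else 0)"
    unfolding hs_sq[OF G]
    by (intro sum.cong refl) (auto simp: Gij norm_mult power_divide norm_divide intro!: sum.cong)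
  also have "\<dots> = (real (card X))\<^sup>2 / real N"
    unfolding sumX by (simp add: power2_eq_square)
  finally show "(hs G)\<^sup>2 = (real (card X))\<^sup>2 / real N" .
  have G': "mat_adjoint G \<in> carrier_mat N N" using G by simp
  have GG: "(mat_adjoint G * G) $$ (i, j) = (if i \<in> X \<and> j \<in> X then
      of_real (1 / real N) * (\<Sum>l\<in>X. ee (of_int ((int j - int i) * int l) / real N)) else 0)"
    if ij: "i < N" "j < N" for i j
  proof -
    have s: "complex_of_real (1 / sqrt (real N)) * of_real (1 / sqrt (real N)) = of_real (1 / real N)"
      unfolding of_real_mult[symmetric] by simp
    have "(mat_adjoint G * G) $$ (i, j) = (\<Sum>l<N. cnj (G $$ (l, i)) * G $$ (l, j))"
      using ij by (simp add: mult_mat_index[OF G' G] mat_adjoint_index[OF G] del: index_mult_mat(1))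
    also have "\<dots> = (\<Sum>l<N. if l \<in> X then (if i \<in> X \<and> j \<in> X then
        of_real (1 / real N) * ee (of_int ((int j - int i) * int l) / real N) else 0) else 0)"
    proof (intro sum.cong refl)
      fix l assume l: "l \<in> {..<N}"
      have "ee (- (real l * real i / real N)) * ee (real l * real j / real N) =
          ee (of_int ((int j - int i) * int l) / real N)"
        unfolding ee_add[symmetric]
        by (rule arg_cong[of _ _ ee]) (simp add: diff_divide_distrib algebra_simps)
      moreover have "(c * x) * (c * y) = (c * c) * (x * y)" for c x y :: complex
        by (simp only: mult_ac)
      ultimately have "(of_real (1 / sqrt (real N)) * ee (- (real l * real i / real N))) *
          (of_real (1 / sqrt (real N)) * ee (real l * real j / real N)) =
          of_real (1 / real N) * ee (of_int ((int j - int i) * int l) / real N)"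
        by (simp only: s)
      then show "cnj (G $$ (l, i)) * G $$ (l, j) = (if l \<in> X then (if i \<in> X \<and> j \<in> X then
        of_real (1 / real N) * ee (of_int ((int j - int i) * int l) / real N) else 0) else 0)"
        using l ij by (auto simp: Gij)
    qed
    also have "\<dots> = (if i \<in> X \<and> j \<in> X then
      of_real (1 / real N) * (\<Sum>l\<in>X. ee (of_int ((int j - int i) * int l) / real N)) else 0)"
      unfolding sumX
      by (cases "i \<in> X \<and> j \<in> X") (simp_all only: simp_thms if_True if_False sum.neutral_const sum_distrib_left)
    finally show ?thesis .
  qed
  have "(hs (mat_adjoint G * G))\<^sup>2 = (\<Sum>i<N. if i \<in> X then (\<Sum>j<N. if j \<in> X then
      (cmod (\<Sum>l\<in>X. ee (of_int ((int j - int i) * int l) / real N)))\<^sup>2 / (real N)\<^sup>2 else 0) else 0)"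
    using G' G by (subst hs_sq[of _ N N], simp add: m)
      (intro sum.cong refl, auto simp: GG norm_mult power_divide norm_divide simp del: index_mult_mat(1) intro!: sum.cong)
  also have "\<dots> = (\<Sum>i\<in>X. \<Sum>j\<in>X. (cmod (\<Sum>l\<in>X. ee (of_int ((int j - int i) * int l) / real N)))\<^sup>2) / (real N)\<^sup>2"
    unfolding sumX by (simp add: sum_divide_distrib)
  also have "(\<Sum>i\<in>X. \<Sum>j\<in>X. (cmod (\<Sum>l\<in>X. ee (of_int ((int j - int i) * int l) / real N)))\<^sup>2) =
      schatten_sum N int X int X"
    unfolding schatten_sum_def by (rule sum.swap)
  also have "\<dots> = schatten_sum N id (int ` X) id (int ` X)"
    by (simp add: schatten_sum_def sum.reindex)
  finally show "(hs (mat_adjoint G * G))\<^sup>2 = schatten_sum N id (int ` X) id (int ` X) / (real N)\<^sup>2" .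
qed

text \<open>Chebyshev's inequality for second and fourth powers of the roots of
  \<open>B ^\<^sub>m k\<close> gives the first two bounds. The third is left in exponential form;
  logarithms to base \<open>N\<close> turn it into a count of order \<open>card X\<close>.\<close>

theorem eigenvalue_count_bounds:
  fixes \<nu> \<eta> :: real and X :: "nat set"
  assumes small: "0 < \<eta>" "\<eta> \<le> 1" "4 * sqrt (\<eta> * real N) \<le> 1"
    and loc: "hs (B ^\<^sub>m k * ind N (- X)) \<le> \<eta>" and X: "X \<subseteq> {..<N}"
  defines "cnt \<equiv> real (eigenvalue_count M A chi k \<nu>)"
  shows "cnt * real N powr (- 2 * \<nu>) \<le> 2 * (real (card X))\<^sup>2 / real N + 32 * \<eta> * real N"
    and "cnt * real N powr (- 4 * \<nu>) \<le>
      2 * schatten_sum N id (int ` X) id (int ` X) / (real N)\<^sup>2 + 288 * \<eta> * (real N)\<^sup>2"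
    and "0 < \<nu> \<Longrightarrow> \<eta> \<le> real N powr (- \<nu> - 3) \<Longrightarrow>
      real N powr cnt \<le> 3 * (2 * real N powr (\<nu> + 2)) ^ card X"
proof -
  obtain es where es: "char_poly B = (\<Prod>e\<leftarrow>es. [:- e, 1:])"
    using char_poly_factorized[OF B_carrier] by blast
  define es' where "es' = map (\<lambda>e. e ^ k) es"
  have es': "char_poly (B ^\<^sub>m k) = (\<Prod>e\<leftarrow>es'. [:- e, 1:])"
    unfolding es'_def by (rule char_poly_pow[OF B_carrier es])
  define a where "a = real N powr (- \<nu>)"
  have a: "0 < a" using NL by (simp add: a_def)
  have "cmod e \<ge> real M powr (- \<nu>) \<longleftrightarrow> a \<le> cmod (e ^ k)" for e
  proof -
    have "a = (real M powr (- \<nu>)) ^ k"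
      using M by (simp add: a_def N_def powr_powr mult.commute flip: powr_realpow)
    then show ?thesis using k by (simp add: norm_power power_mono_iff)
  qed
  then have cnt: "cnt = real (length (filter (\<lambda>e. a \<le> cmod e) es'))"
    unfolding cnt_def eigenvalue_count_def B_def[symmetric] sum_order_char_poly[OF B_carrier es]
    by (simp add: es'_def filter_map o_def)
  interpret localized_contraction N F "B ^\<^sub>m k" X \<eta> es'
    by standard (use NL(3) F_unitary contraction_pow[OF contraction_B] F_B_pow_F small loc es' in auto)
  have G: "localized_contraction.G N F X = ind N X * mat_adjoint F * ind N X"
    by (rule G_def)
  have "cnt * a\<^sup>2 \<le> (\<Sum>e\<leftarrow>es'. (cmod e)\<^sup>2)"
  proof -
    have "a \<le> cmod e \<longleftrightarrow> a\<^sup>2 \<le> (cmod e)\<^sup>2" for e using a by (simp add: abs_le_square_iff[symmetric])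
    then show ?thesis unfolding cnt using length_filter_mult_le[of "a\<^sup>2" es' "\<lambda>e. (cmod e)\<^sup>2"] by simp
  qed
  moreover have "a\<^sup>2 = real N powr (- 2 * \<nu>)"
    using NL by (simp add: a_def powr_powr mult.commute flip: powr_realpow)
  ultimately show "cnt * real N powr (- 2 * \<nu>) \<le> 2 * (real (card X))\<^sup>2 / real N + 32 * \<eta> * real N"
    using sum_eigenvalues_bounds(1)[OF small(3)] hs_compressed_dft(1)[OF X] by (simp add: G)
  have "cnt * a ^ 4 \<le> (\<Sum>e\<leftarrow>es'. (cmod e) ^ 4)"
  proof -
    have "a \<le> cmod e \<longleftrightarrow> a ^ 4 \<le> (cmod e) ^ 4" for e using a by (simp add: power_mono_iff)
    then show ?thesis unfolding cnt using length_filter_mult_le[of "a ^ 4" es' "\<lambda>e. (cmod e) ^ 4"] a by simp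
  qed
  moreover have "a ^ 4 = real N powr (- 4 * \<nu>)"
    using NL by (simp add: a_def powr_powr mult.commute flip: powr_realpow)
  ultimately show "cnt * real N powr (- 4 * \<nu>) \<le>
      2 * schatten_sum N id (int ` X) id (int ` X) / (real N)\<^sup>2 + 288 * \<eta> * (real N)\<^sup>2"
    using sum_eigenvalues_bounds(2)[OF small(3)] hs_compressed_dft(2)[OF X] by (simp add: G)
  show "real N powr cnt \<le> 3 * (2 * real N powr (\<nu> + 2)) ^ card X"
    if \<nu>: "0 < \<nu>" and \<eta>': "\<eta> \<le> real N powr (- \<nu> - 3)"
  proof -
    \<comment> \<open>One power of \<open>N\<close> below \<open>a\<close>, so that
      \<open>a / b = N\<close> and the count appears as an exponent of \<open>N\<close>; the row
      bound \<open>b / N^2\<close> is then \<open>N powr (- \<nu> - 3)\<close>.\<close>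
    define b where "b = real N powr (- \<nu> - 1)"
    have N1: "1 \<le> real N" using NL(3) by simp
    have ab: "a / b = real N" using NL by (simp add: a_def b_def flip: powr_diff)
    have b: "0 < b" "b \<le> 1"
      using NL(3) powr_mono[of "- \<nu> - 1" 0 "real N"] N1 \<nu> by (simp_all add: b_def)
    have ba: "b \<le> a" unfolding a_def b_def using N1 by (intro powr_mono) auto
    have bN: "b / (real N)\<^sup>2 = real N powr (- \<nu> - 3)"
    proof -
      have "b / (real N)\<^sup>2 = real N powr (- \<nu> - 1) / real N powr 2" using NL(3) by (simp add: b_def)
      also have "\<dots> = real N powr (- \<nu> - 1 - 2)" by (simp only: powr_diff)
      also have "- \<nu> - 1 - 2 = - \<nu> - 3" by simp
      finally show ?thesis .
    qed
    \<comment> \<open>The roots are counted for \<open>T\<close>, whose rows outside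
      \<open>X\<close> are small; for \<open>B ^\<^sub>m k\<close> itself these are columns.\<close>
    have "(a / b) ^ length (filter (\<lambda>e. a \<le> cmod e) es') \<le> 3 * (2 * real N / b) ^ card X"
    proof (rule eigenvalue_count_few_rows[OF carriers(3) char_poly_T X NL(3) b(1) ba b(2)])
      show "cmod (T $$ (i, j)) \<le> 1" if "i < N" "j < N" for i j
        using contraction_entry_le_1[OF K that(2,1)] that carrier_matD[OF contractionD(1)[OF K]]
        by (simp add: T_def)
      show "cmod (T $$ (i, j)) \<le> b / (real N)\<^sup>2" if "i < N" "j < N" "i \<notin> X" for i j
        using T_outside[OF that] \<eta>' bN by simp
    qed
    moreover have "2 * real N / b = 2 * real N powr (\<nu> + 2)"
    proof -
      have "real N / b = real N powr 1 / b" by simp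
      also have "\<dots> = real N powr (1 - (- \<nu> - 1))" by (simp only: b_def powr_diff)
      also have "1 - (- \<nu> - 1) = \<nu> + 2" by simp
      finally show ?thesis by simp
    qed
    ultimately show ?thesis using NL unfolding ab cnt by (simp add: powr_realpow)
  qed
qed

end

section \<open>Asymptotics\<close>

lemma eventually_power_ge:
  assumes "2 \<le> (M :: nat)" shows "\<forall>\<^sub>F k in sequentially. c \<le> real (M ^ k)"
proof -
  have "c \<le> real (M ^ k)" if "nat \<lceil>c\<rceil> \<le> k" for k
  proof -
    have "c \<le> real (nat \<lceil>c\<rceil>)" by linarith
    also have "\<dots> \<le> real k" using that by simp
    also have "k < 2 ^ k" by (rule less_exp)
    then have "real k \<le> real (2 ^ k)" by linarith
    also have "(2 :: nat) ^ k \<le> M ^ k" using assms by (intro power_mono) auto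
    then have "real (2 ^ k) \<le> real (M ^ k)" by linarith
    finally show ?thesis .
  qed
  then show ?thesis unfolding eventually_sequentially by blast
qed

locale baker_family =
  fixes M :: nat and A :: "nat set" and chi :: "real \<Rightarrow> real" and \<delta> :: real
  assumes A: "A \<subseteq> {0..<M}" and M: "2 \<le> M" and chi: "smooth_cutoff chi"
    and \<delta>: "real M powr \<delta> = real (card A)" "0 < \<delta>" "\<delta> < 1"
begin

abbreviation "NN k \<equiv> real (M ^ k)"

lemma N_ge_1: "1 \<le> NN k"
  using M by (simp add: Suc_le_eq)

lemma N_pos: "0 < NN k"
  using M by simp

lemma N_powr_mult: "NN k powr a * NN k powr b = NN k powr (a + b)"
  by (simp add: powr_add)

lemma N_powr_mono: "a \<le> b \<Longrightarrow> NN k powr a \<le> NN k powr b"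
  by (intro powr_mono N_ge_1)

lemma N_powr_power: "(NN k powr a) ^ n = NN k powr (real n * a)"
  using N_pos[of k] by (simp add: powr_powr mult.commute flip: powr_realpow)

lemma card_A_power: "real (card A) ^ k = NN k powr \<delta>"
proof -
  have "real (card A) ^ k = (real M powr \<delta>) ^ k" by (simp add: \<delta>)
  also have "\<dots> = (real M ^ k) powr \<delta>"
    using M by (simp add: powr_powr mult.commute flip: powr_realpow)
  finally show ?thesis by simp
qed

lemma localization:
  assumes \<kappa>: "0 < \<kappa>" and P: "0 \<le> P"
  shows "\<forall>\<^sub>F k in sequentially. 0 < k \<and> 4 \<le> NN k \<and>
    hs (open_baker_map M A chi k ^\<^sub>m k * ind (M ^ k) (- baker.nbhd M A k (NN k powr \<kappa>) k)) \<le> NN k powr (- P)"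
proof -
  \<comment> \<open>Besides \<open>P\<close>, three powers of \<open>N\<close> must be paid: one for
    the dimension, one for the number \<open>k\<close> of steps, and one for the constant
    \<open>C\<close>, which is at most \<open>N\<close> eventually.\<close>
  define n where "n = nat \<lceil>(P + 3) / \<kappa>\<rceil>"
  have n: "P + 3 \<le> real n * \<kappa>"
  proof -
    have "(P + 3) / \<kappa> \<le> real n" unfolding n_def by linarith
    then show ?thesis using \<kappa> by (simp add: divide_le_eq)
  qed
  obtain C where C: "0 \<le> C" "\<And>A k R i p. baker M A chi k \<Longrightarrow> 0 < R \<Longrightarrow> i < M ^ k \<Longrightarrow> p < M ^ k \<Longrightarrow>
    R < \<bar>real i - real M * real (p mod M ^ (k - 1))\<bar> \<Longrightarrow>
    cmod (open_baker_map M A chi k $$ (i, p)) \<le> C / R ^ n"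
    using kernel_decay[OF chi M, of n] by blast
  have "\<forall>\<^sub>F k in sequentially. 0 < k \<and> max 4 C \<le> NN k"
    by (intro eventually_conj eventually_gt_at_top eventually_power_ge[OF M])
  then show ?thesis
  proof eventually_elim
    case (elim k)
    interpret baker M A chi k by standard (use A M chi elim in auto)
    define R where "R = NN k powr \<kappa>"
    have R: "0 < R" using N_pos[of k] by (simp add: R_def)
    define \<eta> where "\<eta> = C * NN k powr (- P - 3)"
    have \<eta>: "0 \<le> \<eta>" using C by (simp add: \<eta>_def)
    have "C / R ^ n \<le> \<eta>"
    proof -
      have "1 / R ^ n = NN k powr (- (real n * \<kappa>))"
        unfolding R_def N_powr_power by (simp add: powr_minus_divide)
      also have "\<dots> \<le> NN k powr (- P - 3)" using n by (intro N_powr_mono) simp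
      finally show ?thesis unfolding \<eta>_def using mult_left_mono[OF _ C(1)] by fastforce
    qed
    then have far: "cmod (B $$ (i, p)) \<le> \<eta>"
      if "i < N" "p < N" "R < \<bar>real i - real M * real (p mod L)\<bar>" for i p
      using C(2)[OF baker_axioms R, of i p] that unfolding B_def N_def L_def by linarith
    have "hs (B ^\<^sub>m k * ind N (- nbhd R k)) \<le> real k * (real N * \<eta>)"
      by (rule hs_outside_nbhd[OF \<eta> far])
    also have "\<dots> = real k * NN k * C * NN k powr (- P - 3)" by (simp add: \<eta>_def N_def)
    also have "\<dots> \<le> NN k * NN k * NN k * NN k powr (- P - 3)"
    proof -
      have "k < 2 ^ k" by (rule less_exp)
      also have "(2 :: nat) ^ k \<le> M ^ k" using M by (intro power_mono) auto
      finally have "real k \<le> NN k" by linarith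
      then show ?thesis using elim C(1) N_pos[of k]
        by (intro mult_mono mult_right_mono mult_nonneg_nonneg) auto
    qed
    also have "NN k * NN k * NN k = NN k powr 3"
      using N_pos[of k] by (simp add: powr_numeral power3_eq_cube)
    also have "NN k powr 3 * NN k powr (- P - 3) = NN k powr (- P)" by (simp only: N_powr_mult) simp
    finally show ?case using elim by (simp add: B_def N_def R_def)
  qed
qed

definition cnt :: "real \<Rightarrow> nat \<Rightarrow> real" where
  "cnt \<nu> k = real (eigenvalue_count M A chi k \<nu>)"

text \<open>The radius \<open>N powr \<kappa>\<close> enters with power 2, 4 and 1 in the three
  bounds. The constants are \<open>82 = 2 * 5^2 + 32\<close> and \<open>1250 = 2 * 5^4\<close>, with
  the 5 of \<open>card_range_le\<close>.\<close>

lemma localization_bounds: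
  assumes \<kappa>: "0 < \<kappa>" and P: "3 \<le> P"
  shows "\<forall>\<^sub>F k in sequentially.
    cnt \<nu> k * NN k powr (- 2 * \<nu>) \<le> 82 * NN k powr (2 * \<kappa> + 2 * \<delta> - 1) \<and>
    cnt \<nu> k * NN k powr (- 4 * \<nu>) \<le> 1250 * NN k powr (4 * \<kappa> - 2) *
      schatten_sum (M ^ k) id (int ` cantor_set M A k) id (int ` cantor_set M A k) +
      288 * NN k powr (2 - P) \<and>
    (0 < \<nu> \<longrightarrow> \<nu> + 3 \<le> P \<longrightarrow> cnt \<nu> k \<le> (5 * \<nu> + 17) * NN k powr (\<delta> + \<kappa>))"
proof -
  have "0 \<le> P" using P by simp
  from localization[OF \<kappa> this] show ?thesis
  proof eventually_elim
    case (elim k)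
    then have k: "0 < k" and N4: "4 \<le> NN k" by auto
    interpret baker M A chi k by standard (use A M chi k in auto)
    have Nk: "real N = NN k" "N = M ^ k" by (simp_all add: N_def)
    define R where "R = NN k powr \<kappa>"
    define X where "X = nbhd R k"
    define \<eta> where "\<eta> = NN k powr (- P)"
    have R: "1 \<le> R" unfolding R_def using \<kappa> by (intro ge_one_powr_ge_zero N_ge_1) simp
    have \<eta>N: "\<eta> * NN k \<le> NN k powr (- 2)" "\<eta> * (NN k)\<^sup>2 = NN k powr (2 - P)"
    proof -
      have "\<eta> * NN k = NN k powr (- P) * NN k powr 1" using N_pos[of k] by (simp add: \<eta>_def)
      also have "\<dots> = NN k powr (- P + 1)" by (rule N_powr_mult)
      also have "\<dots> \<le> NN k powr (- 2)" using P by (intro N_powr_mono) simp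
      finally show "\<eta> * NN k \<le> NN k powr (- 2)" .
      have "\<eta> * (NN k)\<^sup>2 = NN k powr (- P) * NN k powr 2" using N_pos[of k] by (simp add: \<eta>_def)
      also have "\<dots> = NN k powr (- P + 2)" by (rule N_powr_mult)
      finally show "\<eta> * (NN k)\<^sup>2 = NN k powr (2 - P)" by (simp add: algebra_simps)
    qed
    have \<eta>: "0 < \<eta>" "\<eta> \<le> 1" "4 * sqrt (\<eta> * real N) \<le> 1"
    proof -
      show "0 < \<eta>" using N_pos[of k] by (simp add: \<eta>_def)
      show "\<eta> \<le> 1" using N_powr_mono[of "- P" 0 k] P M by (simp add: \<eta>_def)
      have "NN k powr (- 2) = 1 / (NN k)\<^sup>2" using N_pos[of k] by (simp add: powr_minus_divide)
      then have "sqrt (\<eta> * NN k) \<le> sqrt (1 / (NN k)\<^sup>2)" using \<eta>N(1) by (intro real_sqrt_le_mono) simp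
      also have "\<dots> = 1 / NN k" using N_pos[of k] by (simp add: real_sqrt_divide)
      also have "\<dots> \<le> 1 / 4" using N4 M by (intro divide_left_mono) auto
      finally show "4 * sqrt (\<eta> * real N) \<le> 1" by (simp add: Nk)
    qed
    have loc: "hs (B ^\<^sub>m k * ind N (- X)) \<le> \<eta>"
      using elim by (simp add: B_def Nk(2) X_def R_def \<eta>_def)
    have XN: "X \<subseteq> {..<N}" unfolding X_def by (rule nbhd_subset)
    note bounds = eigenvalue_count_bounds[OF \<eta> loc XN, of \<nu>, folded cnt_def, unfolded Nk(1)]
    have cX: "real (card X) \<le> 5 * NN k powr (\<delta> + \<kappa>)"
    proof -
      have "real (card X) \<le> 5 * (R * real (card A) ^ k)"
        using card_nbhd_le[OF R] by (simp only: X_def mult.assoc)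
      then show ?thesis by (simp only: R_def card_A_power N_powr_mult add.commute)
    qed
    have "cnt \<nu> k * NN k powr (- 2 * \<nu>) \<le> 2 * (real (card X))\<^sup>2 / NN k + 32 * (\<eta> * NN k)"
      using bounds(1) by simp
    also have "2 * (real (card X))\<^sup>2 / NN k \<le> 50 * NN k powr (2 * \<kappa> + 2 * \<delta> - 1)"
    proof -
      have "(real (card X))\<^sup>2 \<le> (5 * NN k powr (\<delta> + \<kappa>))\<^sup>2" using cX by (intro power_mono) auto
      also have "\<dots> = 25 * NN k powr (2 * (\<delta> + \<kappa>))" unfolding power_mult_distrib N_powr_power by simp
      finally have "2 * (real (card X))\<^sup>2 / NN k \<le> 2 * (25 * NN k powr (2 * (\<delta> + \<kappa>))) / NN k powr 1"
        using N_pos[of k] by (simp add: divide_right_mono)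
      also have "\<dots> = 50 * (NN k powr (2 * (\<delta> + \<kappa>)) / NN k powr 1)" by simp
      also have "NN k powr (2 * (\<delta> + \<kappa>)) / NN k powr 1 = NN k powr (2 * \<kappa> + 2 * \<delta> - 1)"
        unfolding powr_diff[symmetric] by (simp add: algebra_simps)
      finally show ?thesis .
    qed
    also have "\<eta> * NN k \<le> NN k powr (2 * \<kappa> + 2 * \<delta> - 1)"
      using \<eta>N(1) N_powr_mono[of "- 2" "2 * \<kappa> + 2 * \<delta> - 1" k] \<kappa> \<delta> by linarith
    finally have 1: "cnt \<nu> k * NN k powr (- 2 * \<nu>) \<le> 82 * NN k powr (2 * \<kappa> + 2 * \<delta> - 1)" by simp
    let ?S = "schatten_sum (M ^ k) id (int ` cantor_set M A k) id (int ` cantor_set M A k)"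
    have "cnt \<nu> k * NN k powr (- 4 * \<nu>) \<le>
        2 * schatten_sum (M ^ k) id (int ` X) id (int ` X) / (NN k)\<^sup>2 + 288 * (\<eta> * (NN k)\<^sup>2)"
      using bounds(2) by (simp add: Nk(2))
    also have "2 * schatten_sum (M ^ k) id (int ` X) id (int ` X) / (NN k)\<^sup>2 \<le>
        2 * ((5 * R) ^ 4 * ?S) / (NN k)\<^sup>2"
      using schatten_sum_nbhd_le[OF R] by (intro divide_right_mono mult_left_mono) (auto simp: X_def Nk(2))
    also have "\<dots> = 1250 * (NN k powr (4 * \<kappa>) / NN k powr 2) * ?S"
    proof -
      have "R ^ 4 = NN k powr (4 * \<kappa>)" unfolding R_def N_powr_power by simp
      then show ?thesis using N_pos[of k] by (simp add: power_mult_distrib)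
    qed
    also have "NN k powr (4 * \<kappa>) / NN k powr 2 = NN k powr (4 * \<kappa> - 2)" by (simp only: powr_diff)
    finally have 2: "cnt \<nu> k * NN k powr (- 4 * \<nu>) \<le> 1250 * NN k powr (4 * \<kappa> - 2) * ?S + 288 * NN k powr (2 - P)"
      by (simp only: \<eta>N(2))
    have 3: "cnt \<nu> k \<le> (5 * \<nu> + 17) * NN k powr (\<delta> + \<kappa>)" if \<nu>: "0 < \<nu>" "\<nu> + 3 \<le> P"
    proof -
      have "\<eta> \<le> NN k powr (- \<nu> - 3)" unfolding \<eta>_def using \<nu> by (intro N_powr_mono) simp
      from bounds(3)[OF \<nu>(1) this]
      have "NN k powr cnt \<nu> k \<le> 3 * (2 * NN k powr (\<nu> + 2)) ^ card X" .
      \<comment> \<open>The constants 3 and 2 are replaced by \<open>N\<close>, so that both sides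
        are powers of \<open>N\<close> and the exponents can be compared.\<close>
      also have "\<dots> \<le> NN k powr 1 * (NN k powr 1 * NN k powr (\<nu> + 2)) ^ card X"
        using N4 N_pos[of k] by (intro mult_mono power_mono) auto
      also have "\<dots> = NN k powr (1 + real (card X) * (\<nu> + 3))"
        unfolding N_powr_mult N_powr_power by (simp add: algebra_simps)
      finally have "cnt \<nu> k \<le> 1 + real (card X) * (\<nu> + 3)" using N4 by (simp add: powr_le_cancel_iff)
      also have "\<dots> \<le> NN k powr (\<delta> + \<kappa>) + 5 * NN k powr (\<delta> + \<kappa>) * (\<nu> + 3)"
        using cX N_powr_mono[of 0 "\<delta> + \<kappa>" k] \<kappa> \<delta> \<nu> N_pos[of k]
        by (intro add_mono mult_right_mono) auto
      also have "\<dots> \<le> (5 * \<nu> + 17) * NN k powr (\<delta> + \<kappa>)" by (simp add: algebra_simps)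
      finally show ?thesis .
    qed
    show ?case using 1 2 3 by blast
  qed
qed

section \<open>The four upper bounds for the eigenvalue count\<close>

lemma cnt_from_weighted:
  assumes "cnt \<nu> k * NN k powr (- a) \<le> C * NN k powr b"
  shows "cnt \<nu> k \<le> C * NN k powr (a + b)"
proof -
  have "NN k powr (- a) * NN k powr a = 1"
    unfolding N_powr_mult using N_pos[of k] by (simp del: of_nat_power)
  then have "cnt \<nu> k = cnt \<nu> k * NN k powr (- a) * NN k powr a"
    by (simp only: mult.assoc mult_1_right)
  also have "\<dots> \<le> C * NN k powr b * NN k powr a" using assms by (intro mult_right_mono) auto
  finally show ?thesis by (simp only: mult.assoc N_powr_mult add.commute)
qed

lemma count_hs:
  assumes "0 < \<epsilon>"
  shows "\<exists>C>0. \<forall>\<^sub>F k in sequentially. cnt \<nu> k \<le> C * NN k powr (2 * (\<nu> - (1 / 2 - \<delta>)) + \<epsilon>)"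
proof (intro exI[of _ 82] conjI)
  have "0 < \<epsilon> / 2" using assms by simp
  from localization_bounds[OF this order_refl, of \<nu>]
  show "\<forall>\<^sub>F k in sequentially. cnt \<nu> k \<le> 82 * NN k powr (2 * (\<nu> - (1 / 2 - \<delta>)) + \<epsilon>)"
  proof eventually_elim
    case (elim k)
    then have "cnt \<nu> k * NN k powr (- (2 * \<nu>)) \<le> 82 * NN k powr (\<epsilon> + 2 * \<delta> - 1)" by simp
    from cnt_from_weighted[OF this] show ?case by (simp add: algebra_simps)
  qed
qed simp

lemma count_rank:
  assumes "0 < \<epsilon>" "0 < \<nu>"
  shows "\<exists>C>0. \<forall>\<^sub>F k in sequentially. cnt \<nu> k \<le> C * NN k powr (\<delta> + \<epsilon>)"
proof (intro exI[of _ "5 * \<nu> + 17"] conjI)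
  have "3 \<le> \<nu> + 3" using assms by simp
  from localization_bounds[OF assms(1) this, of \<nu>]
  show "\<forall>\<^sub>F k in sequentially. cnt \<nu> k \<le> (5 * \<nu> + 17) * NN k powr (\<delta> + \<epsilon>)"
    by eventually_elim (use assms in auto)
qed (use assms in simp)

lemma count_schatten:
  assumes \<epsilon>: "0 < \<epsilon>" and C: "0 < C"
    and S: "\<And>k. schatten_sum (M ^ k) id (int ` cantor_set M A k) id (int ` cantor_set M A k)
      \<le> C * NN k powr (2 - 4 * b)"
  shows "\<exists>C>0. \<forall>\<^sub>F k in sequentially. cnt \<nu> k \<le> C * NN k powr (4 * (\<nu> - b) + \<epsilon>)"
proof (intro exI[of _ "1250 * C + 288"] conjI)
  \<comment> \<open>\<open>P\<close> is large enough for the error \<open>N powr (2 - P)\<close> to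
    stay below \<open>N powr (- 4 * b)\<close>; the radius exponent is \<open>\<epsilon> / 4\<close>
    because the radius enters to the fourth power.\<close>
  define P where "P = max 3 (2 + 4 * b)"
  have \<kappa>: "0 < \<epsilon> / 4" and P: "3 \<le> P" "2 - P \<le> - 4 * b" using \<epsilon> by (auto simp: P_def)
  from localization_bounds[OF \<kappa> P(1), of \<nu>]
  show "\<forall>\<^sub>F k in sequentially. cnt \<nu> k \<le> (1250 * C + 288) * NN k powr (4 * (\<nu> - b) + \<epsilon>)"
  proof eventually_elim
    case (elim k)
    let ?S = "schatten_sum (M ^ k) id (int ` cantor_set M A k) id (int ` cantor_set M A k)"
    have "cnt \<nu> k * NN k powr (- (4 * \<nu>)) \<le> 1250 * NN k powr (\<epsilon> - 2) * ?S + 288 * NN k powr (2 - P)"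
      using elim by simp
    also have "1250 * NN k powr (\<epsilon> - 2) * ?S \<le> 1250 * NN k powr (\<epsilon> - 2) * (C * NN k powr (2 - 4 * b))"
      by (intro mult_left_mono S) auto
    also have "\<dots> = 1250 * C * (NN k powr (\<epsilon> - 2) * NN k powr (2 - 4 * b))" by simp
    also have "\<dots> = 1250 * C * NN k powr (\<epsilon> - 4 * b)" unfolding N_powr_mult by simp
    also have "NN k powr (2 - P) \<le> NN k powr (\<epsilon> - 4 * b)" using P \<epsilon> by (intro N_powr_mono) simp
    finally have "cnt \<nu> k * NN k powr (- (4 * \<nu>)) \<le> (1250 * C + 288) * NN k powr (\<epsilon> - 4 * b)"
      by (simp add: algebra_simps)
    from cnt_from_weighted[OF this] show ?case by (simp add: algebra_simps)
  qed
qed (use C in simp)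

text \<open>The trivial bound \<open>card A ^ (4 * k) = N powr (4 * \<delta>)\<close> corresponds to
  \<open>\<beta> = 1 / 2 - \<delta>\<close>. A fixed factor \<open>c < 1\<close> for every two
  digits is a power of \<open>N\<close>, and this makes the inequality for \<beta> strict.\<close>

lemma schatten_sum_exponent:
  obtains \<beta> C where "1 / 2 - \<delta> < \<beta>" "0 < C"
    "\<And>k. schatten_sum (M ^ k) id (int ` cantor_set M A k) id (int ` cantor_set M A k)
      \<le> C * NN k powr (2 - 4 * \<beta>)"
proof -
  have "1 < real M powr \<delta>" using gr_one_powr[of "real M" \<delta>] M \<delta>(2) by simp
  then have "2 \<le> card A" using \<delta>(1) by simp
  from schatten_sum_cantor_gain[OF A this] obtain c where c: "0 < c" "c < 1"
    "\<And>k. schatten_sum (M ^ k) id (int ` cantor_set M A k) id (int ` cantor_set M A k)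
      \<le> real (card A) ^ (4 * k) * c ^ (k div 2)"
    by blast
  \<comment> \<open>Chosen such that \<open>c powr (k / 2) = N powr (- 4 * \<tau>)\<close>; rounding
    in \<open>k div 2\<close> costs at most the constant \<open>1 / c\<close>.\<close>
  define \<tau> where "\<tau> = - log (real M) c / 8"
  have logc: "log (real M) c < 0" using c M by (simp add: log_less_zero_cancel_iff)
  have \<tau>: "0 < \<tau>" using logc by (simp add: \<tau>_def)
  have "schatten_sum (M ^ k) id (int ` cantor_set M A k) id (int ` cantor_set M A k)
      \<le> 1 / c * NN k powr (2 - 4 * (1 / 2 - \<delta> + \<tau>))" for k
  proof -
    have "c ^ (k div 2) = c powr real (k div 2)" using c by (simp add: powr_realpow)
    also have "\<dots> \<le> c powr (real k / 2 - 1)"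
    proof (rule powr_mono')
      show "real k / 2 - 1 \<le> real (k div 2)" by linarith
    qed (use c in auto)
    also have "\<dots> = 1 / c * c powr (real k / 2)" using c by (simp add: powr_diff)
    also have "c powr (real k / 2) = NN k powr (- 4 * \<tau>)"
    proof -
      have "c = real M powr (- 8 * \<tau>)" using M c by (simp add: \<tau>_def)
      then have "c powr (real k / 2) = real M powr (- 8 * \<tau> * (real k / 2))" by (metis powr_powr)
      also have "\<dots> = (real M powr real k) powr (- 4 * \<tau>)" unfolding powr_powr by (simp add: algebra_simps)
      also have "real M powr real k = NN k" using M by (simp add: powr_realpow)
      finally show ?thesis .
    qed
    finally have gain: "c ^ (k div 2) \<le> 1 / c * NN k powr (- 4 * \<tau>)" .
    have card: "real (card A) ^ (4 * k) = NN k powr (4 * \<delta>)"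
    proof -
      have "real (card A) ^ (4 * k) = (real (card A) ^ k) ^ 4"
        by (simp only: power_mult[symmetric] mult.commute)
      also have "\<dots> = NN k powr (real 4 * \<delta>)" by (simp only: card_A_power N_powr_power)
      finally show ?thesis by simp
    qed
    have "real (card A) ^ (4 * k) * c ^ (k div 2) \<le> NN k powr (4 * \<delta>) * (1 / c * NN k powr (- 4 * \<tau>))"
      unfolding card by (intro mult_left_mono gain) simp
    also have "\<dots> = 1 / c * (NN k powr (4 * \<delta>) * NN k powr (- 4 * \<tau>))" by simp
    also have "\<dots> = 1 / c * NN k powr (2 - 4 * (1 / 2 - \<delta> + \<tau>))"
      unfolding N_powr_mult by (simp add: algebra_simps)
    finally show ?thesis using c(3)[of k] by linarith
  qed
  then show thesis using that[of "1 / 2 - \<delta> + \<tau>" "1 / c"] \<tau> c(1) by simp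
qed

lemma count_energy:
  assumes \<gamma>: "additive_energy_exponent M A \<gamma>" "cantor_dim M A = \<delta>" and \<epsilon>: "0 < \<epsilon>"
  shows "\<exists>C>0. \<forall>\<^sub>F k in sequentially. cnt \<nu> k \<le> C * NN k powr (4 * (\<nu> - beta_E \<delta> \<gamma>) + \<epsilon>)"
proof -
  have "0 < \<gamma>" "0 < \<epsilon> / 2" using \<gamma> \<epsilon> by (auto simp: additive_energy_exponent_def)
  then obtain C where C: "0 < C" "\<And>k. real (additive_energy (M ^ k) (cantor_set M A k))
      \<le> C * NN k powr (3 * \<delta> - \<gamma> + \<epsilon> / 2)"
    using \<gamma> unfolding additive_energy_exponent_def by metis
  \<comment> \<open>Solves
    \<open>2 - 4 * b = 1 / 2 + 3 * \<delta> - \<gamma> + \<epsilon> / 2\<close>, the exponent of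
    \<open>sqrt N\<close> times the energy. So \<open>b\<close> contains \<open>\<gamma> / 4\<close>
    where \<open>beta_E\<close> has \<open>\<gamma> / 8\<close>; the difference is given away at the
    end.\<close>
  define b where "b = 3 / 8 - 3 / 4 * \<delta> + \<gamma> / 4 - \<epsilon> / 8"
  have "schatten_sum (M ^ k) id (int ` cantor_set M A k) id (int ` cantor_set M A k)
      \<le> C * NN k powr (2 - 4 * b)" for k
  proof -
    have "schatten_sum (M ^ k) id (int ` cantor_set M A k) id (int ` cantor_set M A k) \<le>
        sqrt (NN k) * real (additive_energy (M ^ k) (cantor_set M A k))"
      using M by (intro schatten_sum_le_energy finite_cantor_set[OF A]) simp
    also have "\<dots> \<le> NN k powr (1 / 2) * (C * NN k powr (3 * \<delta> - \<gamma> + \<epsilon> / 2))"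
      using N_pos[of k] C by (intro mult_mono) (auto simp: powr_half_sqrt)
    also have "\<dots> = C * (NN k powr (1 / 2) * NN k powr (3 * \<delta> - \<gamma> + \<epsilon> / 2))" by simp
    also have "\<dots> = C * NN k powr (2 - 4 * b)"
      unfolding N_powr_mult by (simp add: b_def algebra_simps)
    finally show ?thesis .
  qed
  from count_schatten[OF _ C(1) this, of "\<epsilon> / 2" \<nu>] \<epsilon>
  obtain C' where C': "0 < C'" "\<forall>\<^sub>F k in sequentially. cnt \<nu> k \<le> C' * NN k powr (4 * (\<nu> - b) + \<epsilon> / 2)"
    by auto
  have "4 * (\<nu> - b) + \<epsilon> / 2 \<le> 4 * (\<nu> - beta_E \<delta> \<gamma>) + \<epsilon>"
  proof -
    have "4 * (\<nu> - b) + \<epsilon> / 2 = 4 * \<nu> - 3 / 2 + 3 * \<delta> - \<gamma> + \<epsilon>"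
      by (simp add: b_def field_simps)
    moreover have "4 * (\<nu> - beta_E \<delta> \<gamma>) + \<epsilon> = 4 * \<nu> - 3 / 2 + 3 * \<delta> - \<gamma> / 2 + \<epsilon>"
      by (simp add: beta_E_def field_simps)
    ultimately show ?thesis using \<open>0 < \<gamma>\<close> by linarith
  qed
  then have "C' * NN k powr (4 * (\<nu> - b) + \<epsilon> / 2) \<le> C' * NN k powr (4 * (\<nu> - beta_E \<delta> \<gamma>) + \<epsilon>)" for k
    using C'(1) by (intro mult_left_mono N_powr_mono) auto
  then show ?thesis using C' by (intro exI[of _ C'] conjI) (auto elim!: eventually_mono intro: order_trans)
qed

end

theorem theorem1p3:
  fixes M :: nat and A :: "nat set" and chi :: "real \<Rightarrow> real" and \<delta> \<gamma> :: real
  assumes "A \<subseteq> {0..<M}"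
    and "\<delta> = cantor_dim M A"
    and "0 < \<delta>" and "\<delta> < 1"
    and "smooth_cutoff chi"
    and "additive_energy_exponent M A \<gamma>"
  shows "\<exists>\<beta> > 1 / 2 - \<delta>. \<forall>\<nu> > 0. \<forall>\<epsilon> > 0. \<exists>C > 0. \<forall>\<^sub>F k in sequentially.
           real (eigenvalue_count M A chi k \<nu>)
             \<le> C * real (M ^ k) powr (weyl_exponent \<beta> (beta_E \<delta> \<gamma>) \<nu> \<delta> + \<epsilon>)"
proof -
  \<comment> \<open>For \<open>M\<close> equal to 0 or 1 the denominator \<open>ln M\<close> is 0 by
    the convention \<open>ln 0 = 0\<close>, and division by 0 gives 0, against
    \<open>0 < \<delta>\<close>. An empty \<open>A\<close> is excluded below by the same
    convention.\<close>
  have M: "2 \<le> M"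
  proof (rule ccontr)
    assume "\<not> 2 \<le> M"
    then have "M = 0 \<or> M = 1" by auto
    then show False using assms(2,3) by (auto simp: cantor_dim_def)
  qed
  have "card A \<noteq> 0"
    using assms(2,3) by (intro notI) (simp add: cantor_dim_def)
  then have "real M powr \<delta> = real (card A)"
    using M by (simp add: assms(2) cantor_dim_def powr_def)
  then have "baker_family M A chi \<delta>"
    using assms M by (simp add: baker_family_def)
  then interpret baker_family M A chi \<delta> .
  obtain \<beta> C where \<beta>: "1 / 2 - \<delta> < \<beta>" "0 < C"
    "\<And>k. schatten_sum (M ^ k) id (int ` cantor_set M A k) id (int ` cantor_set M A k)
      \<le> C * NN k powr (2 - 4 * \<beta>)"
    using schatten_sum_exponent by blast
  show ?thesis
  proof (rule exI[of _ \<beta>], intro conjI allI impI \<beta>(1))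
    fix \<nu> \<epsilon> :: real assume \<nu>: "0 < \<nu>" and \<epsilon>: "0 < \<epsilon>"
    define E where "E = {4 * (\<nu> - \<beta>), 4 * (\<nu> - beta_E \<delta> \<gamma>), 2 * (\<nu> - (1 / 2 - \<delta>)), \<delta>}"
    have "weyl_exponent \<beta> (beta_E \<delta> \<gamma>) \<nu> \<delta> = Min E" by (simp only: weyl_exponent_def E_def)
    \<comment> \<open>The minimum is one of the four numbers, so four separate bounds suffice; the
      constant is that of the bound attaining it.\<close>
    also have "Min E \<in> E" by (rule Min_in) (auto simp: E_def)
    finally show "\<exists>C > 0. \<forall>\<^sub>F k in sequentially. real (eigenvalue_count M A chi k \<nu>)
             \<le> C * real (M ^ k) powr (weyl_exponent \<beta> (beta_E \<delta> \<gamma>) \<nu> \<delta> + \<epsilon>)"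
      using count_schatten[OF \<epsilon> \<beta>(2,3), of \<nu>] count_energy[OF assms(6) assms(2)[symmetric] \<epsilon>, of \<nu>]
        count_hs[OF \<epsilon>, of \<nu>] count_rank[OF \<epsilon> \<nu>]
      unfolding E_def cnt_def by auto
  qed
qed

end
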